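(* Let $(M,\pi)$ be a $d$-dimensional Poisson manifold, $\mathcal{D}$ a flat, torsion-free contravariant $\mathcal{F}^{reg}$-connection on $M$ with associated tensor $\mathbf{T}$ on $M^{reg}$, and $x\in M^{reg}$ a point where $\pi$ has rank $2r$. Let $\mathcal{H}$ be a smooth subbundle of $T^*M$ near $x$ with $T^*M=\operatorname{Ker}\pi_\sharp\oplus\mathcal{H}$ and $\mathcal{D}\mathcal{H}\subseteq\mathcal{H}$, let $(x_i,y_u)$ ($1\le i\le 2r$, $1\le u\le d-2r$) be a flat coordinate system around $x$, and let $\phi_i$, $A_i^u$, $\pi_{ij}$, $\pi^{ij}$ be as in the context. Then, near $x$: (i) For any $u=1,\ldots,d-2r$, $\mathbf{T}(dy_u,\cdot\,)=0$. (ii) For any $i,j=1,\ldots,2r$, $$\begin{aligned}\mathbf{T}(\phi_i,\phi_j)=&-\sum_{k<l}\frac{\partial^2\pi_{kl}}{\partial x_i\partial x_j}\,\phi_k\wedge\phi_l+\sum_{k,u}\frac{\partial^2A_k^u}{\partial x_i\partial x_j}\,\phi_k\wedge dy_u\\&+\sum_{u<v,\,k}\frac{\partial}{\partial x_i}\biggl(\pi^{jk}\Bigl(\frac{\partial A_k^u}{\partial y_v}-\frac{\partial A_k^v}{\partial y_u}+\sum_l A_l^u\frac{\partial A_k^v}{\partial x_l}-A_l^v\frac{\partial A_k^u}{\partial x_l}\Bigr)\biggr)dy_u\wedge dy_v,\end{aligned}$$ where the indices $k,l$ range over $1,\ldots,2r$, the indices $u,v$ over $1,\ldots,d-2r$,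 and $\sum_l$ applies to both terms following it.
   Context: All objects are smooth. For a Poisson manifold $(M,\pi)$, the anchor $\pi_\sharp:T^*M\to TM$ is defined by $\beta(\pi_\sharp(\alpha))=\pi(\alpha,\beta)$. The Koszul bracket on 1-forms is $[\alpha,\beta]_\pi=L_{\pi_\sharp(\alpha)}\beta-L_{\pi_\sharp(\beta)}\alpha-d(\pi(\alpha,\beta))$; for a 1-form $\alpha$ it is extended to $[\alpha,\cdot]_\pi$ on all forms as the derivation of the wedge product with $[\alpha,f]_\pi=\pi_\sharp(\alpha)(f)$. $M^{reg}$ is the dense open set of points near which the rank of $\pi$ is constant; $\mathcal{S}$ is the symplectic foliation and $T\mathcal{S}=\operatorname{Im}\pi_\sharp$. A contravariant connection on $(M,\pi)$ is an $\mathbb{R}$-bilinear map $\mathcal{D}:\Omega^1(M)\times\Omega^1(M)\to\Omega^1(M)$ with $\mathcal{D}_{f\alpha}\beta=f\mathcal{D}_\alpha\beta$ and $\mathcal{D}_\alpha(f\beta)=f\mathcal{D}_\alpha\beta+\pi_\sharp(\alpha)(f)\beta$; it is local and extends to tensor fields as usual (with $\mathcal{D}_\alpha f=\pi_\sharp(\alpha)(f)$). It is torsion-free if $\mathcal{D}_\alpha\beta-\mathcal{D}_\beta\alpha=[\alpha,\beta]_\pi$, flat if $\mathcal{D}_\alpha\mathcal{D}_\beta\gamma-\mathcal{D}_\beta\mathcal{D}_\alpha\gamma-\mathcal{D}_{[\alpha,\beta]_\pi}\gamma=0$, an $\mathcal{F}$-connection if $\pi_\sharp(a)=0$ implies $\mathcal{D}_a=0$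 for all $a\in T^*M$, and an $\mathcal{F}^{reg}$-connection if its restriction to $M^{reg}$ is an $\mathcal{F}$-connection. A form $\eta$ is parallel if $\mathcal{D}\eta=0$, i.e. $\mathcal{D}_\gamma\eta=0$ for all 1-forms $\gamma$. $\mathcal{D}\mathcal{H}\subseteq\mathcal{H}$ means $\mathcal{D}_\alpha\beta\in\Gamma(\mathcal{H})$ for every 1-form $\alpha$ and $\beta\in\Gamma(\mathcal{H})$; such complements $\mathcal{H}$ of $\operatorname{Ker}\pi_\sharp$ exist near every point of $M^{reg}$ when $\mathcal{D}$ is flat, torsion-free and $\mathcal{F}^{reg}$. For such $\mathcal{H}$, $\varpi^{\mathcal{H}}:T\mathcal{S}\to\mathcal{H}$ denotes the inverse of the isomorphism $\pi_\sharp|_{\mathcal{H}}:\mathcal{H}\to T\mathcal{S}$. Flat coordinate system: an $\mathcal{S}$-foliated coordinate system $(x_i,y_u)$ around $x$ (the $x_i$ are leafwise coordinates, the $y_u$ are transverse ones, so $T\mathcal{S}=\operatorname{span}\{\partial/\partial x_i\}$ and $\operatorname{Ker}\pi_\sharp=\operatorname{span}\{dy_u\}$) such that, for any smooth subbundle $\mathcal{H}$ of $T^*M$ near $x$ with $T^*M=\operatorname{Ker}\pi_\sharp\oplus\mathcal{H}$ and $\mathcal{D}\mathcal{H}\subseteq\mathcal{H}$, the 1-forms $\phi_i:=\varpi^{\mathcal{H}}(\partial/\partial x_i)$ and $dy_u$ form a coframe near $x$ consisting of parallel forms. Such systems exist around every point of $M^{reg}$. The functions $A_i^u$ are the unique functions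 near $x$ such that $dx_i+\sum_{u}A_i^u\,dy_u\in\Gamma(\mathcal{H})$ for each $i$. Also $\pi_{ij}:=\pi(dx_i,dx_j)$ and $(\pi^{ij})$ is the inverse matrix of $(\pi_{ij})_{1\le i,j\le 2r}$. The Hawkins bracket of $\mathcal{D}$ on 1-forms is the 2-form $\{\alpha,\beta\}=-\mathcal{D}_\alpha d\beta-\mathcal{D}_\beta d\alpha+d\mathcal{D}_\beta\alpha+[\alpha,d\beta]_\pi$. The tensor $\mathbf{T}$ on $M^{reg}$: for $x\in M^{reg}$ and $a,b\in T_x^*M$, $\mathbf{T}_x(a,b):=\{\alpha,\beta\}(x)\in\wedge^2T_x^*M$, where $\alpha,\beta$ are parallel 1-forms defined near $x$ with $\alpha(x)=a$, $\beta(x)=b$ (such forms exist and the result is independent of the choice; one has $\mathbf{T}_x(a,b)=-(\mathcal{D}_\alpha d\beta)(x)=-(\mathcal{D}_\beta d\alpha)(x)$). *)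

theory Defs
  imports "HOL-Analysis.Analysis"
begin

section \<open>Smooth functions on open subsets of Euclidean space\<close>

definition partial :: "'d::finite \<Rightarrow> (real^'d \<Rightarrow> real) \<Rightarrow> real^'d \<Rightarrow> real" where
  "partial k f a = deriv (\<lambda>t. f (a + t *\<^sub>R axis k 1)) 0"

primrec Ck_on :: "nat \<Rightarrow> (real^'d::finite) set \<Rightarrow> (real^'d \<Rightarrow> real) \<Rightarrow> bool" where
  "Ck_on 0 S f \<longleftrightarrow> continuous_on S f"
| "Ck_on (Suc n) S f \<longleftrightarrow> f differentiable_on S \<and> (\<forall>k. Ck_on n S (partial k f))"

text \<open>Only used for open \<^term>\<open>S\<close>, where differentiability on \<^term>\<open>S\<close> is differentiability
  at every point.\<close>

definition Cinf_on :: "(real^'d::finite) set \<Rightarrow> (real^'d \<Rightarrow> real) \<Rightarrow> bool" where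
  "Cinf_on S f \<longleftrightarrow> (\<forall>n. Ck_on n S f)"


section \<open>Smooth manifolds\<close>

text \<open>A chart is a domain together with a coordinate map, whose values outside the domain are
  irrelevant. The manifold is the whole (Hausdorff, second countable) type \<^typ>\<open>'m\<close>, its
  dimension is \<^term>\<open>CARD('d)\<close>, and its smooth structure is a maximal atlas. Hence the coordinate
  systems of the manifold are exactly the elements of the atlas.\<close>

type_synonym ('m, 'd) chart = "'m set \<times> ('m \<Rightarrow> real^'d)"

definition chart_inv :: "('m, 'd::finite) chart \<Rightarrow> real^'d \<Rightarrow> 'm" where
  "chart_inv c = inv_into (fst c) (snd c)"

definition is_chart :: "('m::topological_space, 'd::finite) chart \<Rightarrow> bool" where
  "is_chart c \<longleftrightarrow> open (fst c) \<and> open (snd c ` fst c) \<and>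
     homeomorphism (fst c) (snd c ` fst c) (snd c) (chart_inv c)"

definition compatible :: "('m, 'd::finite) chart \<Rightarrow> ('m, 'd) chart \<Rightarrow> bool" where
  "compatible c c' \<longleftrightarrow>
     (\<forall>k. Cinf_on (snd c ` (fst c \<inter> fst c')) (\<lambda>a. snd c' (chart_inv c a) $ k)) \<and>
     (\<forall>k. Cinf_on (snd c' ` (fst c \<inter> fst c')) (\<lambda>a. snd c (chart_inv c' a) $ k))"

definition smooth_structure :: "('m::topological_space, 'd::finite) chart set \<Rightarrow> bool" where
  "smooth_structure A \<longleftrightarrow>
     (\<forall>c\<in>A. is_chart c) \<and> (\<Union>c\<in>A. fst c) = UNIV \<and> (\<forall>c\<in>A. \<forall>c'\<in>A. compatible c c') \<and>
     (\<forall>c. is_chart c \<and> (\<forall>c'\<in>A. compatible c c') \<longrightarrow> c \<in> A)"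

text \<open>The partial derivative of a function on the manifold with respect to a coordinate of a chart:\<close>

definition pd :: "('m, 'd::finite) chart \<Rightarrow> 'd \<Rightarrow> ('m \<Rightarrow> real) \<Rightarrow> 'm \<Rightarrow> real" where
  "pd c k f p = partial k (f \<circ> chart_inv c) (snd c p)"


section \<open>Tensors\<close>

text \<open>For every point a chart around it is selected once and for all, and the vectors, covectors,
  bivectors and 2-covectors at that point are represented by their components in the selected chart.
  So the tangent space and the cotangent space at each point are \<^typ>\<open>real^'d\<close>, paired by the inner
  product, and the bivectors and 2-covectors are the skew-symmetric matrices. The selected charts
  vary without any continuity in the point; smoothness of a tensor field is therefore expressed by
  its components \<^emph>\<open>with respect to the charts of the atlas\<close>, which are obtained by evaluating the
  field on the coordinate vector fields and coordinate differentials of the chart.\<close>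

context
  fixes A :: "('m::topological_space, 'd::finite) chart set"
begin

definition pchart :: "'m \<Rightarrow> ('m, 'd) chart" where
  "pchart p = (SOME c. c \<in> A \<and> p \<in> fst c)"

definition diff :: "('m \<Rightarrow> real) \<Rightarrow> 'm \<Rightarrow> real^'d" where
  "diff f p = (\<chi> k. pd (pchart p) k f p)"

text \<open>The differential of the k-th coordinate of a chart, and the k-th coordinate vector field:\<close>

definition dcoord :: "('m, 'd) chart \<Rightarrow> 'd \<Rightarrow> 'm \<Rightarrow> real^'d" where
  "dcoord c k = diff (\<lambda>q. snd c q $ k)"

definition vcoord :: "('m, 'd) chart \<Rightarrow> 'd \<Rightarrow> 'm \<Rightarrow> real^'d" where
  "vcoord c k p = (\<chi> j. pd c k (\<lambda>q. snd (pchart p) q $ j) p)"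

definition smooth_fun :: "'m set \<Rightarrow> ('m \<Rightarrow> real) \<Rightarrow> bool" where
  "smooth_fun W f \<longleftrightarrow> (\<forall>c\<in>A. Cinf_on (snd c ` (fst c \<inter> W)) (f \<circ> chart_inv c))"

definition forms1 :: "'m set \<Rightarrow> ('m \<Rightarrow> real^'d) set" where
  "forms1 W = {\<alpha>. \<forall>c\<in>A. \<forall>k. smooth_fun (fst c \<inter> W) (\<lambda>q. \<alpha> q \<bullet> vcoord c k q)}"

definition wedge :: "real^'d \<Rightarrow> real^'d \<Rightarrow> real^'d^'d" where
  "wedge a b = (\<chi> k l. a $ k * b $ l - a $ l * b $ k)"

text \<open>Exterior derivative of a 1-form, by the coordinate formula
  \<open>(d\<alpha>)\<^sub>k\<^sub>l = \<partial>\<^sub>k \<alpha>\<^sub>l - \<partial>\<^sub>l \<alpha>\<^sub>k\<close> in the chart selected at the point:\<close>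

definition ext_d :: "('m \<Rightarrow> real^'d) \<Rightarrow> 'm \<Rightarrow> real^'d^'d" where
  "ext_d \<alpha> p = (let c = pchart p in
     \<chi> k l. pd c k (\<lambda>q. \<alpha> q \<bullet> vcoord c l q) p - pd c l (\<lambda>q. \<alpha> q \<bullet> vcoord c k q) p)"

text \<open>Lie derivative of a 1-form, by the coordinate formula
  \<open>(L\<^sub>X \<beta>)\<^sub>k = \<Sum>\<^sub>l X\<^sub>l \<partial>\<^sub>l \<beta>\<^sub>k + \<beta>\<^sub>l \<partial>\<^sub>k X\<^sub>l\<close> in the chart selected at the point:\<close>

definition lie1 :: "('m \<Rightarrow> real^'d) \<Rightarrow> ('m \<Rightarrow> real^'d) \<Rightarrow> 'm \<Rightarrow> real^'d" where
  "lie1 X \<beta> p = (let c = pchart p in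
     \<chi> k. \<Sum>l\<in>UNIV. (dcoord c l p \<bullet> X p) * pd c l (\<lambda>q. \<beta> q \<bullet> vcoord c k q) p
                  + (\<beta> p \<bullet> vcoord c l p) * pd c k (\<lambda>q. dcoord c l q \<bullet> X q) p)"

text \<open>Extension of an operator \<open>\<delta>\<close> on 1-forms with \<open>\<delta>(f\<beta>) = f \<delta>\<beta> + X(f)\<beta>\<close> to 2-forms, as a
  derivation of the wedge product with \<open>\<delta>f = X(f)\<close>: it is applied to
  \<open>\<eta> = 1/2 \<Sum>\<^sub>k\<^sub>,\<^sub>l \<eta>\<^sub>k\<^sub>l dz\<^sub>k \<and> dz\<^sub>l\<close>, where \<open>z\<close> is the chart selected at the point. The argument \<open>X\<close>
  is the value of the vector field at the point.\<close>

definition der_ext ::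
    "real^'d \<Rightarrow> (('m \<Rightarrow> real^'d) \<Rightarrow> 'm \<Rightarrow> real^'d) \<Rightarrow> ('m \<Rightarrow> real^'d^'d) \<Rightarrow> 'm \<Rightarrow> real^'d^'d" where
  "der_ext X \<delta> \<eta> p = (let c = pchart p; comp = (\<lambda>k l q. vcoord c k q \<bullet> (\<eta> q *v vcoord c l q)) in
     (1/2) *\<^sub>R (\<Sum>k\<in>UNIV. \<Sum>l\<in>UNIV.
        (X \<bullet> diff (comp k l) p) *\<^sub>R wedge (dcoord c k p) (dcoord c l p)
        + comp k l p *\<^sub>R (wedge (\<delta> (dcoord c k) p) (dcoord c l p)
                         + wedge (dcoord c k p) (\<delta> (dcoord c l) p))))"

text \<open>Smooth subbundles of the cotangent bundle over \<^term>\<open>W\<close>, and their smooth sections:\<close>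

definition subbundle :: "'m set \<Rightarrow> ('m \<Rightarrow> (real^'d) set) \<Rightarrow> bool" where
  "subbundle W H \<longleftrightarrow> (\<forall>p\<in>W. \<exists>V (n::nat) \<theta>. open V \<and> p \<in> V \<and> V \<subseteq> W \<and> (\<forall>i<n. \<theta> i \<in> forms1 V) \<and>
     (\<forall>q\<in>V. inj_on (\<lambda>i. \<theta> i q) {..<n} \<and> independent ((\<lambda>i. \<theta> i q) ` {..<n}) \<and>
            H q = span ((\<lambda>i. \<theta> i q) ` {..<n})))"

definition sections :: "'m set \<Rightarrow> ('m \<Rightarrow> (real^'d) set) \<Rightarrow> ('m \<Rightarrow> real^'d) set" where
  "sections W H = {\<beta> \<in> forms1 W. \<forall>q\<in>W. \<beta> q \<in> H q}"

end


section \<open>Poisson manifolds\<close>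

definition biv :: "real^'d^'d \<Rightarrow> real^'d \<Rightarrow> real^'d \<Rightarrow> real" where
  "biv M a b = a \<bullet> (M *v b)"

text \<open>With this definition \<^prop>\<open>b \<bullet> anchor M a = biv M a b\<close>.\<close>

definition anchor :: "real^'d^'d \<Rightarrow> real^'d \<Rightarrow> real^'d::finite" where
  "anchor M a = a v* M"

definition reg_points :: "('m::topological_space \<Rightarrow> real^'d^'d) \<Rightarrow> 'm set" where
  "reg_points P = {p. \<exists>n. \<forall>\<^sub>F q in nhds p. rank (P q) = n}"

context
  fixes A :: "('m::topological_space, 'd::finite) chart set"
    and P :: "'m \<Rightarrow> real^'d^'d"
begin

definition bracket :: "('m \<Rightarrow> real) \<Rightarrow> ('m \<Rightarrow> real) \<Rightarrow> 'm \<Rightarrow> real" where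
  "bracket f g p = biv (P p) (diff A f p) (diff A g p)"

definition poisson :: bool where
  "poisson \<longleftrightarrow>
     (\<forall>p. transpose (P p) = - P p) \<and>
     (\<forall>c\<in>A. \<forall>k l. smooth_fun A (fst c) (\<lambda>q. biv (P q) (dcoord A c k q) (dcoord A c l q))) \<and>
     (\<forall>f g h. smooth_fun A UNIV f \<and> smooth_fun A UNIV g \<and> smooth_fun A UNIV h \<longrightarrow>
        (\<forall>p. bracket f (bracket g h) p + bracket g (bracket h f) p + bracket h (bracket f g) p = 0))"

definition koszul :: "('m \<Rightarrow> real^'d) \<Rightarrow> ('m \<Rightarrow> real^'d) \<Rightarrow> 'm \<Rightarrow> real^'d" where
  "koszul \<alpha> \<beta> p = lie1 A (\<lambda>q. anchor (P q) (\<alpha> q)) \<beta> p - lie1 A (\<lambda>q. anchor (P q) (\<beta> q)) \<alpha> p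
     - diff A (\<lambda>q. biv (P q) (\<alpha> q) (\<beta> q)) p"

definition koszul2 :: "('m \<Rightarrow> real^'d) \<Rightarrow> ('m \<Rightarrow> real^'d^'d) \<Rightarrow> 'm \<Rightarrow> real^'d^'d" where
  "koszul2 \<alpha> \<eta> p = der_ext A (anchor (P p) (\<alpha> p)) (koszul \<alpha>) \<eta> p"


section \<open>Contravariant connections\<close>

text \<open>A contravariant connection is an operator on global smooth 1-forms; its values on other
  arguments are unconstrained.\<close>

context
  fixes D :: "('m \<Rightarrow> real^'d) \<Rightarrow> ('m \<Rightarrow> real^'d) \<Rightarrow> 'm \<Rightarrow> real^'d"
begin

definition contravariant_connection :: bool where
  "contravariant_connection \<longleftrightarrow>
     (\<forall>\<alpha>\<in>forms1 A UNIV. \<forall>\<beta>\<in>forms1 A UNIV. D \<alpha> \<beta> \<in> forms1 A UNIV) \<and>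
     (\<forall>\<alpha>\<in>forms1 A UNIV. \<forall>\<alpha>'\<in>forms1 A UNIV. \<forall>\<beta>\<in>forms1 A UNIV.
        D (\<lambda>p. \<alpha> p + \<alpha>' p) \<beta> = (\<lambda>p. D \<alpha> \<beta> p + D \<alpha>' \<beta> p)) \<and>
     (\<forall>\<alpha>\<in>forms1 A UNIV. \<forall>\<beta>\<in>forms1 A UNIV. \<forall>\<beta>'\<in>forms1 A UNIV.
        D \<alpha> (\<lambda>p. \<beta> p + \<beta>' p) = (\<lambda>p. D \<alpha> \<beta> p + D \<alpha> \<beta>' p)) \<and>
     (\<forall>s. \<forall>\<alpha>\<in>forms1 A UNIV. \<forall>\<beta>\<in>forms1 A UNIV.
        D (\<lambda>p. s *\<^sub>R \<alpha> p) \<beta> = (\<lambda>p. s *\<^sub>R D \<alpha> \<beta> p) \<and> D \<alpha> (\<lambda>p. s *\<^sub>R \<beta> p) = (\<lambda>p. s *\<^sub>R D \<alpha> \<beta> p)) \<and>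
     (\<forall>f. smooth_fun A UNIV f \<longrightarrow> (\<forall>\<alpha>\<in>forms1 A UNIV. \<forall>\<beta>\<in>forms1 A UNIV.
        D (\<lambda>p. f p *\<^sub>R \<alpha> p) \<beta> = (\<lambda>p. f p *\<^sub>R D \<alpha> \<beta> p) \<and>
        D \<alpha> (\<lambda>p. f p *\<^sub>R \<beta> p) =
          (\<lambda>p. f p *\<^sub>R D \<alpha> \<beta> p + (anchor (P p) (\<alpha> p) \<bullet> diff A f p) *\<^sub>R \<beta> p)))"

definition torsion_free :: bool where
  "torsion_free \<longleftrightarrow> (\<forall>\<alpha>\<in>forms1 A UNIV. \<forall>\<beta>\<in>forms1 A UNIV. \<forall>p.
     D \<alpha> \<beta> p - D \<beta> \<alpha> p = koszul \<alpha> \<beta> p)"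

definition flat :: bool where
  "flat \<longleftrightarrow> (\<forall>\<alpha>\<in>forms1 A UNIV. \<forall>\<beta>\<in>forms1 A UNIV. \<forall>\<gamma>\<in>forms1 A UNIV. \<forall>p.
     D \<alpha> (D \<beta> \<gamma>) p - D \<beta> (D \<alpha> \<gamma>) p - D (koszul \<alpha> \<beta>) \<gamma> p = 0)"

text \<open>The restriction of the connection to 1-forms that are only defined (and smooth) near a point:
  such forms are replaced by global smooth forms with the same germ at the point.\<close>

definition restr :: "('m \<Rightarrow> real^'d) \<Rightarrow> ('m \<Rightarrow> real^'d) \<Rightarrow> 'm \<Rightarrow> real^'d" where
  "restr \<alpha> \<beta> p = (THE a. \<exists>\<alpha>'\<in>forms1 A UNIV. \<exists>\<beta>'\<in>forms1 A UNIV.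
     (\<forall>\<^sub>F q in nhds p. \<alpha>' q = \<alpha> q) \<and> (\<forall>\<^sub>F q in nhds p. \<beta>' q = \<beta> q) \<and> a = D \<alpha>' \<beta>' p)"

definition restr2 :: "('m \<Rightarrow> real^'d) \<Rightarrow> ('m \<Rightarrow> real^'d^'d) \<Rightarrow> 'm \<Rightarrow> real^'d^'d" where
  "restr2 \<alpha> \<eta> p = der_ext A (anchor (P p) (\<alpha> p)) (restr \<alpha>) \<eta> p"

definition F_connection_on :: "'m set \<Rightarrow> bool" where
  "F_connection_on W \<longleftrightarrow> (\<forall>\<alpha>\<in>forms1 A W. \<forall>\<beta>\<in>forms1 A W. \<forall>p\<in>W.
     anchor (P p) (\<alpha> p) = 0 \<longrightarrow> restr \<alpha> \<beta> p = 0)"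

definition F_reg_connection :: bool where
  "F_reg_connection \<longleftrightarrow> F_connection_on (reg_points P)"

definition parallel_on :: "'m set \<Rightarrow> ('m \<Rightarrow> real^'d) \<Rightarrow> bool" where
  "parallel_on W \<eta> \<longleftrightarrow> \<eta> \<in> forms1 A W \<and> (\<forall>\<gamma>\<in>forms1 A W. \<forall>q\<in>W. restr \<gamma> \<eta> q = 0)"

definition hawkins :: "('m \<Rightarrow> real^'d) \<Rightarrow> ('m \<Rightarrow> real^'d) \<Rightarrow> 'm \<Rightarrow> real^'d^'d" where
  "hawkins \<alpha> \<beta> p = - restr2 \<alpha> (ext_d A \<beta>) p - restr2 \<beta> (ext_d A \<alpha>) p
     + ext_d A (restr \<beta> \<alpha>) p + koszul2 \<alpha> (ext_d A \<beta>) p"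

text \<open>Meaningful for regular points \<^term>\<open>p\<close>, where the value does not depend on the choice of the
  parallel forms:\<close>

definition T_tensor :: "'m \<Rightarrow> real^'d \<Rightarrow> real^'d \<Rightarrow> real^'d^'d" where
  "T_tensor p a b = (THE \<eta>. \<exists>W \<alpha> \<beta>. open W \<and> p \<in> W \<and> parallel_on W \<alpha> \<and> parallel_on W \<beta> \<and>
     \<alpha> p = a \<and> \<beta> p = b \<and> \<eta> = hawkins \<alpha> \<beta> p)"

definition invariant_complement :: "'m set \<Rightarrow> ('m \<Rightarrow> (real^'d) set) \<Rightarrow> bool" where
  "invariant_complement W H \<longleftrightarrow> subbundle A W H \<and>
     (\<forall>q\<in>W. {a. anchor (P q) a = 0} \<inter> H q = {0} \<and>
            (\<forall>a. \<exists>k h. anchor (P q) k = 0 \<and> h \<in> H q \<and> a = k + h)) \<and>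
     (\<forall>\<alpha>\<in>forms1 A W. \<forall>\<beta>\<in>sections A W H. restr \<alpha> \<beta> \<in> sections A W H)"

end

definition varpi :: "('m \<Rightarrow> (real^'d) set) \<Rightarrow> 'm \<Rightarrow> real^'d \<Rightarrow> real^'d" where
  "varpi H q = inv_into (H q) (anchor (P q))"

text \<open>In a foliated chart the coordinates with index in \<^term>\<open>I\<close> are the leafwise ones and those
  with index in \<^term>\<open>- I\<close> are the transverse ones.\<close>

definition foliated_chart :: "('m, 'd) chart \<Rightarrow> 'd set \<Rightarrow> bool" where
  "foliated_chart c I \<longleftrightarrow> c \<in> A \<and> (\<forall>q\<in>fst c.
     range (anchor (P q)) = span ((\<lambda>i. vcoord A c i q) ` I) \<and>
     {a. anchor (P q) a = 0} = span ((\<lambda>u. dcoord A c u q) ` (- I)))"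

definition phi :: "('m \<Rightarrow> (real^'d) set) \<Rightarrow> ('m, 'd) chart \<Rightarrow> 'd \<Rightarrow> 'm \<Rightarrow> real^'d" where
  "phi H c i q = varpi H q (vcoord A c i q)"

definition flat_chart ::
    "(('m \<Rightarrow> real^'d) \<Rightarrow> ('m \<Rightarrow> real^'d) \<Rightarrow> 'm \<Rightarrow> real^'d) \<Rightarrow> 'm \<Rightarrow> ('m, 'd) chart \<Rightarrow> 'd set \<Rightarrow> bool" where
  "flat_chart D x c I \<longleftrightarrow> foliated_chart c I \<and> x \<in> fst c \<and>
     (\<forall>W H. open W \<and> x \<in> W \<and> invariant_complement D W H \<longrightarrow>
        (\<exists>V. open V \<and> x \<in> V \<and> V \<subseteq> W \<inter> fst c \<and>
           (let frame = (\<lambda>k. if k \<in> I then phi H c k else dcoord A c k) in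
              (\<forall>k. parallel_on D V (frame k)) \<and>
              (\<forall>q\<in>V. inj (\<lambda>k. frame k q) \<and> independent (range (\<lambda>k. frame k q)) \<and>
                     span (range (\<lambda>k. frame k q)) = UNIV))))"

text \<open>The functions \<open>\<pi>(dz\<^sub>k, dz\<^sub>l)\<close> for the coordinates \<open>z\<close> of a chart:\<close>

definition pi_comp :: "('m, 'd) chart \<Rightarrow> 'd \<Rightarrow> 'd \<Rightarrow> 'm \<Rightarrow> real" where
  "pi_comp c k l q = biv (P q) (dcoord A c k q) (dcoord A c l q)"

end

end

theory Submission
  imports Defs
begin

text \<open>
  The frame consisting of the \<open>\<phi>\<^sub>i\<close> and the \<open>dy\<^sub>u\<close> is parallel, and a form \<open>\<alpha>\<close> in its parallel span
  satisfies \<open>[\<alpha>, \<cdot>]\<^sub>\<pi> = \<D>\<^sub>\<alpha>\<close> because the torsion vanishes, so that \<open>{\<alpha>, \<beta>} = - \<D>\<^sub>\<beta> d\<alpha>\<close> for parallel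
  forms. Expanding \<open>d\<alpha>\<close> in the parallel frame, \<open>\<D>\<^sub>\<beta>\<close> merely differentiates the coefficients along
  \<open>\<pi>\<^sub>\<sharp>(\<beta>)\<close>. A general parallel form has leafwise constant coefficients \<open>f\<^sub>j\<close> in the frame \<open>\<xi>\<^sub>j\<close>, and
  the terms \<open>df\<^sub>j \<and> \<xi>\<^sub>j\<close> of \<open>d\<alpha>\<close> are again leafwise constant; hence \<open>\<T>\<close> is well defined, and it
  vanishes on the closed forms \<open>dy\<^sub>u\<close>.

  For the coefficients of \<open>d\<phi>\<^sub>j\<close> the only input is \<open>[\<phi>\<^sub>i, \<phi>\<^sub>j]\<^sub>\<pi> = 0\<close>, which says that the component of
  \<open>d\<phi>\<^sub>j\<close> at \<open>(\<partial>/\<partial>x\<^sub>k, \<cdot>)\<close> is the derivative of \<open>\<phi>\<^sub>k\<close> along \<open>x\<^sub>j\<close>. Evaluating \<open>d\<phi>\<^sub>j\<close> on the dual frame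
  and moving derivatives from \<open>\<phi>\<close> to the dual frame gives the three groups of coefficients.
\<close>


section \<open>Smooth functions on open subsets of Euclidean space\<close>

text \<open>The functions \<open>a\<close> and \<open>pinv\<close> reach the connection through a
  single identity. The forms \<open>dx\<^sub>i + \<Sum>\<^sub>u A\<^sub>i\<^sup>u dy\<^sub>u\<close>
  and \<open>\<Sum>\<^sub>l \<pi>\<^sub>i\<^sub>l \<phi>\<^sub>l\<close> both lie in the complement
  and have the same image under the anchor, so they agree. Inverting this relation gives the chart
  components of the frame, and the coefficients of the dual frame then turn out to be
  \<open>\<pi>\<^sub>k\<^sub>l\<close>, \<open>- A\<^sub>k\<^sup>u\<close> and constants. This is
  why exactly these functions are differentiated in the formula. The bracket yields derivatives
  along x_j of the components of d\<phi>_i, whereas the formula differentiates along x_i a quantity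
  built from d\<phi>_j. For the dy_u \<and> dy_v terms these are visibly different expressions, so
  their equality has to be proved. Two encodings shape the rest. The connection acts on global forms
  only, so every local statement passes through bump functions and germs. The tensor is a definite
  description over all pairs of parallel forms near the point, so the bracket must be computed for
  arbitrary parallel forms, not just for the frame.\<close>

lemma has_derivative_line:
  assumes "(f has_derivative f') (at (b + t *\<^sub>R axis k 1))"
  shows "((\<lambda>t. f (b + t *\<^sub>R axis k 1)) has_real_derivative f' (axis k 1)) (at t)"
proof -
  have "((\<lambda>t. f (b + t *\<^sub>R axis k 1)) has_derivative (\<lambda>t. f' (t *\<^sub>R axis k 1))) (at t)"
    by (rule has_derivative_compose[where f = "\<lambda>t. b + t *\<^sub>R axis k 1" and g = f])
      (use assms in \<open>auto intro!: derivative_eq_intros\<close>)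
  moreover have "(\<lambda>t. f' (t *\<^sub>R axis k 1)) = (*) (f' (axis k 1))"
    using has_derivative_linear[OF assms] by (auto simp: linear_cmul)
  ultimately show ?thesis by (simp add: has_field_derivative_def)
qed

lemma has_derivative_imp_partial:
  assumes "(f has_derivative f') (at a)"
  shows "partial k f a = f' (axis k 1)"
  using has_derivative_line[of f f' a 0 k] assms by (simp add: partial_def DERIV_imp_deriv)

lemma has_derivative_partial:
  assumes "f differentiable at a"
  shows "(f has_derivative (\<lambda>h. \<Sum>k\<in>UNIV. h $ k * partial k f a)) (at a)"
proof -
  obtain f' where f': "(f has_derivative f') (at a)"
    using assms differentiable_def by blast
  have "f' h = (\<Sum>k\<in>UNIV. h $ k * partial k f a)" for h
  proof -
    have "f' h = f' (\<Sum>k\<in>UNIV. h $ k *\<^sub>R axis k 1)"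
      by (metis basis_expansion scalar_mult_eq_scaleR)
    also have "\<dots> = (\<Sum>k\<in>UNIV. h $ k * partial k f a)"
      using has_derivative_linear[OF f'] has_derivative_imp_partial[OF f']
      by (simp add: linear_sum linear_cmul)
    finally show ?thesis .
  qed
  then have "f' = (\<lambda>h. \<Sum>k\<in>UNIV. h $ k * partial k f a)" by auto
  with f' show ?thesis by simp
qed

lemma DERIV_line_partial:
  assumes "f differentiable at (b + t *\<^sub>R axis k 1)"
  shows "((\<lambda>t. f (b + t *\<^sub>R axis k 1)) has_real_derivative partial k f (b + t *\<^sub>R axis k 1)) (at t)"
  using assms has_derivative_line has_derivative_imp_partial unfolding differentiable_def by metis

lemma partial_cong:
  assumes "\<forall>\<^sub>F b in nhds a. f b = g b"
  shows "partial k f a = partial k g a"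
proof -
  have "filterlim (\<lambda>t. a + t *\<^sub>R axis k 1) (nhds a) (nhds (0::real))"
    by (auto intro!: tendsto_eq_intros filterlim_ident)
  then have "\<forall>\<^sub>F t in nhds (0::real). f (a + t *\<^sub>R axis k 1) = g (a + t *\<^sub>R axis k 1)"
    using assms eventually_compose_filterlim by blast
  then show ?thesis
    unfolding partial_def by (intro deriv_cong_ev) auto
qed

lemma partial_cong_open:
  assumes "open S" "\<And>b. b \<in> S \<Longrightarrow> f b = g b" "a \<in> S"
  shows "partial k f a = partial k g a"
  using assms by (intro partial_cong) (auto simp: eventually_nhds)

lemma partial_const [simp]: "partial k (\<lambda>_. c) = (\<lambda>_. 0)"
  by (auto simp: partial_def)

lemma partial_add:
  assumes "f differentiable at a" "g differentiable at a"
  shows "partial k (\<lambda>b. f b + g b) a = partial k f a + partial k g a"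
  using has_derivative_imp_partial[OF has_derivative_add[OF has_derivative_partial[OF assms(1)]
    has_derivative_partial[OF assms(2)]], of k]
  by (simp add: axis_def if_distrib if_distribR cong: if_cong)

lemma partial_mult:
  fixes f g :: "real^'d \<Rightarrow> real"
  assumes "f differentiable at a" "g differentiable at a"
  shows "partial k (\<lambda>b. f b * g b) a = partial k f a * g a + f a * partial k g a"
  using has_derivative_imp_partial[OF has_derivative_mult[OF has_derivative_partial[OF assms(1)]
    has_derivative_partial[OF assms(2)]], of k]
  by (simp add: axis_def if_distrib if_distribR mult.commute add.commute cong: if_cong)

lemma partial_coord: "partial k (\<lambda>b. b $ l) a = (if k = l then 1 else 0)"
  by (subst has_derivative_imp_partial[OF bounded_linear_imp_has_derivative[OF bounded_linear_vec_nth]])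
    (simp add: axis_def)

lemma has_derivative_compose_partial:
  fixes f :: "real^'d \<Rightarrow> real" and g :: "real^'e \<Rightarrow> real^'d"
  assumes "f differentiable at (g a)" "\<And>j. (\<lambda>b. g b $ j) differentiable at a"
  shows "((\<lambda>b. f (g b)) has_derivative
    (\<lambda>h. \<Sum>j\<in>UNIV. (\<Sum>k\<in>UNIV. h $ k * partial k (\<lambda>b. g b $ j) a) * partial j f (g a))) (at a)"
proof -
  have "(g has_derivative (\<lambda>h. \<chi> j. \<Sum>k\<in>UNIV. h $ k * partial k (\<lambda>b. g b $ j) a)) (at a)"
    unfolding has_derivative_componentwise_within[where f = g]
    using has_derivative_partial[OF assms(2)]
    by (auto simp: Basis_vec_def inner_axis)
  from has_derivative_compose[OF this has_derivative_partial[OF assms(1)]]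
  show ?thesis by simp
qed

lemma partial_compose:
  fixes f :: "real^'d \<Rightarrow> real" and g :: "real^'e \<Rightarrow> real^'d"
  assumes "f differentiable at (g a)" "\<And>j. (\<lambda>b. g b $ j) differentiable at a"
  shows "partial k (\<lambda>b. f (g b)) a = (\<Sum>j\<in>UNIV. partial j f (g a) * partial k (\<lambda>b. g b $ j) a)"
  using has_derivative_imp_partial[OF has_derivative_compose_partial[of f g a], OF assms, of k]
  by (simp add: axis_def if_distrib if_distribR mult.commute cong: if_cong)

section \<open>Functions of class C^n\<close>

lemma Ck_on_Suc_differentiable:
  "open S \<Longrightarrow> Ck_on (Suc n) S f \<Longrightarrow> a \<in> S \<Longrightarrow> f differentiable at a"
  by (simp add: differentiable_on_eq_differentiable_at)

text \<open>\<open>partial\<close> is a total operator whose rules hold only where the functions are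
  differentiable. A partial derivative is therefore known to equal the expected expression on
  \<open>S\<close> only, and each induction below has to transfer regularity along such an equality.
  Openness of \<open>S\<close> makes this possible, since derivatives depend on germs.\<close>

lemma Ck_on_cong:
  assumes "open S" "\<And>a. a \<in> S \<Longrightarrow> f a = g a" "Ck_on n S f"
  shows "Ck_on n S g"
  using assms(2,3)
proof (induction n arbitrary: f g)
  case 0
  then show ?case by (simp cong: continuous_on_cong)
next
  case (Suc n)
  have "g differentiable at a" if "a \<in> S" for a
    using Ck_on_Suc_differentiable[OF assms(1) Suc.prems(2) that] assms(1) that Suc.prems(1)
    unfolding differentiable_def by (metis has_derivative_transform_within_open)
  then show ?case
    using Suc.IH[OF partial_cong_open[OF assms(1) Suc.prems(1)]] Suc.prems(2) assms(1)
    by (auto simp: differentiable_on_eq_differentiable_at)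
qed

lemma Ck_on_subset: "Ck_on n S f \<Longrightarrow> T \<subseteq> S \<Longrightarrow> Ck_on n T f"
  by (induction n arbitrary: f) (auto intro: continuous_on_subset differentiable_on_subset)

lemma Ck_on_Suc_imp: "Ck_on (Suc n) S f \<Longrightarrow> Ck_on n S f"
  by (induction n arbitrary: f) (auto intro: differentiable_imp_continuous_on)

lemma Ck_on_locally:
  assumes "open S" "\<And>a. a \<in> S \<Longrightarrow> \<exists>T. open T \<and> a \<in> T \<and> Ck_on n T f"
  shows "Ck_on n S f"
  using assms(2)
proof (induction n arbitrary: f)
  case 0
  have "isCont f a" if "a \<in> S" for a
    using 0[OF that] by (auto simp: continuous_on_eq_continuous_at)
  then show ?case by (simp add: continuous_at_imp_continuous_on)
next
  case (Suc n)
  have "f differentiable at a" if "a \<in> S" for a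
    using Suc.prems[OF that] Ck_on_Suc_differentiable by blast
  moreover have "Ck_on n S (partial k f)" for k
    by (rule Suc.IH) (use Suc.prems in fastforce)
  ultimately show ?case
    using assms(1) by (simp add: differentiable_on_eq_differentiable_at)
qed

lemma Ck_on_const: "Ck_on n S (\<lambda>_. c)"
  by (induction n arbitrary: c) auto

lemma Ck_on_coord: "Ck_on n S (\<lambda>a. a $ k)"
  by (cases n) (auto simp: partial_coord[abs_def] intro!: continuous_intros Ck_on_const
      bounded_linear_imp_differentiable_on bounded_linear_vec_nth)

lemma Ck_on_add:
  assumes "open S" "Ck_on n S f" "Ck_on n S g"
  shows "Ck_on n S (\<lambda>a. f a + g a)"
  using assms(2,3)
proof (induction n arbitrary: f g)
  case 0
  then show ?case by (simp add: continuous_on_add)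
next
  case (Suc n)
  have "Ck_on n S (partial k (\<lambda>a. f a + g a))" for k
  proof (rule Ck_on_cong[OF assms(1)])
    show "partial k f a + partial k g a = partial k (\<lambda>a. f a + g a) a" if "a \<in> S" for a
      using partial_add Ck_on_Suc_differentiable[OF assms(1)] Suc.prems that by metis
    show "Ck_on n S (\<lambda>a. partial k f a + partial k g a)"
      using Suc.prems by (intro Suc.IH) auto
  qed
  then show ?case using Suc.prems by (simp add: differentiable_on_add)
qed

lemma Ck_on_mult:
  fixes f g :: "real^'d \<Rightarrow> real"
  assumes "open S" "Ck_on n S f" "Ck_on n S g"
  shows "Ck_on n S (\<lambda>a. f a * g a)"
  using assms(2,3)
proof (induction n arbitrary: f g)
  case 0
  then show ?case by (simp add: continuous_on_mult)
next
  case (Suc n)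
  have "Ck_on n S (partial k (\<lambda>a. f a * g a))" for k
  proof (rule Ck_on_cong[OF assms(1)])
    show "partial k f a * g a + f a * partial k g a = partial k (\<lambda>a. f a * g a) a" if "a \<in> S" for a
      using partial_mult Ck_on_Suc_differentiable[OF assms(1)] Suc.prems that by metis
    show "Ck_on n S (\<lambda>a. partial k f a * g a + f a * partial k g a)"
      using Suc.prems Suc.prems[THEN Ck_on_Suc_imp] by (intro Ck_on_add[OF assms(1)] Suc.IH) auto
  qed
  then show ?case using Suc.prems by (simp add: differentiable_on_mult)
qed

lemma Ck_on_sum:
  assumes "open S" "\<And>i. i \<in> J \<Longrightarrow> Ck_on n S (f i)"
  shows "Ck_on n S (\<lambda>a. \<Sum>i\<in>J. f i a)"
  using assms(2)
  by (induction J rule: infinite_finite_induct) (auto intro: Ck_on_const Ck_on_add[OF assms(1)])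

text \<open>The chain rule writes a derivative of the composition as a sum of products of some
  \<open>partial j f\<close> composed with \<open>g\<close> and derivatives of \<open>g\<close>. The
  induction hypothesis is used for \<open>partial j f\<close>, hence the generalization over
  \<open>f\<close>.\<close>

lemma Ck_on_compose:
  fixes f :: "real^'d \<Rightarrow> real" and g :: "real^'e \<Rightarrow> real^'d"
  assumes "open S" "open T" "g ` S \<subseteq> T" "Ck_on n T f" "\<And>j. Ck_on n S (\<lambda>a. g a $ j)"
  shows "Ck_on n S (\<lambda>a. f (g a))"
  using assms(4,5)
proof (induction n arbitrary: f)
  case 0
  have "continuous_on S g"
    using 0 by (subst continuous_on_componentwise) (auto simp: Basis_vec_def inner_axis)
  then show ?case
    using 0 assms(3) continuous_on_compose2[of T f S g] by auto
next
  case (Suc n)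
  have d: "f differentiable at (g a)" "(\<lambda>b. g b $ j) differentiable at a" if "a \<in> S" for a j
    using Ck_on_Suc_differentiable[OF assms(2) Suc.prems(1)]
      Ck_on_Suc_differentiable[OF assms(1) Suc.prems(2)] assms(3) that by auto
  have "Ck_on n S (partial k (\<lambda>a. f (g a)))" for k
  proof (rule Ck_on_cong[OF assms(1)])
    show "(\<Sum>j\<in>UNIV. partial j f (g a) * partial k (\<lambda>b. g b $ j) a) = partial k (\<lambda>a. f (g a)) a"
      if "a \<in> S" for a
      using partial_compose[of f g a k] d[OF that] by simp
    show "Ck_on n S (\<lambda>a. \<Sum>j\<in>UNIV. partial j f (g a) * partial k (\<lambda>b. g b $ j) a)"
    proof (rule Ck_on_sum[OF assms(1)], rule Ck_on_mult[OF assms(1)])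
      show "Ck_on n S (\<lambda>a. partial j f (g a))" for j
        by (rule Suc.IH) (use Suc.prems Ck_on_Suc_imp[OF Suc.prems(2)] in auto)
      show "Ck_on n S (\<lambda>a. partial k (\<lambda>b. g b $ j) a)" for j
        using Suc.prems(2)[of j] by simp
    qed
  qed
  moreover have "(\<lambda>a. f (g a)) differentiable at a" if "a \<in> S" for a
    using has_derivative_compose_partial[of f g a] d[OF that] differentiable_def by blast
  ultimately show ?case
    using assms(1) by (simp add: differentiable_on_eq_differentiable_at)
qed

text \<open>Two applications of the mean value theorem, first along \<open>k\<close> to the
  increment in direction \<open>l\<close>, then along \<open>l\<close> to
  \<open>partial k f\<close>. The left-hand side is symmetric in \<open>k\<close> and
  \<open>l\<close> while the right-hand side is not, and this asymmetry is what makes the mixed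
  derivatives comparable.\<close>

lemma second_difference:
  fixes f :: "real^'d \<Rightarrow> real"
  assumes S: "open S" "ball a \<epsilon> \<subseteq> S" and f: "Ck_on 2 S f" and s: "0 < s" "2 * s < \<epsilon>"
  shows "\<exists>b. dist a b \<le> 2 * s \<and> f (a + s *\<^sub>R axis k 1 + s *\<^sub>R axis l 1) - f (a + s *\<^sub>R axis k 1)
    - f (a + s *\<^sub>R axis l 1) + f a = s\<^sup>2 * partial l (partial k f) b"
proof -
  have near: "dist a (a + t *\<^sub>R axis k 1 + u *\<^sub>R axis l 1) \<le> 2 * s"
    if "0 \<le> t" "t \<le> s" "0 \<le> u" "u \<le> s" for t u
  proof -
    have "norm (t *\<^sub>R axis k (1::real) + u *\<^sub>R axis l (1::real)) \<le> t + u"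
      using that norm_triangle_ineq[of "t *\<^sub>R axis k (1::real)" "u *\<^sub>R axis l (1::real)"] by simp
    then show ?thesis
      using that norm_minus_cancel[of "t *\<^sub>R axis k (1::real) + u *\<^sub>R axis l (1::real)"]
      by (simp add: dist_norm add.assoc del: norm_minus_cancel)
  qed
  have inS: "a + t *\<^sub>R axis k 1 + u *\<^sub>R axis l 1 \<in> S"
    if "0 \<le> t" "t \<le> s" "0 \<le> u" "u \<le> s" for t u
    using near[OF that] S(2) s(2) by (auto intro!: subsetD[OF S(2)])
  have d1: "f differentiable at b" and d2: "partial k f differentiable at b" if "b \<in> S" for b
    using f S(1) that by (auto simp: numeral_2_eq_2 differentiable_on_eq_differentiable_at)
  define \<phi> where "\<phi> t = f (a + t *\<^sub>R axis k 1 + s *\<^sub>R axis l 1) - f (a + t *\<^sub>R axis k 1)" for t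
  have "(\<phi> has_real_derivative
      partial k f (a + t *\<^sub>R axis k 1 + s *\<^sub>R axis l 1) - partial k f (a + t *\<^sub>R axis k 1)) (at t)"
    if "0 \<le> t" "t \<le> s" for t
  proof -
    have "((\<lambda>t. f (a + s *\<^sub>R axis l 1 + t *\<^sub>R axis k 1)) has_real_derivative
        partial k f (a + s *\<^sub>R axis l 1 + t *\<^sub>R axis k 1)) (at t)"
      by (rule DERIV_line_partial, rule d1) (use inS[of t s] that s in \<open>simp add: ac_simps\<close>)
    moreover have "((\<lambda>t. f (a + t *\<^sub>R axis k 1)) has_real_derivative
        partial k f (a + t *\<^sub>R axis k 1)) (at t)"
      by (rule DERIV_line_partial, rule d1) (use inS[of t 0] that s in simp)
    ultimately show ?thesis
      unfolding \<phi>_def by (auto intro!: DERIV_diff simp: ac_simps)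
  qed
  from MVT2[OF s(1) this] obtain t where t: "0 < t" "t < s"
    and \<phi>: "\<phi> s - \<phi> 0 = s * (partial k f (a + t *\<^sub>R axis k 1 + s *\<^sub>R axis l 1)
      - partial k f (a + t *\<^sub>R axis k 1))" by auto
  have "((\<lambda>u. partial k f (a + t *\<^sub>R axis k 1 + u *\<^sub>R axis l 1)) has_real_derivative
      partial l (partial k f) (a + t *\<^sub>R axis k 1 + u *\<^sub>R axis l 1)) (at u)"
    if "0 \<le> u" "u \<le> s" for u
    by (rule DERIV_line_partial, rule d2) (use inS[of t u] that t in simp)
  from MVT2[OF s(1) this] obtain u where u: "0 < u" "u < s"
    and "partial k f (a + t *\<^sub>R axis k 1 + s *\<^sub>R axis l 1) - partial k f (a + t *\<^sub>R axis k 1)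
      = s * partial l (partial k f) (a + t *\<^sub>R axis k 1 + u *\<^sub>R axis l 1)" by auto
  with \<phi> show ?thesis
    using near[of t u] t u
    by (intro exI[of _ "a + t *\<^sub>R axis k 1 + u *\<^sub>R axis l 1"]) (simp add: \<phi>_def power2_eq_square)
qed

lemma partial_commute:
  fixes f :: "real^'d \<Rightarrow> real"
  assumes S: "open S" "a \<in> S" and f: "Ck_on 2 S f"
  shows "partial k (partial l f) a = partial l (partial k f) a"
proof (rule ccontr)
  define g h where "g = partial k (partial l f)" and "h = partial l (partial k f)"
  assume "partial k (partial l f) a \<noteq> partial l (partial k f) a"
  then have "0 < dist (g a) (h a) / 2" by (simp add: g_def h_def)
  moreover have "isCont g a" "isCont h a"
    using f S by (auto simp: g_def h_def numeral_2_eq_2 continuous_on_eq_continuous_at)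
  ultimately obtain \<delta>1 \<delta>2 where \<delta>: "0 < \<delta>1" "0 < \<delta>2"
    and g: "\<And>b. dist a b < \<delta>1 \<Longrightarrow> dist (g b) (g a) < dist (g a) (h a) / 2"
    and h: "\<And>b. dist a b < \<delta>2 \<Longrightarrow> dist (h b) (h a) < dist (g a) (h a) / 2"
    unfolding continuous_at_eps_delta by (metis dist_commute)
  obtain \<epsilon> where \<epsilon>: "0 < \<epsilon>" "ball a \<epsilon> \<subseteq> S" using S openE by blast
  \<comment> \<open>Dividing by 3 keeps \<open>2 * s\<close>, the bound on the distance of the
    intermediate points, below all three radii.\<close>
  define s where "s = min \<epsilon> (min \<delta>1 \<delta>2) / 3"
  have s: "0 < s" "2 * s < \<epsilon>" "2 * s < \<delta>1" "2 * s < \<delta>2"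
    using \<delta> \<epsilon> by (auto simp: s_def min_def)
  obtain b b' where b: "dist a b \<le> 2 * s" "dist a b' \<le> 2 * s" and "s\<^sup>2 * h b = s\<^sup>2 * g b'"
    using second_difference[OF S(1) \<epsilon>(2) f s(1,2), of k l]
      second_difference[OF S(1) \<epsilon>(2) f s(1,2), of l k]
    unfolding g_def h_def by (auto simp: algebra_simps)
  then have "h b = g b'" using s by simp
  then show False
    using g[of b'] h[of b] b s dist_triangle_half_l[of "g a" "g b'" "dist (g a) (h a)" "h a"]
    by (auto simp: dist_commute)
qed

text \<open>The factor \<open>1 / t\<^sup>n\<close> closes the family under differentiation.\<close>

definition flat_exp :: "nat \<Rightarrow> real \<Rightarrow> real" where
  "flat_exp n t = (if 0 < t then exp (- 1 / t) / t ^ n else 0)"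

lemma DERIV_flat_exp:
  "(flat_exp n has_real_derivative flat_exp (n + 2) t - n * flat_exp (n + 1) t) (at t)"
proof -
  consider "0 < t" | "t < 0" | "t = 0" by linarith
  then show ?thesis
  proof cases
    case 1
    have "real n * t ^ (n - Suc 0) = n * t ^ n / t"
      using 1 by (cases n) auto
    then have "((\<lambda>t. exp (- 1 / t) / t ^ n) has_real_derivative
        flat_exp (n + 2) t - n * flat_exp (n + 1) t) (at t)"
      using 1 by (auto intro!: derivative_eq_intros simp: flat_exp_def)
        (simp add: divide_simps power2_eq_square algebra_simps)
    then show ?thesis
      by (rule has_field_derivative_transform_within_open[where S = "{0<..}"])
        (use 1 in \<open>auto simp: flat_exp_def\<close>)
  next
    case 2
    have "((\<lambda>t. 0) has_real_derivative flat_exp (n + 2) t - n * flat_exp (n + 1) t) (at t)"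
      using 2 by (auto simp: flat_exp_def)
    then show ?thesis
      by (rule has_field_derivative_transform_within_open[where S = "{..<0}"])
        (use 2 in \<open>auto simp: flat_exp_def\<close>)
  next
    case 3
    \<comment> \<open>From the right the difference quotient at 0 is exp(-1/t) / t^(n+1). With 1/t
      as the variable this is a power divided by the exponential.\<close>
    have "((\<lambda>t. inverse t ^ (n + 1) / exp (inverse t)) \<longlongrightarrow> 0) (at_right (0::real))"
      by (rule filterlim_compose[OF tendsto_power_div_exp_0 filterlim_inverse_at_top_right])
    then have "((\<lambda>t. flat_exp n t / t) \<longlongrightarrow> 0) (at_right 0)"
      by (rule Lim_transform_eventually)
        (auto simp: eventually_at_right_less flat_exp_def exp_minus divide_simps
          intro!: eventually_mono[OF eventually_at_right_less])
    moreover have "((\<lambda>t. flat_exp n t / t) \<longlongrightarrow> 0) (at_left 0)"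
      by (rule Lim_transform_eventually[OF tendsto_const])
        (auto simp: flat_exp_def eventually_at_left_field intro!: exI[of _ "-1"])
    ultimately have "((\<lambda>t. flat_exp n t / t) \<longlongrightarrow> 0) (at 0)"
      by (simp add: filterlim_at_split)
    then show ?thesis
      using 3 by (simp add: has_field_derivative_iff flat_exp_def)
  qed
qed

text \<open>The composition with \<open>u\<close> is built into the statement because
  \<open>Ck_on\<close> speaks only of functions of a vector. The index \<open>m\<close> varies in
  the induction since each derivative raises it.\<close>

lemma Ck_on_flat_exp:
  fixes u :: "real^'d \<Rightarrow> real"
  assumes "open S" "Ck_on n S u"
  shows "Ck_on n S (\<lambda>a. flat_exp m (u a))"
  using assms(2)
proof (induction n arbitrary: m)
  case 0
  have "continuous_on UNIV (flat_exp m)"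
    by (intro continuous_at_imp_continuous_on) (auto intro: DERIV_isCont[OF DERIV_flat_exp])
  then show ?case
    using 0 continuous_on_compose2[of UNIV "flat_exp m" S u] by auto
next
  case (Suc n)
  have d: "((\<lambda>a. flat_exp m (u a)) has_derivative (\<lambda>h.
      (flat_exp (m + 2) (u a) - m * flat_exp (m + 1) (u a)) * (\<Sum>k\<in>UNIV. h $ k * partial k u a))) (at a)"
    if "a \<in> S" for a
    using has_derivative_compose[OF has_derivative_partial[OF
        Ck_on_Suc_differentiable[OF assms(1) Suc.prems that]]
        DERIV_flat_exp[of m "u a", unfolded has_field_derivative_def]] by simp
  have "Ck_on n S (partial k (\<lambda>a. flat_exp m (u a)))" for k
  proof (rule Ck_on_cong[OF assms(1)])
    show "(flat_exp (m + 2) (u a) + (- real m) * flat_exp (m + 1) (u a)) * partial k u a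
        = partial k (\<lambda>a. flat_exp m (u a)) a" if "a \<in> S" for a
      using has_derivative_imp_partial[OF d[OF that], of k]
      by (simp add: axis_def if_distrib if_distribR cong: if_cong)
    show "Ck_on n S (\<lambda>a. (flat_exp (m + 2) (u a) + (- real m) * flat_exp (m + 1) (u a)) * partial k u a)"
      using Suc.prems Ck_on_Suc_imp[OF Suc.prems]
      by (intro Ck_on_mult[OF assms(1)] Ck_on_add[OF assms(1)] Ck_on_const Suc.IH) auto
  qed
  then show ?case
    using d assms(1) by (auto simp: differentiable_on_eq_differentiable_at differentiable_def)
qed

lemma flat_exp_0_mono: "s \<le> t \<Longrightarrow> flat_exp 0 s \<le> flat_exp 0 t"
  by (auto simp: flat_exp_def divide_simps)

lemma Cinf_bump:
  fixes z :: "real^'d"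
  assumes "0 < \<epsilon>"
  obtains \<beta> where "\<And>S. open S \<Longrightarrow> Cinf_on S \<beta>" "\<And>y. dist z y \<le> \<epsilon> / 2 \<Longrightarrow> \<beta> y = 1"
    "\<And>y. \<epsilon> \<le> dist z y \<Longrightarrow> \<beta> y = (0::real)"
proof -
  define s where "s y = (1 / \<epsilon>\<^sup>2) * (\<Sum>k\<in>UNIV. (y $ k + (- z $ k)) * (y $ k + (- z $ k)))" for y
  have s: "s y = (dist z y / \<epsilon>)\<^sup>2" for y
    by (simp add: s_def dist_vec_def L2_set_def dist_real_def power_divide sum_nonneg
        power2_eq_square[symmetric] power2_commute)
  \<comment> \<open>The inner \<open>flat_exp\<close> vanishes for \<open>s y \<ge> 1\<close>, the outer one for \<open>s y \<le> 1/4\<close>, so the nested function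
    is constant in both regions and no quotient of smooth functions is needed.\<close>
  define \<beta> where "\<beta> y = 1 + (- 1 / flat_exp 0 (flat_exp 0 (3/4)))
    * flat_exp 0 (flat_exp 0 (3/4) + (- 1) * flat_exp 0 (1 + (- 1) * s y))" for y
  have "Ck_on n S \<beta>" if "open S" for n S
    unfolding \<beta>_def[abs_def] s_def
    by (intro Ck_on_add Ck_on_mult Ck_on_sum Ck_on_const Ck_on_coord Ck_on_flat_exp that)
  moreover have "\<beta> y = 1" if "dist z y \<le> \<epsilon> / 2" for y
  proof -
    have "dist z y / \<epsilon> \<le> 1 / 2" using that assms by (simp add: field_simps)
    then have "s y \<le> (1 / 2)\<^sup>2" unfolding s by (rule power_mono) (use assms in simp)
    \<comment> \<open>The constant 3/4 is \<open>1 - s y\<close> at distance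
      \<open>\<epsilon> / 2\<close>. Inside that ball the argument of the outer
      \<open>flat_exp\<close> is thus at most 0.\<close>
    then have "flat_exp 0 (3/4) \<le> flat_exp 0 (1 - s y)"
      by (intro flat_exp_0_mono) (simp add: power2_eq_square)
    then show ?thesis by (simp add: \<beta>_def flat_exp_def[of 0 "flat_exp 0 (3/4) - flat_exp 0 (1 - s y)"])
  qed
  moreover have "\<beta> y = 0" if "\<epsilon> \<le> dist z y" for y
  proof -
    have "1 \<le> dist z y / \<epsilon>" using that assms by (simp add: field_simps)
    then have "1 \<le> s y" unfolding s using one_le_power by blast
    then have "flat_exp 0 (1 - s y) = 0" by (simp add: flat_exp_def)
    moreover have "flat_exp 0 (flat_exp 0 (3/4)) \<noteq> 0" by (simp add: flat_exp_def)
    ultimately show ?thesis by (simp add: \<beta>_def)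
  qed
  ultimately show thesis by (intro that[of \<beta>]) (auto simp: Cinf_on_def)
qed

section \<open>Smooth functions and biorthogonal bases\<close>

lemma Cinf_on_cong: "open S \<Longrightarrow> (\<And>a. a \<in> S \<Longrightarrow> f a = g a) \<Longrightarrow> Cinf_on S f \<Longrightarrow> Cinf_on S g"
  using Ck_on_cong unfolding Cinf_on_def by blast

lemma Cinf_on_subset: "Cinf_on S f \<Longrightarrow> T \<subseteq> S \<Longrightarrow> Cinf_on T f"
  using Ck_on_subset unfolding Cinf_on_def by blast

lemma Cinf_on_differentiable: "open S \<Longrightarrow> Cinf_on S f \<Longrightarrow> a \<in> S \<Longrightarrow> f differentiable at a"
  using Ck_on_Suc_differentiable unfolding Cinf_on_def by blast

lemma Cinf_on_partial: "Cinf_on S f \<Longrightarrow> Cinf_on S (partial k f)"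
  unfolding Cinf_on_def by (metis Ck_on.simps(2))

lemma Cinf_on_add: "open S \<Longrightarrow> Cinf_on S f \<Longrightarrow> Cinf_on S g \<Longrightarrow> Cinf_on S (\<lambda>a. f a + g a)"
  using Ck_on_add unfolding Cinf_on_def by blast

lemma Cinf_on_mult: "open S \<Longrightarrow> Cinf_on S f \<Longrightarrow> Cinf_on S g \<Longrightarrow> Cinf_on S (\<lambda>a. f a * g a)"
  using Ck_on_mult unfolding Cinf_on_def by blast

lemma Cinf_on_compose:
  fixes f :: "real^'d \<Rightarrow> real" and g :: "real^'e \<Rightarrow> real^'d"
  assumes "open S" "open T" "g ` S \<subseteq> T" "Cinf_on T f" "\<And>j. Cinf_on S (\<lambda>a. g a $ j)"
  shows "Cinf_on S (\<lambda>a. f (g a))"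
  using assms(4,5) unfolding Cinf_on_def by (blast intro: Ck_on_compose[OF assms(1-3)])

lemma Cinf_on_locally:
  assumes "open S" "\<And>a. a \<in> S \<Longrightarrow> \<exists>T. open T \<and> a \<in> T \<and> Cinf_on T f"
  shows "Cinf_on S f"
  using Ck_on_locally assms unfolding Cinf_on_def by metis

text \<open>Biorthogonality says that the matrix with rows \<open>d k\<close> times the matrix with
  columns \<open>v k\<close> is the identity. For square matrices the reversed product is the
  identity too, and that is the expansion. It serves both for the coordinate frames and for the
  parallel frame.\<close>

lemma biorthogonal_expand:
  fixes d v :: "'d::finite \<Rightarrow> real^'d"
  assumes "\<And>k l. d k \<bullet> v l = (if k = l then 1 else 0)"
  shows "(\<Sum>k\<in>UNIV. (a \<bullet> v k) *\<^sub>R d k) = a"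
proof (rule vec_eq_iff[THEN iffD2], intro allI)
  fix j
  define M N :: "real^'d^'d" where "M = (\<chi> k j. d k $ j)" and "N = (\<chi> i k. v k $ i)"
  have "M ** N = mat 1"
    using assms by (simp add: M_def N_def matrix_matrix_mult_def mat_def vec_eq_iff inner_vec_def)
  then have "N ** M = mat 1" by (simp add: matrix_left_right_inverse)
  then have "(N ** M) $ i $ j = mat 1 $ i $ j" for i by simp
  then have NM: "(\<Sum>k\<in>UNIV. v k $ i * d k $ j) = (if i = j then 1 else 0)" for i
    by (simp add: M_def N_def matrix_matrix_mult_def mat_def)
  have "(\<Sum>k\<in>UNIV. (a \<bullet> v k) *\<^sub>R d k) $ j = (\<Sum>k\<in>UNIV. \<Sum>i\<in>UNIV. a $ i * (v k $ i * d k $ j))"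
    by (simp add: inner_vec_def sum_distrib_right mult.assoc)
  also have "\<dots> = (\<Sum>i\<in>UNIV. a $ i * (\<Sum>k\<in>UNIV. v k $ i * d k $ j))"
    by (subst sum.swap) (simp add: sum_distrib_left)
  also have "\<dots> = a $ j" by (simp add: NM mult_delta_right)
  finally show "(\<Sum>k\<in>UNIV. (a \<bullet> v k) *\<^sub>R d k) $ j = a $ j" .
qed

section \<open>Germs of functions and 1-forms on a manifold\<close>

locale smooth_manifold =
  fixes A :: "('m::t2_space, 'd::finite) chart set"
  assumes smooth_structure: "smooth_structure A"
begin

lemma chart_facts:
  assumes "c \<in> A"
  shows open_dom: "open (fst c)" and open_rng: "open (snd c ` fst c)"
    and cont_chart: "continuous_on (fst c) (snd c)"
    and cont_chart_inv: "continuous_on (snd c ` fst c) (chart_inv c)"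
    and chart_inv_chart: "\<And>p. p \<in> fst c \<Longrightarrow> chart_inv c (snd c p) = p"
  using smooth_structure assms
  unfolding smooth_structure_def is_chart_def homeomorphism_def by auto

lemma open_chart_image:
  assumes "c \<in> A" "open U"
  shows "open (snd c ` (fst c \<inter> U))"
proof -
  have "snd c ` (fst c \<inter> U) = snd c ` fst c \<inter> chart_inv c -` U"
    using chart_inv_chart[OF assms(1)] by force
  then show ?thesis
    using continuous_open_preimage[OF cont_chart_inv open_rng] assms by metis
qed

lemma tendsto_chart_inv:
  assumes "c \<in> A" "p \<in> fst c"
  shows "filterlim (chart_inv c) (nhds p) (nhds (snd c p))"
proof -
  have "isCont (chart_inv c) (snd c p)"
    using cont_chart_inv[OF assms(1)] open_rng[OF assms(1)] assms(2)
    by (simp add: continuous_on_eq_continuous_at)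
  then show ?thesis
    using chart_inv_chart[OF assms] by (metis isCont_def tendsto_at_iff_tendsto_nhds)
qed

lemma eventually_chart_inv:
  assumes "c \<in> A" "p \<in> fst c" "\<forall>\<^sub>F q in nhds p. Q q"
  shows "\<forall>\<^sub>F z in nhds (snd c p). Q (chart_inv c z)"
  using eventually_compose_filterlim[OF assms(3) tendsto_chart_inv[OF assms(1,2)]] .

lemma eventually_dom: "c \<in> A \<Longrightarrow> p \<in> fst c \<Longrightarrow> \<forall>\<^sub>F q in nhds p. q \<in> fst c"
  by (simp add: open_dom eventually_nhds_in_open)

lemma pd_cong:
  assumes "c \<in> A" "p \<in> fst c" "\<forall>\<^sub>F q in nhds p. f q = g q"
  shows "pd c k f p = pd c k g p"
  unfolding pd_def using eventually_chart_inv[OF assms] by (intro partial_cong) (simp add: o_def)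

text \<open>\<open>smooth_fun\<close> quantifies over all charts. Working with germs at a point
  allows computing in one chart and replacing functions by others that agree nearby.\<close>

definition smooth_at :: "'m \<Rightarrow> ('m \<Rightarrow> real) \<Rightarrow> bool" where
  "smooth_at p f \<longleftrightarrow> (\<exists>U. open U \<and> p \<in> U \<and> smooth_fun A U f)"

lemma transition_Cinf:
  assumes "c \<in> A" "c' \<in> A"
  shows "Cinf_on (snd c ` (fst c \<inter> fst c')) (\<lambda>a. snd c' (chart_inv c a) $ k)"
  using smooth_structure assms unfolding smooth_structure_def compatible_def by blast

lemma smooth_atE:
  assumes "smooth_at p f" "c \<in> A" "p \<in> fst c"
  obtains S where "open S" "snd c p \<in> S" "S \<subseteq> snd c ` fst c" "Cinf_on S (\<lambda>a. f (chart_inv c a))"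
proof -
  obtain U where U: "open U" "p \<in> U" "smooth_fun A U f"
    using assms(1) smooth_at_def by blast
  show thesis
    by (rule that[of "snd c ` (fst c \<inter> U)"])
      (use U assms open_chart_image in \<open>auto simp: smooth_fun_def o_def\<close>)
qed

text \<open>One chart suffices because the transition maps of the atlas are smooth.\<close>

lemma smooth_atI:
  assumes "c \<in> A" "p \<in> fst c" "open S" "snd c p \<in> S" "Cinf_on S (\<lambda>a. f (chart_inv c a))"
  shows "smooth_at p f"
proof -
  define U where "U = fst c \<inter> snd c -` S"
  have U: "open U" "p \<in> U"
    using continuous_open_preimage[OF cont_chart open_dom] assms by (auto simp: U_def)
  have "Cinf_on (snd c' ` (fst c' \<inter> U)) (f \<circ> chart_inv c')" if c': "c' \<in> A" for c'
  proof (rule Cinf_on_cong)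
    show op: "open (snd c' ` (fst c' \<inter> U))" by (rule open_chart_image[OF c' U(1)])
    show "Cinf_on (snd c' ` (fst c' \<inter> U)) (\<lambda>a. f (chart_inv c (snd c (chart_inv c' a))))"
      by (rule Cinf_on_compose[OF op assms(3) _ assms(5)])
        (auto simp: chart_inv_chart[OF c'] U_def intro: Cinf_on_subset[OF transition_Cinf[OF c' assms(1)]])
    show "f (chart_inv c (snd c (chart_inv c' a))) = (f \<circ> chart_inv c') a"
      if "a \<in> snd c' ` (fst c' \<inter> U)" for a
      using that by (auto simp: chart_inv_chart[OF c'] chart_inv_chart[OF assms(1)] U_def)
  qed
  then have "smooth_fun A U f" by (simp add: smooth_fun_def)
  with U show ?thesis unfolding smooth_at_def by blast
qed

lemma smooth_at_eventually:
  assumes "smooth_at p f" shows "\<forall>\<^sub>F q in nhds p. smooth_at q f"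
  using assms unfolding smooth_at_def eventually_nhds by blast

lemma some_chart: obtains c where "c \<in> A" "p \<in> fst c"
  using smooth_structure unfolding smooth_structure_def by blast

lemma smooth_at_cong:
  assumes "smooth_at p f" "\<forall>\<^sub>F q in nhds p. f q = g q"
  shows "smooth_at p g"
proof -
  obtain c where c: "c \<in> A" "p \<in> fst c" by (rule some_chart)
  obtain S where S: "open S" "snd c p \<in> S" "Cinf_on S (\<lambda>a. f (chart_inv c a))"
    using smooth_atE[OF assms(1) c] by metis
  obtain T where T: "open T" "snd c p \<in> T" "\<And>a. a \<in> T \<Longrightarrow> f (chart_inv c a) = g (chart_inv c a)"
    using eventually_chart_inv[OF c assms(2)] unfolding eventually_nhds by blast
  have "Cinf_on (S \<inter> T) (\<lambda>a. g (chart_inv c a))"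
    by (rule Cinf_on_cong[OF _ _ Cinf_on_subset[OF S(3)]]) (use S T in auto)
  then show ?thesis by (intro smooth_atI[OF c, of "S \<inter> T"]) (use S T in auto)
qed

lemma smooth_fun_iff:
  assumes "open W"
  shows "smooth_fun A W f \<longleftrightarrow> (\<forall>p\<in>W. smooth_at p f)"
proof
  assume f: "\<forall>p\<in>W. smooth_at p f"
  have "Cinf_on (snd c ` (fst c \<inter> W)) (f \<circ> chart_inv c)" if c: "c \<in> A" for c
  proof (rule Cinf_on_locally[OF open_chart_image[OF c assms]])
    fix a assume "a \<in> snd c ` (fst c \<inter> W)"
    then obtain p where p: "a = snd c p" "p \<in> fst c" "p \<in> W" by blast
    show "\<exists>T. open T \<and> a \<in> T \<and> Cinf_on T (f \<circ> chart_inv c)"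
      using smooth_atE[OF _ c p(2)] f p(1,3) unfolding o_def by metis
  qed
  then show "smooth_fun A W f" by (simp add: smooth_fun_def)
qed (use assms smooth_at_def in blast)

lemma smooth_at_const [intro]: "smooth_at p (\<lambda>_. r)"
  unfolding smooth_at_def smooth_fun_def Cinf_on_def o_def
  using Ck_on_const by (intro exI[of _ UNIV]) auto

lemma smooth_at_binop:
  assumes f: "smooth_at p f" and g: "smooth_at p g"
    and op: "\<And>S f g :: real^'d \<Rightarrow> real.
      open S \<Longrightarrow> Cinf_on S f \<Longrightarrow> Cinf_on S g \<Longrightarrow> Cinf_on S (\<lambda>a. h (f a) (g a))"
  shows "smooth_at p (\<lambda>q. h (f q) (g q))"
proof -
  obtain c where c: "c \<in> A" "p \<in> fst c" by (rule some_chart)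
  obtain S where S: "open S" "snd c p \<in> S" "Cinf_on S (\<lambda>a. f (chart_inv c a))"
    using smooth_atE[OF f c] by metis
  obtain T where T: "open T" "snd c p \<in> T" "Cinf_on T (\<lambda>a. g (chart_inv c a))"
    using smooth_atE[OF g c] by metis
  have "Cinf_on (S \<inter> T) (\<lambda>a. h (f (chart_inv c a)) (g (chart_inv c a)))"
    by (rule op) (use S T in \<open>auto intro: Cinf_on_subset\<close>)
  then show ?thesis by (intro smooth_atI[OF c, of "S \<inter> T"]) (use S T in auto)
qed

lemma smooth_at_add [intro]: "smooth_at p f \<Longrightarrow> smooth_at p g \<Longrightarrow> smooth_at p (\<lambda>q. f q + g q)"
  by (rule smooth_at_binop) (auto intro: Cinf_on_add)

lemma smooth_at_mult [intro]: "smooth_at p f \<Longrightarrow> smooth_at p g \<Longrightarrow> smooth_at p (\<lambda>q. f q * g q)"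
  by (rule smooth_at_binop) (auto intro: Cinf_on_mult)

lemma smooth_at_minus [intro]: "smooth_at p f \<Longrightarrow> smooth_at p (\<lambda>q. - f q)"
  using smooth_at_mult[OF smooth_at_const[of p "-1"]] by force

lemma smooth_at_diff [intro]: "smooth_at p f \<Longrightarrow> smooth_at p g \<Longrightarrow> smooth_at p (\<lambda>q. f q - g q)"
  using smooth_at_add[OF _ smooth_at_minus] by force

lemma smooth_at_sum [intro]:
  "(\<And>i. i \<in> J \<Longrightarrow> smooth_at p (f i)) \<Longrightarrow> smooth_at p (\<lambda>q. \<Sum>i\<in>J. f i q)"
  by (induction J rule: infinite_finite_induct) auto

lemma smooth_at_coord:
  assumes "c \<in> A" "p \<in> fst c"
  shows "smooth_at p (\<lambda>q. snd c q $ k)"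
proof (rule smooth_atI[OF assms open_rng[OF assms(1)]])
  show "Cinf_on (snd c ` fst c) (\<lambda>a. snd c (chart_inv c a) $ k)"
    using transition_Cinf[OF assms(1) assms(1)] by simp
qed (use assms in auto)

lemma smooth_at_differentiable:
  assumes "smooth_at p f" "c \<in> A" "p \<in> fst c"
  shows "(\<lambda>a. f (chart_inv c a)) differentiable at (snd c p)"
  using smooth_atE[OF assms] Cinf_on_differentiable by metis

lemma smooth_at_pd [intro]:
  assumes "c \<in> A" "p \<in> fst c" "smooth_at p f"
  shows "smooth_at p (pd c k f)"
proof -
  obtain S where S: "open S" "snd c p \<in> S" "S \<subseteq> snd c ` fst c" "Cinf_on S (\<lambda>a. f (chart_inv c a))"
    using smooth_atE[OF assms(3,1,2)] by metis
  have "Cinf_on S (\<lambda>a. pd c k f (chart_inv c a))"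
    by (rule Cinf_on_cong[OF S(1) _ Cinf_on_partial[OF S(4), of k]])
      (use S(3) chart_inv_chart[OF assms(1)] in \<open>auto simp: pd_def o_def\<close>)
  then show ?thesis by (intro smooth_atI[OF assms(1,2)]) (use S in auto)
qed

lemma pd_const [simp]: "pd c k (\<lambda>_. r) p = 0"
  by (simp add: pd_def o_def)

lemma pd_add:
  assumes "c \<in> A" "p \<in> fst c" "smooth_at p f" "smooth_at p g"
  shows "pd c k (\<lambda>q. f q + g q) p = pd c k f p + pd c k g p"
  using partial_add[OF smooth_at_differentiable[OF assms(3,1,2)] smooth_at_differentiable[OF assms(4,1,2)]]
  by (simp add: pd_def o_def)

lemma pd_mult:
  assumes "c \<in> A" "p \<in> fst c" "smooth_at p f" "smooth_at p g"
  shows "pd c k (\<lambda>q. f q * g q) p = pd c k f p * g p + f p * pd c k g p"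
  using partial_mult[OF smooth_at_differentiable[OF assms(3,1,2)] smooth_at_differentiable[OF assms(4,1,2)]]
    chart_inv_chart[OF assms(1,2)]
  by (simp add: pd_def o_def)

lemma pd_minus:
  assumes "c \<in> A" "p \<in> fst c" "smooth_at p f"
  shows "pd c k (\<lambda>q. - f q) p = - pd c k f p"
  using pd_mult[OF assms(1,2) smooth_at_const[of p "-1"] assms(3)] by simp

lemma pd_diff:
  assumes "c \<in> A" "p \<in> fst c" "smooth_at p f" "smooth_at p g"
  shows "pd c k (\<lambda>q. f q - g q) p = pd c k f p - pd c k g p"
  using pd_add[OF assms(1-3) smooth_at_minus[OF assms(4)]] pd_minus[OF assms(1,2,4)] by simp

lemma pd_sum:
  assumes "c \<in> A" "p \<in> fst c" "\<And>i. i \<in> J \<Longrightarrow> smooth_at p (f i)"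
  shows "pd c k (\<lambda>q. \<Sum>i\<in>J. f i q) p = (\<Sum>i\<in>J. pd c k (f i) p)"
  using assms(3)
  by (induction J rule: infinite_finite_induct) (auto simp: pd_add[OF assms(1,2)] smooth_at_sum)

lemma pd_commute:
  assumes "c \<in> A" "p \<in> fst c" "smooth_at p f"
  shows "pd c k (pd c l f) p = pd c l (pd c k f) p"
proof -
  obtain S where S: "open S" "snd c p \<in> S" "S \<subseteq> snd c ` fst c" "Cinf_on S (\<lambda>a. f (chart_inv c a))"
    using smooth_atE[OF assms(3,1,2)] by metis
  define g where "g a = f (chart_inv c a)" for a
  have "pd c k (pd c l f) p = partial k (partial l g) (snd c p)" for k l
    unfolding pd_def[of c k]
    by (rule partial_cong_open[OF S(1) _ S(2)])
      (use S(3) chart_inv_chart[OF assms(1)] in \<open>auto simp: pd_def o_def g_def[abs_def]\<close>)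
  then show ?thesis
    using partial_commute[OF S(1,2), of g k l] S(4) by (simp add: g_def[abs_def] Cinf_on_def)
qed

text \<open>The change of charts is inserted as the transition map, so this is the Euclidean chain
  rule in coordinates.\<close>

lemma pd_chain:
  assumes "c \<in> A" "p \<in> fst c" "c' \<in> A" "p \<in> fst c'" "smooth_at p f"
  shows "pd c k f p = (\<Sum>j\<in>UNIV. pd c' j f p * pd c k (\<lambda>q. snd c' q $ j) p)"
proof -
  have "pd c k f p = partial k (\<lambda>a. f (chart_inv c' (snd c' (chart_inv c a)))) (snd c p)"
    unfolding pd_def
    by (rule partial_cong_open[OF open_chart_image[OF assms(1) open_dom[OF assms(3)]]])
      (use assms in \<open>auto simp: chart_inv_chart\<close>)
  also have "\<dots> = (\<Sum>j\<in>UNIV. pd c' j f p * pd c k (\<lambda>q. snd c' q $ j) p)"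
    using partial_compose[of "\<lambda>a. f (chart_inv c' a)" "\<lambda>a. snd c' (chart_inv c a)" "snd c p" k]
      smooth_at_differentiable[OF assms(5,3,4)]
      smooth_at_differentiable[OF smooth_at_coord[OF assms(3,4)] assms(1,2)]
    by (simp add: chart_inv_chart assms pd_def o_def)
  finally show ?thesis .
qed

lemma pd_coord:
  assumes "c \<in> A" "p \<in> fst c"
  shows "pd c k (\<lambda>q. snd c q $ l) p = (if k = l then 1 else 0)"
proof -
  have "pd c k (\<lambda>q. snd c q $ l) p = partial k (\<lambda>a. a $ l) (snd c p)"
    unfolding pd_def
    by (rule partial_cong_open[OF open_rng[OF assms(1)]])
      (use assms in \<open>auto simp: chart_inv_chart\<close>)
  then show ?thesis by (simp add: partial_coord)
qed

text \<open>A Euclidean bump function is transported by a chart and extended by 0. Vanishing near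
  every point outside \<open>U\<close>, and not merely at it, is what later makes the product with
  an object defined only on \<open>U\<close> smooth everywhere.\<close>

lemma smooth_bump:
  assumes "open U" "p \<in> U"
  obtains \<beta> where "\<And>q. smooth_at q \<beta>" "\<forall>\<^sub>F q in nhds p. \<beta> q = 1"
    "\<And>q. q \<notin> U \<Longrightarrow> \<forall>\<^sub>F q' in nhds q. \<beta> q' = 0"
proof -
  obtain c where c: "c \<in> A" "p \<in> fst c" by (rule some_chart)
  have "open (snd c ` (fst c \<inter> U))" "snd c p \<in> snd c ` (fst c \<inter> U)"
    using open_chart_image[OF c(1) assms(1)] c assms by auto
  then obtain \<epsilon> where \<epsilon>: "0 < \<epsilon>" "cball (snd c p) \<epsilon> \<subseteq> snd c ` (fst c \<inter> U)"
    by (meson open_contains_cball)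
  obtain \<gamma> where \<gamma>: "\<And>S. open S \<Longrightarrow> Cinf_on S \<gamma>" "\<And>y. dist (snd c p) y \<le> \<epsilon> / 2 \<Longrightarrow> \<gamma> y = 1"
    "\<And>y. \<epsilon> \<le> dist (snd c p) y \<Longrightarrow> \<gamma> y = 0"
    using Cinf_bump[OF \<epsilon>(1), of "snd c p"] by blast
  define \<beta> where "\<beta> q = (if q \<in> fst c then \<gamma> (snd c q) else 0)" for q
  define K where "K = chart_inv c ` cball (snd c p) \<epsilon>"
  have "compact K"
    unfolding K_def
    by (rule compact_continuous_image[OF continuous_on_subset[OF cont_chart_inv[OF c(1)]] compact_cball])
      (use \<epsilon> in auto)
  \<comment> \<open>This is where the Hausdorff property enters. A closed coordinate ball is closed
    in the whole manifold, so the extension by 0 is smooth also at boundary points of the chart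
    domain.\<close>
  then have K: "closed K" by (rule compact_imp_closed)
  have KU: "K \<subseteq> fst c \<inter> U"
    using \<epsilon>(2) chart_inv_chart[OF c(1)] unfolding K_def by fastforce
  have "\<beta> q = 0" if "q \<notin> K" for q
  proof (cases "q \<in> fst c")
    case True
    then have "snd c q \<notin> cball (snd c p) \<epsilon>"
      using that chart_inv_chart[OF c(1)] unfolding K_def by force
    then show ?thesis using \<gamma>(3)[of "snd c q"] by (simp add: \<beta>_def)
  qed (simp add: \<beta>_def)
  then have zero: "\<forall>\<^sub>F q' in nhds q. \<beta> q' = 0" if "q \<notin> K" for q
    using K that by (intro eventually_nhds[THEN iffD2] exI[of _ "- K"]) auto
  show thesis
  proof (rule that[of \<beta>])
    fix q
    show "smooth_at q \<beta>"
    proof (cases "q \<in> fst c")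
      case True
      have "Cinf_on (snd c ` fst c) (\<lambda>a. \<beta> (chart_inv c a))"
        by (rule Cinf_on_cong[OF open_rng[OF c(1)] _ \<gamma>(1)[OF open_rng[OF c(1)]]])
          (auto simp: \<beta>_def chart_inv_chart c)
      then show ?thesis
        by (intro smooth_atI[OF c(1) True open_rng[OF c(1)]]) (use True in auto)
    next
      case False
      then have "\<forall>\<^sub>F q' in nhds q. 0 = \<beta> q'"
        using zero[of q] KU by (auto elim: eventually_mono)
      then show ?thesis by (rule smooth_at_cong[OF smooth_at_const])
    qed
    show "\<forall>\<^sub>F q' in nhds q. \<beta> q' = 0" if "q \<notin> U"
      using zero[of q] KU that by blast
    have "\<forall>\<^sub>F q in nhds p. q \<in> fst c \<inter> snd c -` ball (snd c p) (\<epsilon> / 2)"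
      by (rule eventually_nhds_in_open)
        (use continuous_open_preimage[OF cont_chart open_dom] c \<epsilon> in auto)
    then show "\<forall>\<^sub>F q in nhds p. \<beta> q = 1"
      by (rule eventually_mono) (auto simp: \<beta>_def \<gamma>(2))
  qed
qed

section \<open>Coordinate differentials and coordinate vector fields\<close>

lemma pchart_in: "pchart A p \<in> A" "p \<in> fst (pchart A p)"
  using someI_ex[of "\<lambda>c. c \<in> A \<and> p \<in> fst c"] some_chart[of p] unfolding pchart_def by blast+

text \<open>Both sides of the pairing are stored in the arbitrarily selected chart. The chain rule
  cancels that choice, so any chart of the atlas can be used for computations.\<close>

lemma diff_vcoord:
  assumes "c \<in> A" "p \<in> fst c" "smooth_at p f"
  shows "diff A f p \<bullet> vcoord A c k p = pd c k f p"
  using pd_chain[OF assms(1,2) pchart_in assms(3), of k]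
  by (simp add: diff_def vcoord_def inner_vec_def)

lemma dcoord_vcoord:
  assumes "c \<in> A" "p \<in> fst c"
  shows "dcoord A c k p \<bullet> vcoord A c l p = (if k = l then 1 else 0)"
  unfolding dcoord_def using diff_vcoord[OF assms smooth_at_coord[OF assms]] pd_coord[OF assms] by auto

lemma covector_expand:
  assumes "c \<in> A" "p \<in> fst c"
  shows "(\<Sum>k\<in>UNIV. (a \<bullet> vcoord A c k p) *\<^sub>R dcoord A c k p) = a"
  by (rule biorthogonal_expand) (rule dcoord_vcoord[OF assms])

lemma vcoord_pchart: "vcoord A (pchart A p) k p = axis k 1"
  using pd_coord[OF pchart_in] by (simp add: vcoord_def axis_def vec_eq_iff eq_commute)

lemma dcoord_pchart: "dcoord A (pchart A p) k p = axis k 1"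
  using pd_coord[OF pchart_in] by (simp add: dcoord_def diff_def axis_def vec_eq_iff)

lemma diff_cong: "\<forall>\<^sub>F q in nhds p. f q = g q \<Longrightarrow> diff A f p = diff A g p"
  using pd_cong[OF pchart_in] by (simp add: diff_def)

lemma diff_expand:
  assumes "c \<in> A" "p \<in> fst c" "smooth_at p f"
  shows "diff A f p = (\<Sum>k\<in>UNIV. pd c k f p *\<^sub>R dcoord A c k p)"
  using covector_expand[OF assms(1,2), of "diff A f p"] by (simp add: diff_vcoord[OF assms])

lemma diff_const: "diff A (\<lambda>_. r) p = 0"
  by (simp add: diff_def vec_eq_iff)

lemma diff_mult:
  "smooth_at p f \<Longrightarrow> smooth_at p g \<Longrightarrow>
    diff A (\<lambda>q. f q * g q) p = g p *\<^sub>R diff A f p + f p *\<^sub>R diff A g p"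
  by (simp add: diff_def vec_eq_iff pd_mult[OF pchart_in])

lemma diff_sum:
  "(\<And>i. i \<in> J \<Longrightarrow> smooth_at p (f i)) \<Longrightarrow>
    diff A (\<lambda>q. \<Sum>i\<in>J. f i q) p = (\<Sum>i\<in>J. diff A (f i) p)"
  by (simp add: diff_def vec_eq_iff pd_sum[OF pchart_in])

section \<open>Germs of 1-forms\<close>

definition form_at :: "'m \<Rightarrow> ('m \<Rightarrow> real^'d) \<Rightarrow> bool" where
  "form_at p \<alpha> \<longleftrightarrow> (\<exists>U. open U \<and> p \<in> U \<and> \<alpha> \<in> forms1 A U)"

lemma form_atD:
  assumes "form_at p \<alpha>" "c \<in> A" "p \<in> fst c"
  shows "smooth_at p (\<lambda>q. \<alpha> q \<bullet> vcoord A c k q)"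
proof -
  obtain U where "open U" "p \<in> U" "smooth_fun A (fst c \<inter> U) (\<lambda>q. \<alpha> q \<bullet> vcoord A c k q)"
    using assms unfolding form_at_def forms1_def by blast
  then show ?thesis
    using assms open_dom unfolding smooth_at_def by (meson IntI open_Int)
qed

lemma smooth_at_dcoord_vcoord:
  assumes "c \<in> A" "p \<in> fst c" "c' \<in> A" "p \<in> fst c'"
  shows "smooth_at p (\<lambda>q. dcoord A c k q \<bullet> vcoord A c' l q)"
proof (rule smooth_at_cong[OF smooth_at_pd[OF assms(3,4) smooth_at_coord[OF assms(1,2)]]])
  show "\<forall>\<^sub>F q in nhds p. pd c' l (\<lambda>q. snd c q $ k) q = dcoord A c k q \<bullet> vcoord A c' l q"
    using eventually_dom[OF assms(1,2)] eventually_dom[OF assms(3,4)]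
    by eventually_elim (simp add: dcoord_def diff_vcoord assms(1,3) smooth_at_coord)
qed

lemma inner_expand:
  assumes "c \<in> A" "p \<in> fst c"
  shows "a \<bullet> X = (\<Sum>k\<in>UNIV. (a \<bullet> vcoord A c k p) * (dcoord A c k p \<bullet> X))"
  by (subst (1) covector_expand[OF assms, of a, symmetric]) (simp add: inner_sum_left)

lemma smooth_at_inner_vcoord:
  assumes "c \<in> A" "p \<in> fst c" "\<And>k. smooth_at p (\<lambda>q. \<alpha> q \<bullet> vcoord A c k q)" "c' \<in> A" "p \<in> fst c'"
  shows "smooth_at p (\<lambda>q. \<alpha> q \<bullet> vcoord A c' l q)"
proof (rule smooth_at_cong)
  show "smooth_at p (\<lambda>q. \<Sum>k\<in>UNIV. (\<alpha> q \<bullet> vcoord A c k q) * (dcoord A c k q \<bullet> vcoord A c' l q))"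
    by (intro smooth_at_sum smooth_at_mult assms smooth_at_dcoord_vcoord)
  show "\<forall>\<^sub>F q in nhds p. (\<Sum>k\<in>UNIV. (\<alpha> q \<bullet> vcoord A c k q) * (dcoord A c k q \<bullet> vcoord A c' l q))
      = \<alpha> q \<bullet> vcoord A c' l q"
    using eventually_dom[OF assms(1,2)]
    by eventually_elim (rule inner_expand[OF assms(1), symmetric])
qed

lemma form_atI:
  assumes "c \<in> A" "p \<in> fst c" "\<And>k. smooth_at p (\<lambda>q. \<alpha> q \<bullet> vcoord A c k q)"
  shows "form_at p \<alpha>"
proof -
  have "\<forall>\<^sub>F q in nhds p. q \<in> fst c \<and> (\<forall>k. smooth_at q (\<lambda>q. \<alpha> q \<bullet> vcoord A c k q))"
    using eventually_dom[OF assms(1,2)] eventually_all_finite[OF smooth_at_eventually[OF assms(3)]]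
    by (rule eventually_conj)
  then obtain U where U: "open U" "p \<in> U" "U \<subseteq> fst c"
    "\<And>q k. q \<in> U \<Longrightarrow> smooth_at q (\<lambda>q. \<alpha> q \<bullet> vcoord A c k q)"
    unfolding eventually_nhds by blast
  have "smooth_fun A (fst c' \<inter> U) (\<lambda>q. \<alpha> q \<bullet> vcoord A c' k q)" if "c' \<in> A" for c' k
    unfolding smooth_fun_iff[OF open_Int[OF open_dom[OF that] U(1)]]
  proof
    fix q assume "q \<in> fst c' \<inter> U"
    then show "smooth_at q (\<lambda>q. \<alpha> q \<bullet> vcoord A c' k q)"
      using smooth_at_inner_vcoord[OF assms(1) _ U(4) that, of q] U(3) by blast
  qed
  then show ?thesis using U unfolding form_at_def forms1_def by blast
qed

lemma forms1_iff: "open W \<Longrightarrow> \<alpha> \<in> forms1 A W \<longleftrightarrow> (\<forall>p\<in>W. form_at p \<alpha>)"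
proof
  assume W: "open W" and "\<forall>p\<in>W. form_at p \<alpha>"
  then have "smooth_fun A (fst c \<inter> W) (\<lambda>q. \<alpha> q \<bullet> vcoord A c k q)" if "c \<in> A" for c k
    using that by (subst smooth_fun_iff) (auto simp: open_dom open_Int intro!: form_atD)
  then show "\<alpha> \<in> forms1 A W" by (simp add: forms1_def)
qed (auto simp: form_at_def)

lemma form_at_eventually: "form_at p \<alpha> \<Longrightarrow> \<forall>\<^sub>F q in nhds p. form_at q \<alpha>"
  unfolding form_at_def eventually_nhds by blast

lemma form_at_cong:
  assumes "form_at p \<alpha>" "\<forall>\<^sub>F q in nhds p. \<alpha> q = \<alpha>' q"
  shows "form_at p \<alpha>'"
  by (rule form_atI[OF pchart_in], rule smooth_at_cong[OF form_atD[OF assms(1) pchart_in]])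
    (use assms(2) in \<open>auto elim: eventually_mono\<close>)

lemma form_at_add:
  assumes "form_at p \<alpha>" "form_at p \<alpha>'" shows "form_at p (\<lambda>q. \<alpha> q + \<alpha>' q)"
  by (rule form_atI[OF pchart_in])
    (use form_atD[OF assms(1) pchart_in] form_atD[OF assms(2) pchart_in] in \<open>auto simp: inner_add_left\<close>)

lemma form_at_scale:
  assumes "smooth_at p f" "form_at p \<alpha>" shows "form_at p (\<lambda>q. f q *\<^sub>R \<alpha> q)"
  by (rule form_atI[OF pchart_in]) (use form_atD[OF assms(2) pchart_in] assms(1) in auto)

lemma form_at_0: "form_at p (\<lambda>q. 0)"
  by (rule form_atI[OF pchart_in]) auto

lemma form_at_sum: "(\<And>i. i \<in> J \<Longrightarrow> form_at p (\<alpha> i)) \<Longrightarrow> form_at p (\<lambda>q. \<Sum>i\<in>J. \<alpha> i q)"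
  by (induction J rule: infinite_finite_induct) (auto intro: form_at_0 form_at_add)

lemma form_at_dcoord: "c \<in> A \<Longrightarrow> p \<in> fst c \<Longrightarrow> form_at p (dcoord A c k)"
  by (rule form_atI[OF pchart_in]) (auto intro: smooth_at_dcoord_vcoord pchart_in)

text \<open>Cutting off with a bump function supplies the global representatives on which the
  connection is defined, so that \<open>restr\<close> has something to choose from.\<close>

lemma form_at_global_extension:
  assumes "form_at p \<alpha>"
  obtains \<alpha>' where "\<alpha>' \<in> forms1 A UNIV" "\<forall>\<^sub>F q in nhds p. \<alpha>' q = \<alpha> q"
proof -
  obtain U where U: "open U" "p \<in> U" "\<And>q. q \<in> U \<Longrightarrow> form_at q \<alpha>"
    using form_at_eventually[OF assms] unfolding eventually_nhds by blast
  obtain \<beta> where \<beta>: "\<And>q. smooth_at q \<beta>" "\<forall>\<^sub>F q in nhds p. \<beta> q = 1"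
    "\<And>q. q \<notin> U \<Longrightarrow> \<forall>\<^sub>F q' in nhds q. \<beta> q' = 0"
    using smooth_bump[OF U(1,2)] by blast
  show thesis
  proof (rule that)
    have "form_at q (\<lambda>q. \<beta> q *\<^sub>R \<alpha> q)" for q
    proof (cases "q \<in> U")
      case False
      show ?thesis
        by (rule form_at_cong[OF form_at_0]) (use \<beta>(3)[OF False] in \<open>auto elim: eventually_mono\<close>)
    qed (use U \<beta> in \<open>auto intro: form_at_scale\<close>)
    then show "(\<lambda>q. \<beta> q *\<^sub>R \<alpha> q) \<in> forms1 A UNIV" by (simp add: forms1_iff)
    show "\<forall>\<^sub>F q in nhds p. \<beta> q *\<^sub>R \<alpha> q = \<alpha> q"
      using \<beta>(2) by eventually_elim simp
  qed
qed

end

section \<open>The exterior and Lie derivatives\<close>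

lemma wedge_add: "wedge (a + a') b = wedge a b + wedge a' b" "wedge a (b + b') = wedge a b + wedge a b'"
  by (simp_all add: wedge_def vec_eq_iff algebra_simps)

lemma wedge_scaleR: "wedge (s *\<^sub>R a) b = s *\<^sub>R wedge a b" "wedge a (s *\<^sub>R b) = s *\<^sub>R wedge a b"
  by (simp_all add: wedge_def vec_eq_iff algebra_simps)

lemma wedge_0 [simp]: "wedge 0 b = 0" "wedge a 0 = 0"
  by (simp_all add: wedge_def vec_eq_iff)

lemma wedge_sum: "wedge (\<Sum>i\<in>J. f i) b = (\<Sum>i\<in>J. wedge (f i) b)"
    "wedge a (\<Sum>i\<in>J. f i) = (\<Sum>i\<in>J. wedge a (f i))"
  by (induction J rule: infinite_finite_induct) (auto simp: wedge_add)

lemma wedge_sum_sum: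
  "wedge (\<Sum>i\<in>J. f i) (\<Sum>j\<in>K. g j) = (\<Sum>i\<in>J. \<Sum>j\<in>K. wedge (f i) (g j))"
  by (subst wedge_sum(1)) (simp only: wedge_sum(2))

lemma wedge_skew: "wedge b a = - wedge a b"
  by (simp add: wedge_def vec_eq_iff)

lemma wedge_pair: "u \<bullet> (wedge a b *v w) = (a \<bullet> u) * (b \<bullet> w) - (a \<bullet> w) * (b \<bullet> u)"
proof -
  have "u \<bullet> (wedge a b *v w) = (\<Sum>k\<in>UNIV. \<Sum>l\<in>UNIV. (a $ k * u $ k) * (b $ l * w $ l)
      - (b $ k * u $ k) * (a $ l * w $ l))"
    by (simp add: inner_vec_def matrix_vector_mult_def wedge_def sum_distrib_left algebra_simps)
  also have "\<dots> = (a \<bullet> u) * (b \<bullet> w) - (b \<bullet> u) * (a \<bullet> w)"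
    by (simp add: inner_vec_def sum_subtractf sum_product)
  finally show ?thesis by simp
qed

lemma matrix_pair_sum: "u \<bullet> ((\<Sum>i\<in>J. M i) *v w) = (\<Sum>i\<in>J. u \<bullet> (M i *v w))"
  for M :: "'i \<Rightarrow> real^'d^'d"
  by (induction J rule: infinite_finite_induct)
    (auto simp: matrix_vector_mult_add_rdistrib inner_add_right)

lemma matrix_pair_scaleR: "u \<bullet> ((s *\<^sub>R M) *v w) = s * (u \<bullet> (M *v w))"
  for M :: "real^'d^'d"
  by (simp add: scaleR_matrix_vector_assoc[symmetric])

lemma inner_anchor: "b \<bullet> anchor M a = biv M a b"
  by (simp add: anchor_def biv_def dot_lmul_matrix inner_commute[of b])

lemma anchor_add: "anchor M (a + b) = anchor M a + anchor M b"
  by (simp add: anchor_def vector_matrix_left_distrib)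

lemma anchor_scaleR: "anchor M (s *\<^sub>R a) = s *\<^sub>R anchor M a"
  by (simp add: anchor_def scaleR_vector_matrix_assoc)

lemma anchor_0 [simp]: "anchor M 0 = 0"
  by (simp add: anchor_def)

lemma anchor_sum: "anchor M (\<Sum>i\<in>J. f i) = (\<Sum>i\<in>J. anchor M (f i))"
  by (induction J rule: infinite_finite_induct) (auto simp: anchor_add)

lemma sum_swap4:
  "(\<Sum>k\<in>K. \<Sum>l\<in>L. \<Sum>m\<in>M. \<Sum>n\<in>N. f k l m n) = (\<Sum>m\<in>M. \<Sum>n\<in>N. \<Sum>k\<in>K. \<Sum>l\<in>L. f k l m n)"
proof -
  have "(\<Sum>k\<in>K. \<Sum>l\<in>L. \<Sum>m\<in>M. \<Sum>n\<in>N. f k l m n) = (\<Sum>k\<in>K. \<Sum>m\<in>M. \<Sum>n\<in>N. \<Sum>l\<in>L. f k l m n)"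
    by (subst (2) sum.swap, subst (3) sum.swap) rule
  also have "\<dots> = (\<Sum>m\<in>M. \<Sum>n\<in>N. \<Sum>k\<in>K. \<Sum>l\<in>L. f k l m n)"
    by (subst (1) sum.swap, subst (2) sum.swap) rule
  finally show ?thesis .
qed

lemma anchor_diff: "anchor M (a - b) = anchor M a - anchor M b"
  using anchor_add[of M "a - b" b] by simp

context smooth_manifold
begin

section \<open>The exterior derivative and Cartan's formula\<close>

lemma ext_d_cong:
  assumes "\<forall>\<^sub>F q in nhds p. \<alpha> q = \<alpha>' q"
  shows "ext_d A \<alpha> p = ext_d A \<alpha>' p"
proof -
  have "pd (pchart A p) k (\<lambda>q. \<alpha> q \<bullet> vcoord A (pchart A p) l q) p
      = pd (pchart A p) k (\<lambda>q. \<alpha>' q \<bullet> vcoord A (pchart A p) l q) p" for k l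
    by (rule pd_cong[OF pchart_in]) (use assms in \<open>auto elim: eventually_mono\<close>)
  then show ?thesis by (simp add: ext_d_def Let_def)
qed

text \<open>In the selected chart the components of the form are first derivatives of one coordinate
  function, so symmetry of second derivatives gives d d = 0.\<close>

lemma ext_d_dcoord:
  assumes "c \<in> A" "p \<in> fst c"
  shows "ext_d A (dcoord A c n) p = 0"
proof -
  let ?c = "pchart A p"
  have "pd ?c k (\<lambda>q. dcoord A c n q \<bullet> vcoord A ?c l q) p = pd ?c k (pd ?c l (\<lambda>q. snd c q $ n)) p" for k l
  proof (rule pd_cong[OF pchart_in])
    show "\<forall>\<^sub>F q in nhds p. dcoord A c n q \<bullet> vcoord A ?c l q = pd ?c l (\<lambda>q. snd c q $ n) q"
      using eventually_dom[OF assms] eventually_dom[OF pchart_in]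
      by eventually_elim (simp add: dcoord_def diff_vcoord pchart_in smooth_at_coord assms)
  qed
  then show ?thesis
    using pd_commute[OF pchart_in smooth_at_coord[OF assms]]
    by (simp add: ext_d_def Let_def vec_eq_iff)
qed

lemma ext_d_0 [simp]: "ext_d A (\<lambda>q. 0) p = 0"
  by (simp add: ext_d_def Let_def vec_eq_iff)

lemma ext_d_add:
  assumes "form_at p \<alpha>" "form_at p \<alpha>'"
  shows "ext_d A (\<lambda>q. \<alpha> q + \<alpha>' q) p = ext_d A \<alpha> p + ext_d A \<alpha>' p"
  using form_atD[OF assms(1) pchart_in] form_atD[OF assms(2) pchart_in]
  by (simp add: ext_d_def Let_def vec_eq_iff inner_add_left pd_add[OF pchart_in])

lemma ext_d_scale:
  assumes "smooth_at p f" "form_at p \<alpha>"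
  shows "ext_d A (\<lambda>q. f q *\<^sub>R \<alpha> q) p = wedge (diff A f p) (\<alpha> p) + f p *\<^sub>R ext_d A \<alpha> p"
  using form_atD[OF assms(2) pchart_in] assms(1)
  by (simp add: ext_d_def Let_def vec_eq_iff pd_mult[OF pchart_in] wedge_def diff_def
      vcoord_pchart inner_axis algebra_simps)

lemma ext_d_sum:
  assumes "\<And>i. i \<in> J \<Longrightarrow> smooth_at p (f i)" "\<And>i. i \<in> J \<Longrightarrow> form_at p (\<xi> i)"
  shows "ext_d A (\<lambda>q. \<Sum>i\<in>J. f i q *\<^sub>R \<xi> i q) p
    = (\<Sum>i\<in>J. wedge (diff A (f i) p) (\<xi> i p) + f i p *\<^sub>R ext_d A (\<xi> i) p)"
  using assms
  by (induction J rule: infinite_finite_induct)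
    (auto simp: ext_d_add ext_d_scale form_at_scale form_at_sum)

lemma eventually_covector_expand:
  assumes "c \<in> A" "p \<in> fst c"
  shows "\<forall>\<^sub>F q in nhds p. \<alpha> q = (\<Sum>k\<in>UNIV. (\<alpha> q \<bullet> vcoord A c k q) *\<^sub>R dcoord A c k q)"
  using eventually_dom[OF assms] by eventually_elim (simp add: covector_expand assms)

text \<open>\<open>ext_d\<close> is defined in the selected chart. Its formula in an arbitrary chart
  follows from the Leibniz rule and closedness of the coordinate differentials, without transforming
  second derivatives between charts.\<close>

lemma ext_d_expand:
  assumes "c \<in> A" "p \<in> fst c" "form_at p \<alpha>"
  shows "ext_d A \<alpha> p
    = (\<Sum>n\<in>UNIV. wedge (diff A (\<lambda>q. \<alpha> q \<bullet> vcoord A c n q) p) (dcoord A c n p))"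
  unfolding ext_d_cong[OF eventually_covector_expand[OF assms(1,2)], of \<alpha>]
  using form_atD[OF assms(3,1,2)] form_at_dcoord[OF assms(1,2)] ext_d_dcoord[OF assms(1,2)]
  by (subst ext_d_sum) auto

lemma ext_d_pair:
  assumes "c \<in> A" "p \<in> fst c" "form_at p \<alpha>"
  shows "vcoord A c k p \<bullet> (ext_d A \<alpha> p *v vcoord A c l p)
    = pd c k (\<lambda>q. \<alpha> q \<bullet> vcoord A c l q) p - pd c l (\<lambda>q. \<alpha> q \<bullet> vcoord A c k q) p"
  using diff_vcoord[OF assms(1,2) form_atD[OF assms(3,1,2)]]
  by (simp add: ext_d_expand[OF assms] matrix_pair_sum wedge_pair dcoord_vcoord[OF assms(1,2)]
      sum_subtractf mult_delta_right mult_delta_left)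

text \<open>Cartan's formula: the product \<open>v*\<close> with the matrix of d\<beta> is
  contraction in the first slot. Differentiating the pairing \<open>\<beta> q \<bullet> X q\<close>
  produces the terms with derivatives of \<open>X\<close> and the correction that turns derivatives
  of \<beta> into d\<beta>.\<close>

lemma lie1_cartan:
  assumes "form_at p \<beta>" "\<And>l. smooth_at p (\<lambda>q. dcoord A (pchart A p) l q \<bullet> X q)"
  shows "lie1 A X \<beta> p = X p v* ext_d A \<beta> p + diff A (\<lambda>q. \<beta> q \<bullet> X q) p"
proof -
  let ?c = "pchart A p"
  have b: "smooth_at p (\<lambda>q. \<beta> q \<bullet> vcoord A ?c l q)" for l
    by (rule form_atD[OF assms(1) pchart_in])
  have "pd ?c k (\<lambda>q. \<beta> q \<bullet> X q) p
      = pd ?c k (\<lambda>q. \<Sum>l\<in>UNIV. (\<beta> q \<bullet> vcoord A ?c l q) * (dcoord A ?c l q \<bullet> X q)) p" for k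
  proof (rule pd_cong[OF pchart_in])
    show "\<forall>\<^sub>F q in nhds p. \<beta> q \<bullet> X q = (\<Sum>l\<in>UNIV. (\<beta> q \<bullet> vcoord A ?c l q) * (dcoord A ?c l q \<bullet> X q))"
      using eventually_dom[OF pchart_in] by eventually_elim (rule inner_expand[OF pchart_in(1)])
  qed
  also have "pd ?c k (\<lambda>q. \<Sum>l\<in>UNIV. (\<beta> q \<bullet> vcoord A ?c l q) * (dcoord A ?c l q \<bullet> X q)) p
      = (\<Sum>l\<in>UNIV. pd ?c k (\<lambda>q. \<beta> q \<bullet> vcoord A ?c l q) p * (dcoord A ?c l p \<bullet> X p)
        + (\<beta> p \<bullet> vcoord A ?c l p) * pd ?c k (\<lambda>q. dcoord A ?c l q \<bullet> X q) p)" for k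
    using b assms(2) by (simp add: pd_sum[OF pchart_in] pd_mult[OF pchart_in] smooth_at_mult)
  finally show ?thesis
    by (simp add: lie1_def Let_def vec_eq_iff diff_def vector_matrix_mult_def ext_d_def
        dcoord_pchart inner_axis' sum.distrib[symmetric] algebra_simps)
qed

lemma lie1_cong:
  assumes "\<forall>\<^sub>F q in nhds p. X q = X' q" "\<forall>\<^sub>F q in nhds p. \<beta> q = \<beta>' q"
  shows "lie1 A X \<beta> p = lie1 A X' \<beta>' p"
proof -
  let ?c = "pchart A p"
  have "pd ?c l (\<lambda>q. \<beta> q \<bullet> vcoord A ?c k q) p = pd ?c l (\<lambda>q. \<beta>' q \<bullet> vcoord A ?c k q) p" for l k
    by (rule pd_cong[OF pchart_in]) (use assms in \<open>auto elim: eventually_mono\<close>)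
  moreover have "pd ?c k (\<lambda>q. dcoord A ?c l q \<bullet> X q) p = pd ?c k (\<lambda>q. dcoord A ?c l q \<bullet> X' q) p" for l k
    by (rule pd_cong[OF pchart_in]) (use assms in \<open>auto elim: eventually_mono\<close>)
  ultimately show ?thesis
    using assms[THEN eventually_nhds_x_imp_x] by (simp add: lie1_def Let_def)
qed

lemma smooth_at_global_extension:
  assumes "smooth_at p f"
  obtains f' where "\<And>q. smooth_at q f'" "\<forall>\<^sub>F q in nhds p. f' q = f q"
proof -
  obtain U where U: "open U" "p \<in> U" "\<And>q. q \<in> U \<Longrightarrow> smooth_at q f"
    using smooth_at_eventually[OF assms] unfolding eventually_nhds by blast
  obtain \<beta> where \<beta>: "\<And>q. smooth_at q \<beta>" "\<forall>\<^sub>F q in nhds p. \<beta> q = 1"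
    "\<And>q. q \<notin> U \<Longrightarrow> \<forall>\<^sub>F q' in nhds q. \<beta> q' = 0"
    using smooth_bump[OF U(1,2)] by blast
  show thesis
  proof (rule that)
    show "smooth_at q (\<lambda>q. \<beta> q * f q)" for q
    proof (cases "q \<in> U")
      case False
      show ?thesis
        by (rule smooth_at_cong[OF smooth_at_const]) (use \<beta>(3)[OF False] in \<open>auto elim: eventually_mono\<close>)
    qed (use U \<beta> in auto)
    show "\<forall>\<^sub>F q in nhds p. \<beta> q * f q = f q"
      using \<beta>(2) by eventually_elim simp
  qed
qed

end

section \<open>Torsion-free contravariant connections\<close>

locale poisson_manifold = smooth_manifold A
  for A :: "('m::t2_space, 'd::finite) chart set" +
  fixes P :: "'m \<Rightarrow> real^'d^'d"
  assumes poisson: "poisson A P"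
begin

lemma biv_skew: "biv (P q) b a = - biv (P q) a b"
proof -
  have "transpose (P q) = - P q" using poisson by (simp add: poisson_def)
  then have "a v* P q = (- P q) *v a" by (metis transpose_matrix_vector)
  then have "P q *v a = - (a v* P q)"
    by (simp add: matrix_vector_mult_def sum_negf vec_eq_iff)
  then show ?thesis
    by (simp add: biv_def dot_lmul_matrix[symmetric] inner_commute)
qed

lemma biv_expand:
  assumes "c \<in> A" "q \<in> fst c"
  shows "biv (P q) a b = (\<Sum>k\<in>UNIV. \<Sum>l\<in>UNIV.
    (a \<bullet> vcoord A c k q) * (b \<bullet> vcoord A c l q) * pi_comp A P c k l q)"
proof -
  have pair: "biv (P q) (dcoord A c k q) b = (\<Sum>l\<in>UNIV. (b \<bullet> vcoord A c l q) * pi_comp A P c k l q)" for k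
    using inner_expand[OF assms, of b "anchor (P q) (dcoord A c k q)"]
    by (simp add: inner_anchor pi_comp_def)
  have "biv (P q) a b = b \<bullet> anchor (P q) (\<Sum>k\<in>UNIV. (a \<bullet> vcoord A c k q) *\<^sub>R dcoord A c k q)"
    by (simp add: inner_anchor covector_expand assms)
  also have "\<dots> = (\<Sum>k\<in>UNIV. (a \<bullet> vcoord A c k q) * biv (P q) (dcoord A c k q) b)"
    by (simp add: anchor_sum anchor_scaleR inner_sum_right inner_anchor)
  also have "\<dots> = (\<Sum>k\<in>UNIV. (a \<bullet> vcoord A c k q) * (\<Sum>l\<in>UNIV. (b \<bullet> vcoord A c l q) * pi_comp A P c k l q))"
    unfolding pair ..
  finally show ?thesis by (simp add: sum_distrib_left mult.assoc)
qed

lemma anchor_dcoord_expand: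
  assumes "c \<in> A" "q \<in> fst c"
  shows "anchor (P q) (dcoord A c i q) = (\<Sum>l\<in>UNIV. pi_comp A P c i l q *\<^sub>R vcoord A c l q)"
proof -
  have "b \<bullet> anchor (P q) (dcoord A c i q) = b \<bullet> (\<Sum>l\<in>UNIV. pi_comp A P c i l q *\<^sub>R vcoord A c l q)" for b
    using inner_expand[OF assms, of b "anchor (P q) (dcoord A c i q)"]
    by (simp add: inner_anchor pi_comp_def inner_sum_right mult.commute)
  then show ?thesis using vector_eq_ldot by blast
qed

lemma smooth_at_pi_comp:
  assumes "c \<in> A" "q \<in> fst c" shows "smooth_at q (pi_comp A P c k l)"
  using poisson assms open_dom unfolding poisson_def smooth_at_def pi_comp_def[abs_def] by blast

lemma smooth_at_biv:
  assumes "form_at p \<alpha>" "form_at p \<beta>"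
  shows "smooth_at p (\<lambda>q. biv (P q) (\<alpha> q) (\<beta> q))"
proof (rule smooth_at_cong)
  let ?c = "pchart A p"
  show "smooth_at p (\<lambda>q. \<Sum>k\<in>UNIV. \<Sum>l\<in>UNIV.
      (\<alpha> q \<bullet> vcoord A ?c k q) * (\<beta> q \<bullet> vcoord A ?c l q) * pi_comp A P ?c k l q)"
    by (intro smooth_at_sum smooth_at_mult smooth_at_pi_comp form_atD[OF assms(1)] form_atD[OF assms(2)] pchart_in)
  show "\<forall>\<^sub>F q in nhds p. (\<Sum>k\<in>UNIV. \<Sum>l\<in>UNIV.
      (\<alpha> q \<bullet> vcoord A ?c k q) * (\<beta> q \<bullet> vcoord A ?c l q) * pi_comp A P ?c k l q)
      = biv (P q) (\<alpha> q) (\<beta> q)"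
    using eventually_dom[OF pchart_in] by eventually_elim (rule biv_expand[OF pchart_in(1), symmetric])
qed

text \<open>Cartan's formula contributes d(\<pi>(\<alpha>, \<beta>)) from each of the two Lie
  derivatives, the second one by skewness. The definition subtracts one copy, so one
  remains.\<close>

lemma koszul_formula:
  assumes "form_at p \<alpha>" "form_at p \<beta>"
  shows "koszul A P \<alpha> \<beta> p = anchor (P p) (\<alpha> p) v* ext_d A \<beta> p - anchor (P p) (\<beta> p) v* ext_d A \<alpha> p
    + diff A (\<lambda>q. biv (P q) (\<alpha> q) (\<beta> q)) p"
proof -
  have "smooth_at p (\<lambda>q. dcoord A (pchart A p) l q \<bullet> anchor (P q) (\<gamma> q))" if "form_at p \<gamma>" for \<gamma> l
    unfolding inner_anchor by (rule smooth_at_biv[OF that form_at_dcoord[OF pchart_in]])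
  note lie = lie1_cartan[OF assms(2) this[OF assms(1)]] lie1_cartan[OF assms(1) this[OF assms(2)]]
  have "diff A (\<lambda>q. biv (P q) (\<beta> q) (\<alpha> q)) p = - diff A (\<lambda>q. biv (P q) (\<alpha> q) (\<beta> q)) p"
    unfolding biv_skew[of _ "\<beta> _" "\<alpha> _"]
    using pd_minus[OF pchart_in smooth_at_biv[OF assms]] by (simp add: diff_def vec_eq_iff)
  then show ?thesis by (simp add: koszul_def lie inner_anchor)
qed

lemma koszul_cong:
  assumes "\<forall>\<^sub>F q in nhds p. \<alpha> q = \<alpha>' q" "\<forall>\<^sub>F q in nhds p. \<beta> q = \<beta>' q"
  shows "koszul A P \<alpha> \<beta> p = koszul A P \<alpha>' \<beta>' p"
proof -
  have "diff A (\<lambda>q. biv (P q) (\<alpha> q) (\<beta> q)) p = diff A (\<lambda>q. biv (P q) (\<alpha>' q) (\<beta>' q)) p"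
    by (rule diff_cong) (use assms in \<open>eventually_elim, simp\<close>)
  moreover have "lie1 A (\<lambda>q. anchor (P q) (\<alpha> q)) \<beta> p = lie1 A (\<lambda>q. anchor (P q) (\<alpha>' q)) \<beta>' p"
    by (rule lie1_cong) (use assms in \<open>auto elim: eventually_mono\<close>)
  moreover have "lie1 A (\<lambda>q. anchor (P q) (\<beta> q)) \<alpha> p = lie1 A (\<lambda>q. anchor (P q) (\<beta>' q)) \<alpha>' p"
    by (rule lie1_cong) (use assms in \<open>auto elim: eventually_mono\<close>)
  ultimately show ?thesis by (simp add: koszul_def)
qed

end

locale torsion_free_connection = poisson_manifold A P
  for A :: "('m::t2_space, 'd::finite) chart set" and P :: "'m \<Rightarrow> real^'d^'d" +
  fixes D :: "('m \<Rightarrow> real^'d) \<Rightarrow> ('m \<Rightarrow> real^'d) \<Rightarrow> 'm \<Rightarrow> real^'d"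
  assumes connection: "contravariant_connection A P D" and torsion_free: "torsion_free A P D"
begin

section \<open>Locality of the connection and its restriction to germs\<close>

lemma D_add: "\<alpha> \<in> forms1 A UNIV \<Longrightarrow> \<beta> \<in> forms1 A UNIV \<Longrightarrow> \<beta>' \<in> forms1 A UNIV \<Longrightarrow>
    D \<alpha> (\<lambda>p. \<beta> p + \<beta>' p) p = D \<alpha> \<beta> p + D \<alpha> \<beta>' p"
  using connection unfolding contravariant_connection_def by simp

lemma D_scale:
  assumes "\<And>q. smooth_at q f" "\<alpha> \<in> forms1 A UNIV" "\<beta> \<in> forms1 A UNIV"
  shows "D (\<lambda>p. f p *\<^sub>R \<alpha> p) \<beta> p = f p *\<^sub>R D \<alpha> \<beta> p"
    and "D \<alpha> (\<lambda>p. f p *\<^sub>R \<beta> p) p = f p *\<^sub>R D \<alpha> \<beta> p + (anchor (P p) (\<alpha> p) \<bullet> diff A f p) *\<^sub>R \<beta> p"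
  using connection assms unfolding contravariant_connection_def by (simp_all add: smooth_fun_iff)

text \<open>Multiplication by a bump function makes forms with equal germs globally equal. It
  changes neither derivative at \<open>p\<close>, because there the function is 1 and its
  differential, which enters the Leibniz rule, is 0.\<close>

lemma D_local:
  assumes "\<alpha> \<in> forms1 A UNIV" "\<alpha>' \<in> forms1 A UNIV" "\<beta> \<in> forms1 A UNIV" "\<beta>' \<in> forms1 A UNIV"
    and "\<forall>\<^sub>F q in nhds p. \<alpha> q = \<alpha>' q" "\<forall>\<^sub>F q in nhds p. \<beta> q = \<beta>' q"
  shows "D \<alpha> \<beta> p = D \<alpha>' \<beta>' p"
proof -
  obtain U where U: "open U" "p \<in> U" "\<And>q. q \<in> U \<Longrightarrow> \<alpha> q = \<alpha>' q \<and> \<beta> q = \<beta>' q"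
    using eventually_conj[OF assms(5,6)] unfolding eventually_nhds by blast
  obtain \<eta> where \<eta>: "\<And>q. smooth_at q \<eta>" "\<forall>\<^sub>F q in nhds p. \<eta> q = 1"
    "\<And>q. q \<notin> U \<Longrightarrow> \<forall>\<^sub>F q' in nhds q. \<eta> q' = 0"
    using smooth_bump[OF U(1,2)] by blast
  have p: "\<eta> p = 1" "diff A \<eta> p = 0"
    using eventually_nhds_x_imp_x[OF \<eta>(2)] diff_cong[OF \<eta>(2)] diff_const by auto
  have eq: "(\<lambda>q. \<eta> q *\<^sub>R \<alpha> q) = (\<lambda>q. \<eta> q *\<^sub>R \<alpha>' q)" "(\<lambda>q. \<eta> q *\<^sub>R \<beta> q) = (\<lambda>q. \<eta> q *\<^sub>R \<beta>' q)"
    using U(3) eventually_nhds_x_imp_x[OF \<eta>(3)] by (metis scale_zero_left)+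
  have "D \<alpha> \<beta> p = D (\<lambda>q. \<eta> q *\<^sub>R \<alpha> q) \<beta> p" using D_scale(1)[OF \<eta>(1) assms(1,3)] p by simp
  also have "\<dots> = D \<alpha>' \<beta> p" using D_scale(1)[OF \<eta>(1) assms(2,3)] p eq by simp
  also have "\<dots> = D \<alpha>' (\<lambda>q. \<eta> q *\<^sub>R \<beta> q) p" using D_scale(2)[OF \<eta>(1) assms(2,3)] p by simp
  also have "\<dots> = D \<alpha>' \<beta>' p" using D_scale(2)[OF \<eta>(1) assms(2,4)] p eq by simp
  finally show ?thesis .
qed

text \<open>Locality makes the description in \<open>restr\<close> independent of the chosen
  extensions. All rules for \<open>restr\<close> below are those of \<open>D\<close> read through
  this equation.\<close>

lemma restr_eq:
  assumes "\<alpha>' \<in> forms1 A UNIV" "\<beta>' \<in> forms1 A UNIV"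
    and "\<forall>\<^sub>F q in nhds p. \<alpha>' q = \<alpha> q" "\<forall>\<^sub>F q in nhds p. \<beta>' q = \<beta> q"
  shows "restr A D \<alpha> \<beta> p = D \<alpha>' \<beta>' p"
  unfolding restr_def
proof (rule the_equality)
  show "\<exists>\<alpha>''\<in>forms1 A UNIV. \<exists>\<beta>''\<in>forms1 A UNIV. (\<forall>\<^sub>F q in nhds p. \<alpha>'' q = \<alpha> q) \<and>
      (\<forall>\<^sub>F q in nhds p. \<beta>'' q = \<beta> q) \<and> D \<alpha>' \<beta>' p = D \<alpha>'' \<beta>'' p"
    using assms by blast
next
  fix a
  assume "\<exists>\<alpha>''\<in>forms1 A UNIV. \<exists>\<beta>''\<in>forms1 A UNIV. (\<forall>\<^sub>F q in nhds p. \<alpha>'' q = \<alpha> q) \<and>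
      (\<forall>\<^sub>F q in nhds p. \<beta>'' q = \<beta> q) \<and> a = D \<alpha>'' \<beta>'' p"
  then obtain \<alpha>'' \<beta>'' where *: "\<alpha>'' \<in> forms1 A UNIV" "\<beta>'' \<in> forms1 A UNIV"
    "\<forall>\<^sub>F q in nhds p. \<alpha>'' q = \<alpha> q" "\<forall>\<^sub>F q in nhds p. \<beta>'' q = \<beta> q" "a = D \<alpha>'' \<beta>'' p" by blast
  show "a = D \<alpha>' \<beta>' p"
    unfolding *(5) by (rule D_local[OF *(1) assms(1) *(2) assms(2)])
      (use *(3,4) assms(3,4) in \<open>eventually_elim, simp\<close>)+
qed

lemma restr_cong:
  assumes "\<forall>\<^sub>F q in nhds p. \<alpha> q = \<alpha>' q" "\<forall>\<^sub>F q in nhds p. \<beta> q = \<beta>' q"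
  shows "restr A D \<alpha> \<beta> p = restr A D \<alpha>' \<beta>' p"
proof -
  have "(\<forall>\<^sub>F q in nhds p. \<gamma> q = \<alpha> q) \<longleftrightarrow> (\<forall>\<^sub>F q in nhds p. \<gamma> q = \<alpha>' q)" for \<gamma>
    by (rule eventually_subst) (use assms in \<open>auto elim: eventually_mono\<close>)
  moreover have "(\<forall>\<^sub>F q in nhds p. \<gamma> q = \<beta> q) \<longleftrightarrow> (\<forall>\<^sub>F q in nhds p. \<gamma> q = \<beta>' q)" for \<gamma>
    by (rule eventually_subst) (use assms in \<open>auto elim: eventually_mono\<close>)
  ultimately show ?thesis by (simp add: restr_def)
qed

lemma restr_add:
  assumes "form_at p \<alpha>" "form_at p \<beta>" "form_at p \<beta>'"
  shows "restr A D \<alpha> (\<lambda>q. \<beta> q + \<beta>' q) p = restr A D \<alpha> \<beta> p + restr A D \<alpha> \<beta>' p"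
proof -
  obtain a where a: "a \<in> forms1 A UNIV" "\<forall>\<^sub>F q in nhds p. a q = \<alpha> q"
    using form_at_global_extension[OF assms(1)] .
  obtain b where b: "b \<in> forms1 A UNIV" "\<forall>\<^sub>F q in nhds p. b q = \<beta> q"
    using form_at_global_extension[OF assms(2)] .
  obtain b' where b': "b' \<in> forms1 A UNIV" "\<forall>\<^sub>F q in nhds p. b' q = \<beta>' q"
    using form_at_global_extension[OF assms(3)] .
  have "(\<lambda>q. b q + b' q) \<in> forms1 A UNIV" using b(1) b'(1) by (simp add: forms1_iff form_at_add)
  moreover have "\<forall>\<^sub>F q in nhds p. b q + b' q = \<beta> q + \<beta>' q"
    using b(2) b'(2) by eventually_elim simp
  ultimately show ?thesis
    using a b b' by (simp add: restr_eq[OF a(1) _ a(2)] D_add)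
qed

lemma restr_scale:
  assumes "form_at p \<alpha>" "smooth_at p f" "form_at p \<beta>"
  shows "restr A D \<alpha> (\<lambda>q. f q *\<^sub>R \<beta> q) p
    = f p *\<^sub>R restr A D \<alpha> \<beta> p + (anchor (P p) (\<alpha> p) \<bullet> diff A f p) *\<^sub>R \<beta> p"
proof -
  obtain a where a: "a \<in> forms1 A UNIV" "\<forall>\<^sub>F q in nhds p. a q = \<alpha> q"
    using form_at_global_extension[OF assms(1)] .
  obtain b where b: "b \<in> forms1 A UNIV" "\<forall>\<^sub>F q in nhds p. b q = \<beta> q"
    using form_at_global_extension[OF assms(3)] .
  obtain g where g: "\<And>q. smooth_at q g" "\<forall>\<^sub>F q in nhds p. g q = f q"
    using smooth_at_global_extension[OF assms(2)] by metis
  have gb: "(\<lambda>q. g q *\<^sub>R b q) \<in> forms1 A UNIV" using b(1) g(1) by (simp add: forms1_iff form_at_scale)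
  have ev: "\<forall>\<^sub>F q in nhds p. g q *\<^sub>R b q = f q *\<^sub>R \<beta> q"
    using b(2) g(2) by eventually_elim simp
  have "a p = \<alpha> p" "b p = \<beta> p" "g p = f p" "diff A g p = diff A f p"
    using a(2) b(2) g(2) eventually_nhds_x_imp_x diff_cong[OF g(2)] by blast+
  then show ?thesis
    using restr_eq[OF a(1) gb a(2) ev] restr_eq[OF a(1) b(1) a(2) b(2)] D_scale(2)[OF g(1) a(1) b(1)]
    by simp
qed

lemma restr_0:
  assumes "form_at p \<alpha>" shows "restr A D \<alpha> (\<lambda>q. 0) p = 0"
  using restr_scale[OF assms smooth_at_const[of p 0] form_at_0] by (simp add: diff_const)

lemma restr_sum:
  assumes "form_at p \<alpha>" "\<And>i. i \<in> J \<Longrightarrow> smooth_at p (f i)" "\<And>i. i \<in> J \<Longrightarrow> form_at p (\<xi> i)"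
  shows "restr A D \<alpha> (\<lambda>q. \<Sum>i\<in>J. f i q *\<^sub>R \<xi> i q) p
    = (\<Sum>i\<in>J. f i p *\<^sub>R restr A D \<alpha> (\<xi> i) p + (anchor (P p) (\<alpha> p) \<bullet> diff A (f i) p) *\<^sub>R \<xi> i p)"
  using assms(2,3)
  by (induction J rule: infinite_finite_induct)
    (auto simp: restr_add restr_scale restr_0 form_at_scale form_at_sum assms(1))

lemma restr_torsion_free:
  assumes "form_at p \<alpha>" "form_at p \<beta>"
  shows "restr A D \<alpha> \<beta> p - restr A D \<beta> \<alpha> p = koszul A P \<alpha> \<beta> p"
proof -
  obtain a where a: "a \<in> forms1 A UNIV" "\<forall>\<^sub>F q in nhds p. a q = \<alpha> q"
    using form_at_global_extension[OF assms(1)] .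
  obtain b where b: "b \<in> forms1 A UNIV" "\<forall>\<^sub>F q in nhds p. b q = \<beta> q"
    using form_at_global_extension[OF assms(2)] .
  show ?thesis
    using torsion_free a(1) b(1) koszul_cong[OF a(2) b(2)]
    by (simp add: torsion_free_def restr_eq[OF a(1) b(1) a(2) b(2)] restr_eq[OF b(1) a(1) b(2) a(2)])
qed

section \<open>Parallel forms and the Hawkins bracket\<close>

lemma parallel_form_at:
  assumes "parallel_on A D W \<xi>" "open W" "p \<in> W" shows "form_at p \<xi>"
  using assms unfolding parallel_on_def form_at_def by blast

lemma parallel_restr:
  assumes "parallel_on A D W \<xi>" "open W" "p \<in> W" "form_at p \<gamma>"
  shows "restr A D \<gamma> \<xi> p = 0"
proof -
  obtain g where g: "g \<in> forms1 A UNIV" "\<forall>\<^sub>F q in nhds p. g q = \<gamma> q"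
    using form_at_global_extension[OF assms(4)] .
  then have "g \<in> forms1 A W" using assms(2) by (simp add: forms1_iff)
  then have "restr A D g \<xi> p = 0" using assms(1,3) by (simp add: parallel_on_def)
  then show ?thesis using restr_cong[OF g(2), of \<xi> \<xi>] by simp
qed

lemma parallel_onI:
  assumes "open W" "\<And>p. p \<in> W \<Longrightarrow> form_at p \<xi>"
    and "\<And>p \<gamma>. p \<in> W \<Longrightarrow> form_at p \<gamma> \<Longrightarrow> restr A D \<gamma> \<xi> p = 0"
  shows "parallel_on A D W \<xi>"
  using assms by (simp add: parallel_on_def forms1_iff)

text \<open>The last term of the bracket cancels the first one, and \<D>_\<beta> \<alpha> vanishes
  near \<open>p\<close>, so its differential does too.\<close>

lemma hawkins_parallel:
  assumes \<alpha>: "parallel_on A D W \<alpha>" and \<beta>: "parallel_on A D W \<beta>" and W: "open W" "p \<in> W"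
  shows "hawkins A P D \<alpha> \<beta> p = - restr2 A P D \<beta> (ext_d A \<alpha>) p"
proof -
  \<comment> \<open>\<open>der_ext\<close> applies its operator only to the coordinate differentials
    of the selected chart, so agreement of the bracket and the connection on these is enough. There
    the torsion identity loses a term because \<alpha> is parallel.\<close>
  have "koszul A P \<alpha> (dcoord A (pchart A p) k) p = restr A D \<alpha> (dcoord A (pchart A p) k) p" for k
    using restr_torsion_free[OF parallel_form_at[OF \<alpha> W] form_at_dcoord[OF pchart_in]]
      parallel_restr[OF \<alpha> W form_at_dcoord[OF pchart_in]] by (metis diff_zero)
  then have "koszul2 A P \<alpha> (ext_d A \<beta>) p = restr2 A P D \<alpha> (ext_d A \<beta>) p"
    by (simp add: koszul2_def restr2_def der_ext_def)
  moreover have "ext_d A (restr A D \<beta> \<alpha>) p = ext_d A (\<lambda>q. 0) p"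
  proof (rule ext_d_cong)
    show "\<forall>\<^sub>F q in nhds p. restr A D \<beta> \<alpha> q = 0"
      using eventually_nhds_in_open[OF W]
      by eventually_elim (rule parallel_restr[OF \<alpha> W(1) _ parallel_form_at[OF \<beta> W(1)]])
  qed
  ultimately show ?thesis by (simp add: hawkins_def)
qed

text \<open>A derivation that kills the frame acts on the coefficients alone. Since
  \<open>der_ext\<close> is defined through the selected chart and not through the frame, this is
  obtained by expanding the frame in that chart and showing that all contributions of the expansion
  coefficients cancel.\<close>

lemma restr2_frame:
  fixes \<xi> :: "'d \<Rightarrow> 'm \<Rightarrow> real^'d" and g :: "'d \<Rightarrow> 'd \<Rightarrow> 'm \<Rightarrow> real"
  assumes \<beta>: "form_at p \<beta>" and \<xi>: "\<And>m. form_at p (\<xi> m)" and par: "\<And>m. restr A D \<beta> (\<xi> m) p = 0"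
    and g: "\<And>m n. smooth_at p (g m n)" and skew: "\<And>m n q. g n m q = - g m n q"
    and \<eta>: "\<forall>\<^sub>F q in nhds p. \<eta> q = (1/2) *\<^sub>R (\<Sum>m\<in>UNIV. \<Sum>n\<in>UNIV. g m n q *\<^sub>R wedge (\<xi> m q) (\<xi> n q))"
  shows "restr2 A P D \<beta> \<eta> p = (1/2) *\<^sub>R (\<Sum>m\<in>UNIV. \<Sum>n\<in>UNIV.
    (anchor (P p) (\<beta> p) \<bullet> diff A (g m n) p) *\<^sub>R wedge (\<xi> m p) (\<xi> n p))"
proof -
  define v d where "v = vcoord A (pchart A p)" and "d = dcoord A (pchart A p)"
  define X where "X = anchor (P p) (\<beta> p)"
  define x where "x m k q = \<xi> m q \<bullet> v k q" for m k q
  define comp where "comp k l q = v k q \<bullet> (\<eta> q *v v l q)" for k l q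
  define e where "e k = restr A D \<beta> (d k) p" for k
  have x: "smooth_at p (x m k)" for m k
    using form_atD[OF \<xi> pchart_in] by (simp add: x_def[abs_def] v_def)
  have flip: "(\<Sum>m\<in>UNIV. \<Sum>n\<in>UNIV. g m n q * (x m l q * x n k q))
      = - (\<Sum>m\<in>UNIV. \<Sum>n\<in>UNIV. g m n q * (x m k q * x n l q))" for k l q
  proof -
    have "(\<Sum>m\<in>UNIV. \<Sum>n\<in>UNIV. g m n q * (x m l q * x n k q))
        = (\<Sum>m\<in>UNIV. \<Sum>n\<in>UNIV. - (g m n q * (x m k q * x n l q)))"
      by (subst sum.swap, intro sum.cong refl) (metis skew minus_mult_left mult.commute)
    then show ?thesis by (simp add: sum_negf)
  qed
  have comp: "\<forall>\<^sub>F q in nhds p. comp k l q = (\<Sum>m\<in>UNIV. \<Sum>n\<in>UNIV. g m n q * (x m k q * x n l q))" for k l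
    using \<eta>
  proof eventually_elim
    case (elim q)
    have "comp k l q = (1/2) * ((\<Sum>m\<in>UNIV. \<Sum>n\<in>UNIV. g m n q * (x m k q * x n l q))
        - (\<Sum>m\<in>UNIV. \<Sum>n\<in>UNIV. g m n q * (x m l q * x n k q)))"
      unfolding comp_def elim matrix_pair_scaleR matrix_pair_sum wedge_pair x_def
      by (simp only: sum_subtractf right_diff_distrib)
    \<comment> \<open>The wedge gives a difference of two sums. By skewness of \<open>g\<close> they
      are opposite, which absorbs the factor 1/2.\<close>
    moreover have "u = s" if "u = (1/2) * (s - t)" "t = - s" for u s t :: real
      using that by simp
    ultimately show ?case using flip by blast
  qed
  have comp_p: "comp k l p = (\<Sum>m\<in>UNIV. \<Sum>n\<in>UNIV. g m n p * (x m k p * x n l p))" for k l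
    using eventually_nhds_x_imp_x[OF comp] .
  define Y where "Y m k = X \<bullet> diff A (x m k) p" for m k
  have Xcomp: "X \<bullet> diff A (comp k l) p = (\<Sum>m\<in>UNIV. \<Sum>n\<in>UNIV.
      (X \<bullet> diff A (g m n) p) * (x m k p * x n l p) + g m n p * (Y m k * x n l p + x m k p * Y n l))" for k l
    unfolding diff_cong[OF comp] using g x
    by (simp add: diff_sum diff_mult smooth_at_sum smooth_at_mult inner_add_right inner_sum_right
        Y_def algebra_simps)
  have \<xi>_eq: "\<xi> m p = (\<Sum>k\<in>UNIV. x m k p *\<^sub>R d k p)" for m
    using covector_expand[OF pchart_in, of "\<xi> m p"] by (simp add: x_def v_def d_def)
  \<comment> \<open>The vanishing of the derivative of \<open>\<xi> m\<close> along \<beta>, written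
    in the selected chart. It relates the unknown derivatives \<open>e k\<close> to the derivatives
    \<open>Y m k\<close> of the components.\<close>
  have zero: "(\<Sum>k\<in>UNIV. x m k p *\<^sub>R e k + Y m k *\<^sub>R d k p) = 0" for m
  proof -
    have "restr A D \<beta> (\<xi> m) p = restr A D \<beta> (\<lambda>q. \<Sum>k\<in>UNIV. x m k q *\<^sub>R d k q) p"
      by (rule restr_cong) (use eventually_covector_expand[OF pchart_in, where \<alpha> = "\<xi> m"] in
          \<open>auto simp: x_def v_def d_def\<close>)
    also have "\<dots> = (\<Sum>k\<in>UNIV. x m k p *\<^sub>R e k + Y m k *\<^sub>R d k p)"
      by (subst restr_sum[OF \<beta> x]) (simp_all add: d_def form_at_dcoord pchart_in e_def Y_def X_def)
    finally show ?thesis using par by simp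
  qed
  \<comment> \<open>For a fixed pair of frame forms, \<open>s\<close> stands for the differentiated
    coefficient and \<open>t\<close> for the coefficient itself. Adding two wedge products that
    contain the zero combination above produces exactly the Leibniz expansion, so every term with
    \<open>t\<close> disappears.\<close>
  have expand: "(\<Sum>k\<in>UNIV. \<Sum>l\<in>UNIV. (s * (x m k p * x n l p) + t * (Y m k * x n l p + x m k p * Y n l))
        *\<^sub>R wedge (d k p) (d l p) + (t * (x m k p * x n l p)) *\<^sub>R (wedge (e k) (d l p) + wedge (d k p) (e l)))
      = s *\<^sub>R wedge (\<xi> m p) (\<xi> n p)" for m n s t
  proof -
    have "s *\<^sub>R wedge (\<xi> m p) (\<xi> n p)
        = s *\<^sub>R wedge (\<xi> m p) (\<xi> n p)
          + t *\<^sub>R wedge (\<Sum>k\<in>UNIV. x m k p *\<^sub>R e k + Y m k *\<^sub>R d k p) (\<xi> n p)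
          + t *\<^sub>R wedge (\<xi> m p) (\<Sum>l\<in>UNIV. x n l p *\<^sub>R e l + Y n l *\<^sub>R d l p)"
      by (simp only: zero) simp
    also have "\<dots> = (\<Sum>k\<in>UNIV. \<Sum>l\<in>UNIV. s *\<^sub>R wedge (x m k p *\<^sub>R d k p) (x n l p *\<^sub>R d l p)
          + t *\<^sub>R wedge (x m k p *\<^sub>R e k + Y m k *\<^sub>R d k p) (x n l p *\<^sub>R d l p)
          + t *\<^sub>R wedge (x m k p *\<^sub>R d k p) (x n l p *\<^sub>R e l + Y n l *\<^sub>R d l p))"
      unfolding \<xi>_eq wedge_sum_sum by (simp only: scaleR_sum_right sum.distrib)
    also have "\<dots> = (\<Sum>k\<in>UNIV. \<Sum>l\<in>UNIV. (s * (x m k p * x n l p) + t * (Y m k * x n l p + x m k p * Y n l))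
        *\<^sub>R wedge (d k p) (d l p) + (t * (x m k p * x n l p)) *\<^sub>R (wedge (e k) (d l p) + wedge (d k p) (e l)))"
      by (intro sum.cong refl) (simp add: wedge_add wedge_scaleR algebra_simps)
    finally show ?thesis by simp
  qed
  have "restr2 A P D \<beta> \<eta> p = (1/2) *\<^sub>R (\<Sum>k\<in>UNIV. \<Sum>l\<in>UNIV. (X \<bullet> diff A (comp k l) p) *\<^sub>R wedge (d k p) (d l p)
      + comp k l p *\<^sub>R (wedge (e k) (d l p) + wedge (d k p) (e l)))"
    by (simp add: restr2_def der_ext_def Let_def X_def comp_def[abs_def] v_def d_def e_def)
  also have "\<dots> = (1/2) *\<^sub>R (\<Sum>k\<in>UNIV. \<Sum>l\<in>UNIV. \<Sum>m\<in>UNIV. \<Sum>n\<in>UNIV.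
      ((X \<bullet> diff A (g m n) p) * (x m k p * x n l p) + g m n p * (Y m k * x n l p + x m k p * Y n l))
        *\<^sub>R wedge (d k p) (d l p)
      + (g m n p * (x m k p * x n l p)) *\<^sub>R (wedge (e k) (d l p) + wedge (d k p) (e l)))"
    unfolding Xcomp comp_p scaleR_sum_left by (simp only: sum.distrib)
  also have "\<dots> = (1/2) *\<^sub>R (\<Sum>m\<in>UNIV. \<Sum>n\<in>UNIV. \<Sum>k\<in>UNIV. \<Sum>l\<in>UNIV.
      ((X \<bullet> diff A (g m n) p) * (x m k p * x n l p) + g m n p * (Y m k * x n l p + x m k p * Y n l))
        *\<^sub>R wedge (d k p) (d l p)
      + (g m n p * (x m k p * x n l p)) *\<^sub>R (wedge (e k) (d l p) + wedge (d k p) (e l)))"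
    by (subst sum_swap4) rule
  finally show ?thesis by (simp only: expand X_def)
qed

end

section \<open>Parallel frames adapted to a flat chart\<close>

text \<open>The complement itself no longer occurs. \<open>anchor_\<phi>\<close> and
  \<open>\<theta>_eq\<close> record what the computation takes from it, and the charts and frames
  are compared only on \<open>V\<close>.\<close>

locale flat_frame = torsion_free_connection A P D
  for A :: "('m::t2_space, 'd::finite) chart set" and P :: "'m \<Rightarrow> real^'d^'d"
    and D :: "('m \<Rightarrow> real^'d) \<Rightarrow> ('m \<Rightarrow> real^'d) \<Rightarrow> 'm \<Rightarrow> real^'d" +
  fixes c :: "('m, 'd) chart" and I :: "'d set" and V :: "'m set"
    and \<phi> :: "'d \<Rightarrow> 'm \<Rightarrow> real^'d" and a pinv :: "'d \<Rightarrow> 'd \<Rightarrow> 'm \<Rightarrow> real"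
  assumes c: "c \<in> A" and V: "open V" "V \<subseteq> fst c"
    and parallel: "\<And>k. parallel_on A D V (if k \<in> I then \<phi> k else dcoord A c k)"
    and anchor_\<phi>: "\<And>i q. i \<in> I \<Longrightarrow> q \<in> V \<Longrightarrow> anchor (P q) (\<phi> i q) = vcoord A c i q"
    and anchor_dcoord: "\<And>u q. u \<notin> I \<Longrightarrow> q \<in> V \<Longrightarrow> anchor (P q) (dcoord A c u q) = 0"
    and \<theta>_eq: "\<And>i q. i \<in> I \<Longrightarrow> q \<in> V \<Longrightarrow>
      dcoord A c i q + (\<Sum>u\<in>-I. a i u q *\<^sub>R dcoord A c u q) = (\<Sum>l\<in>I. pi_comp A P c i l q *\<^sub>R \<phi> l q)"
    and smooth_a: "\<And>i u q. i \<in> I \<Longrightarrow> u \<notin> I \<Longrightarrow> q \<in> V \<Longrightarrow> smooth_at q (a i u)"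
    and pinv_pi: "\<And>i j q. i \<in> I \<Longrightarrow> j \<in> I \<Longrightarrow> q \<in> V \<Longrightarrow>
      (\<Sum>k\<in>I. pinv i k q * pi_comp A P c k j q) = (if i = j then 1 else 0)"
begin

lemma V_dom: "q \<in> V \<Longrightarrow> q \<in> fst c" using V by blast

lemma pd_cong_V: "q \<in> V \<Longrightarrow> (\<And>q'. q' \<in> V \<Longrightarrow> f q' = g q') \<Longrightarrow> pd c k f q = pd c k g q"
  using V(1) by (intro pd_cong[OF c V_dom]) (auto simp: eventually_nhds)

lemma smooth_cong_V:
  "q \<in> V \<Longrightarrow> smooth_at q f \<Longrightarrow> (\<And>q'. q' \<in> V \<Longrightarrow> f q' = g q') \<Longrightarrow> smooth_at q g"
  using V(1) by (elim smooth_at_cong) (auto simp: eventually_nhds)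

lemma smooth_pd_V: "q \<in> V \<Longrightarrow> smooth_at q f \<Longrightarrow> smooth_at q (pd c k f)"
  using c V_dom by blast

definition \<xi> :: "'d \<Rightarrow> 'm \<Rightarrow> real^'d" where "\<xi> k = (if k \<in> I then \<phi> k else dcoord A c k)"

definition F :: "'d \<Rightarrow> 'd \<Rightarrow> 'm \<Rightarrow> real" where "F j n q = \<xi> j q \<bullet> vcoord A c n q"

text \<open>The coefficients of the frame dual to \<open>\<xi>\<close>, namely \<open>E\<^sub>n = - \<pi>\<^sub>\<sharp>(dx\<^sub>n)\<close> for \<open>n \<in> I\<close>, and
  \<open>E\<^sub>u = \<partial>/\<partial>y\<^sub>u - \<Sum>\<^sub>m A\<^sub>m\<^sup>u \<partial>/\<partial>x\<^sub>m\<close> for \<open>u \<notin> I\<close>.\<close>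

definition e :: "'d \<Rightarrow> 'd \<Rightarrow> 'm \<Rightarrow> real" where
  "e n m = (if m \<in> I then if n \<in> I then pi_comp A P c m n else (\<lambda>q. - a m n q)
    else (\<lambda>q. if m = n then 1 else 0))"

definition E :: "'d \<Rightarrow> 'm \<Rightarrow> real^'d" where "E n q = (\<Sum>m\<in>UNIV. e n m q *\<^sub>R vcoord A c m q)"

section \<open>Chart components of the frame and duality\<close>

lemma parallel_\<xi>: "parallel_on A D V (\<xi> k)"
  unfolding \<xi>_def by (rule parallel)

lemma form_at_\<xi>: "q \<in> V \<Longrightarrow> form_at q (\<xi> k)"
  by (rule parallel_form_at[OF parallel_\<xi> V(1)])

lemma anchor_\<xi>: "q \<in> V \<Longrightarrow> anchor (P q) (\<xi> k q) = (if k \<in> I then vcoord A c k q else 0)"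
  by (simp add: \<xi>_def anchor_\<phi> anchor_dcoord)

lemma smooth_F: "q \<in> V \<Longrightarrow> smooth_at q (F j n)"
  unfolding F_def[abs_def] by (rule form_atD[OF form_at_\<xi> c V_dom])

lemma smooth_e: "q \<in> V \<Longrightarrow> smooth_at q (e n m)"
  using c by (auto simp: e_def V_dom intro: smooth_at_pi_comp smooth_a)

lemma pd_e_transverse: "m \<notin> I \<Longrightarrow> pd c i (e n m) q = 0"
  by (simp add: e_def)

lemma inner_E: "b \<bullet> E n q = (\<Sum>m\<in>UNIV. (b \<bullet> vcoord A c m q) * e n m q)"
  by (simp add: E_def inner_sum_right mult.commute)

lemma sum_UNIV_split: "(\<Sum>m\<in>UNIV. f m) = (\<Sum>m\<in>I. f m) + (\<Sum>m\<in>-I. f m)"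
  for f :: "'d \<Rightarrow> 'b::comm_monoid_add"
  using sum.union_disjoint[of I "-I" f] by simp

lemma sum_leaf: "(\<And>m. m \<notin> I \<Longrightarrow> f m = 0) \<Longrightarrow> (\<Sum>m\<in>UNIV. f m) = (\<Sum>m\<in>I. f m)"
  for f :: "'d \<Rightarrow> 'b::comm_monoid_add"
  by (simp add: sum_UNIV_split)

lemma e_leaf_transverse: "k \<in> I \<Longrightarrow> m \<notin> I \<Longrightarrow> e k m q = 0"
  by (auto simp: e_def)

text \<open>Inverts \<open>\<theta>_eq\<close> with \<open>pinv\<close>. The components of \<phi>_j
  in the chart can then be read off: \<open>\<pi>\<^sup>j\<^sup>k\<close> along the leaves and
  \<open>\<Sum>\<^sub>k \<pi>\<^sup>j\<^sup>k A\<^sub>k\<^sup>u\<close> transversally.\<close>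

lemma \<phi>_eq:
  assumes "q \<in> V" "j \<in> I"
  shows "\<phi> j q = (\<Sum>k\<in>I. pinv j k q *\<^sub>R (dcoord A c k q + (\<Sum>u\<in>-I. a k u q *\<^sub>R dcoord A c u q)))"
proof -
  have "(\<Sum>k\<in>I. pinv j k q *\<^sub>R (dcoord A c k q + (\<Sum>u\<in>-I. a k u q *\<^sub>R dcoord A c u q)))
      = (\<Sum>k\<in>I. pinv j k q *\<^sub>R (\<Sum>l\<in>I. pi_comp A P c k l q *\<^sub>R \<phi> l q))"
    using assms by (simp add: \<theta>_eq)
  also have "\<dots> = (\<Sum>l\<in>I. (\<Sum>k\<in>I. pinv j k q * pi_comp A P c k l q) *\<^sub>R \<phi> l q)"
    by (simp add: scaleR_sum_right scaleR_sum_left) (rule sum.swap)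
  also have "\<dots> = (\<Sum>l\<in>I. if j = l then \<phi> l q else 0)"
    using assms by (intro sum.cong) (auto simp: pinv_pi)
  also have "\<dots> = \<phi> j q" using assms by simp
  finally show ?thesis by simp
qed

lemma F_leaf: "q \<in> V \<Longrightarrow> j \<in> I \<Longrightarrow> k \<in> I \<Longrightarrow> F j k q = pinv j k q"
proof -
  assume q: "q \<in> V" and j: "j \<in> I" and k: "k \<in> I"
  have "F j k q = (\<Sum>m\<in>I. pinv j m q * ((if m = k then 1 else 0) + (\<Sum>u\<in>-I. a m u q * (if u = k then 1 else 0))))"
    using q j by (simp add: F_def \<xi>_def \<phi>_eq inner_sum_left inner_add_left dcoord_vcoord[OF c V_dom])
  also have "\<dots> = (\<Sum>m\<in>I. pinv j m q * (if m = k then 1 else 0))"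
    using k by (intro sum.cong) (auto simp: mult_delta_right)
  also have "\<dots> = pinv j k q" using k by (simp add: mult_delta_right)
  finally show ?thesis .
qed

lemma F_transverse: "q \<in> V \<Longrightarrow> j \<in> I \<Longrightarrow> u \<notin> I \<Longrightarrow> F j u q = (\<Sum>k\<in>I. pinv j k q * a k u q)"
proof -
  assume q: "q \<in> V" and j: "j \<in> I" and u: "u \<notin> I"
  have "F j u q = (\<Sum>m\<in>I. pinv j m q * ((if m = u then 1 else 0) + (\<Sum>v\<in>-I. a m v q * (if v = u then 1 else 0))))"
    using q j by (simp add: F_def \<xi>_def \<phi>_eq inner_sum_left inner_add_left dcoord_vcoord[OF c V_dom])
  also have "\<dots> = (\<Sum>k\<in>I. pinv j k q * a k u q)"
    using u by (intro sum.cong) (auto simp: mult_delta_right)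
  finally show ?thesis .
qed

lemma F_dcoord: "q \<in> V \<Longrightarrow> u \<notin> I \<Longrightarrow> F u n q = (if u = n then 1 else 0)"
  by (simp add: F_def \<xi>_def dcoord_vcoord[OF c V_dom])

text \<open>For leafwise indices \<open>F j k\<close> is the pairing of \<phi>_j with the anchor of
  \<phi>_k, that is \<pi>(\<phi>_k, \<phi>_j).\<close>

lemma F_skew: "q \<in> V \<Longrightarrow> j \<in> I \<Longrightarrow> k \<in> I \<Longrightarrow> F k j q = - F j k q"
  using biv_skew[of q "\<phi> j q" "\<phi> k q"]
  by (simp add: F_def \<xi>_def anchor_\<phi>[symmetric] inner_anchor)

text \<open>Duality of \<open>\<xi>\<close> and \<open>E\<close> in chart components. For leafwise
  \<open>j\<close> and transverse \<open>n\<close>, the leafwise part of \<open>E n\<close> cancels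
  the transverse component of \<phi>_j; the two other cases use the inverse matrix and the closed
  coordinate forms.\<close>

lemma F_e: "q \<in> V \<Longrightarrow> (\<Sum>m\<in>UNIV. F j m q * e n m q) = (if j = n then 1 else 0)"
proof -
  assume q: "q \<in> V"
  consider "j \<in> I" "n \<in> I" | "j \<in> I" "n \<notin> I" | "j \<notin> I" by blast
  then show ?thesis
  proof cases
    case 1
    then have "(\<Sum>m\<in>UNIV. F j m q * e n m q) = (\<Sum>m\<in>I. pinv j m q * pi_comp A P c m n q)"
      using q by (subst sum_leaf) (auto simp: e_leaf_transverse F_leaf e_def intro!: sum.cong)
    then show ?thesis using 1 q by (simp add: pinv_pi)
  next
    case 2
    have "(\<Sum>m\<in>UNIV. F j m q * e n m q) = (\<Sum>m\<in>I. - (pinv j m q * a m n q))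
        + (\<Sum>m\<in>-I. F j m q * (if m = n then 1 else 0))"
      unfolding sum_UNIV_split using 2 q
      by (intro arg_cong2[of _ _ _ _ "(+)"] sum.cong) (auto simp: F_leaf e_def)
    also have "(\<Sum>m\<in>-I. F j m q * (if m = n then 1 else 0)) = F j n q"
      using 2 by (simp add: mult_delta_right)
    also have "F j n q = (\<Sum>m\<in>I. pinv j m q * a m n q)"
      using 2 q by (simp add: F_transverse)
    finally show ?thesis using 2 by (auto simp: sum_negf)
  next
    case 3
    then have "(\<Sum>m\<in>UNIV. F j m q * e n m q) = e n j q"
      using q by (simp add: F_dcoord mult_delta_left)
    then show ?thesis using 3 by (simp add: e_def)
  qed
qed

lemma \<xi>_E: "q \<in> V \<Longrightarrow> \<xi> j q \<bullet> E n q = (if j = n then 1 else 0)"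
  using F_e by (simp add: inner_E F_def)

lemma frame_expand: "q \<in> V \<Longrightarrow> (\<Sum>k\<in>UNIV. (b \<bullet> E k q) *\<^sub>R \<xi> k q) = b"
  by (rule biorthogonal_expand) (rule \<xi>_E)

text \<open>Differentiating the constant duality relation moves a derivative from the frame to the
  dual frame. Only leafwise \<open>n\<close> survive, since the transverse coefficients of the dual
  frame are constant.\<close>

lemma F_pd_e:
  assumes "q \<in> V"
  shows "(\<Sum>n\<in>UNIV. pd c m (F j n) q * e l n q) = - (\<Sum>n\<in>I. F j n q * pd c m (e l n) q)"
proof -
  have "0 = pd c m (\<lambda>q. if j = l then 1 else 0) q" by simp
  also have "\<dots> = pd c m (\<lambda>q. \<Sum>n\<in>UNIV. F j n q * e l n q) q"
    by (rule pd_cong_V[OF assms]) (simp add: F_e)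
  also have "\<dots> = (\<Sum>n\<in>UNIV. pd c m (F j n) q * e l n q) + (\<Sum>n\<in>UNIV. F j n q * pd c m (e l n) q)"
    using assms by (simp add: pd_sum[OF c V_dom] pd_mult[OF c V_dom] smooth_at_mult smooth_F smooth_e
        sum.distrib)
  also have "(\<Sum>n\<in>UNIV. F j n q * pd c m (e l n) q) = (\<Sum>n\<in>I. F j n q * pd c m (e l n) q)"
    by (rule sum_leaf) (simp add: pd_e_transverse)
  finally show ?thesis by simp
qed

text \<open>This is where the torsion enters: the forms \<open>\<phi>\<^sub>i\<close> are parallel, so their Koszul brackets vanish.\<close>

lemma F_koszul:
  assumes q: "q \<in> V" and ij: "i \<in> I" "j \<in> I"
  shows "pd c i (F j m) q - pd c j (F i m) q + pd c m (F i j) q = 0"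
proof -
  have "koszul A P (\<xi> i) (\<xi> j) q = 0"
    using restr_torsion_free[OF form_at_\<xi>[OF q] form_at_\<xi>[OF q], of i j]
      parallel_restr[OF parallel_\<xi> V(1) q form_at_\<xi>[OF q]] by simp
  then have "0 = (vcoord A c i q v* ext_d A (\<xi> j) q - vcoord A c j q v* ext_d A (\<xi> i) q
      + diff A (\<lambda>q. biv (P q) (\<xi> i q) (\<xi> j q)) q) \<bullet> vcoord A c m q"
    using q ij by (simp add: koszul_formula form_at_\<xi> anchor_\<xi>)
  also have "diff A (\<lambda>q. biv (P q) (\<xi> i q) (\<xi> j q)) q = diff A (F j i) q"
  proof (rule diff_cong)
    show "\<forall>\<^sub>F q in nhds q. biv (P q) (\<xi> i q) (\<xi> j q) = F j i q"
      using eventually_nhds_in_open[OF V(1) q]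
      by eventually_elim (use ij in \<open>simp add: inner_anchor[symmetric] anchor_\<xi> F_def\<close>)
  qed
  also have "(vcoord A c i q v* ext_d A (\<xi> j) q - vcoord A c j q v* ext_d A (\<xi> i) q
      + diff A (F j i) q) \<bullet> vcoord A c m q
      = (pd c i (F j m) q - pd c m (F j i) q) - (pd c j (F i m) q - pd c m (F i j) q) + pd c m (F j i) q"
    using ext_d_pair[OF c V_dom[OF q] form_at_\<xi>[OF q]] diff_vcoord[OF c V_dom[OF q] smooth_F[OF q]]
    by (simp add: inner_add_left inner_diff_left dot_lmul_matrix F_def[abs_def])
  finally show ?thesis by simp
qed

text \<open>The components of \<open>d\<xi>\<^sub>j\<close> in the chart; those of an arbitrary \<open>d\<alpha>\<close> in the frame \<open>\<xi>\<close> are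
  \<open>G \<alpha> k l = d\<alpha>(E\<^sub>k, E\<^sub>l)\<close>.\<close>

definition W :: "'d \<Rightarrow> 'd \<Rightarrow> 'd \<Rightarrow> 'm \<Rightarrow> real" where
  "W j m n q = pd c m (F j n) q - pd c n (F j m) q"

lemma W_skew: "W j n m q = - W j m n q"
  by (simp add: W_def)

lemma smooth_W: "q \<in> V \<Longrightarrow> smooth_at q (W j m n)"
  unfolding W_def[abs_def] by (intro smooth_at_diff smooth_pd_V smooth_F)

text \<open>Skewness of \<open>F\<close> in its leafwise indices rewrites the second term of
  \<open>W\<close>, after which \<open>F_koszul\<close> for the pair \<open>k\<close>,
  \<open>j\<close> leaves a single derivative.\<close>

lemma W_leaf:
  assumes "q \<in> V" "j \<in> I" "k \<in> I"
  shows "W j k n q = pd c j (F k n) q"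
proof -
  have "pd c n (F j k) q = pd c n (\<lambda>q. - F k j q) q"
    by (rule pd_cong_V[OF assms(1)]) (rule F_skew[OF _ assms(3,2)])
  then have "pd c n (F j k) q = - pd c n (F k j) q"
    using assms by (simp add: pd_minus[OF c V_dom] smooth_F)
  then show ?thesis using F_koszul[OF assms(1,3,2), of n] by (simp add: W_def)
qed

lemma W_leaf_right: "q \<in> V \<Longrightarrow> j \<in> I \<Longrightarrow> k \<in> I \<Longrightarrow> W j n k q = - pd c j (F k n) q"
  by (subst W_skew) (simp add: W_leaf)

definition G :: "('m \<Rightarrow> real^'d) \<Rightarrow> 'd \<Rightarrow> 'd \<Rightarrow> 'm \<Rightarrow> real" where
  "G \<alpha> k l q = (\<Sum>m\<in>UNIV. \<Sum>n\<in>UNIV. (pd c m (\<lambda>q. \<alpha> q \<bullet> vcoord A c n q) q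
    - pd c n (\<lambda>q. \<alpha> q \<bullet> vcoord A c m q) q) * (e k m q * e l n q))"

lemma G_skew: "G \<alpha> l k q = - G \<alpha> k l q"
proof -
  have "G \<alpha> l k q = (\<Sum>m\<in>UNIV. \<Sum>n\<in>UNIV. - ((pd c m (\<lambda>q. \<alpha> q \<bullet> vcoord A c n q) q
      - pd c n (\<lambda>q. \<alpha> q \<bullet> vcoord A c m q) q) * (e k m q * e l n q)))"
    unfolding G_def by (subst sum.swap, intro sum.cong refl) (simp add: algebra_simps)
  then show ?thesis by (simp add: G_def sum_negf)
qed

lemma smooth_G: "q \<in> V \<Longrightarrow> form_at q \<alpha> \<Longrightarrow> smooth_at q (G \<alpha> k l)"
  unfolding G_def[abs_def]
  by (intro smooth_at_sum smooth_at_mult smooth_at_diff smooth_pd_V smooth_e form_atD[OF _ c V_dom])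

section \<open>Components of exterior derivatives in the parallel frame\<close>

lemma ext_d_frame:
  assumes q: "q \<in> V" and \<alpha>: "form_at q \<alpha>"
  shows "ext_d A \<alpha> q = (1/2) *\<^sub>R (\<Sum>k\<in>UNIV. \<Sum>l\<in>UNIV. G \<alpha> k l q *\<^sub>R wedge (\<xi> k q) (\<xi> l q))"
proof -
  define d where "d n = dcoord A c n q" for n
  define w where "w m n = pd c m (\<lambda>q. \<alpha> q \<bullet> vcoord A c n q) q" for m n
  have 0: "ext_d A \<alpha> q = (\<Sum>n\<in>UNIV. \<Sum>m\<in>UNIV. w m n *\<^sub>R wedge (d m) (d n))"
    using form_atD[OF \<alpha> c V_dom[OF q]]
    by (simp add: ext_d_expand[OF c V_dom[OF q] \<alpha>] diff_expand[OF c V_dom[OF q]] wedge_sum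
        wedge_scaleR w_def d_def)
  have 1: "ext_d A \<alpha> q = (\<Sum>m\<in>UNIV. \<Sum>n\<in>UNIV. w m n *\<^sub>R wedge (d m) (d n))"
    unfolding 0 by (rule sum.swap)
  have 2: "ext_d A \<alpha> q = (\<Sum>m\<in>UNIV. \<Sum>n\<in>UNIV. - (w n m *\<^sub>R wedge (d m) (d n)))"
    unfolding 0 by (intro sum.cong refl) (subst wedge_skew, simp)
  \<comment> \<open>Adding the expansion to its version with exchanged indices antisymmetrizes the
    coefficients without ordering the indices. The factor 1/2 returns in the last step.\<close>
  have "ext_d A \<alpha> q + ext_d A \<alpha> q = (\<Sum>m\<in>UNIV. \<Sum>n\<in>UNIV. (w m n - w n m) *\<^sub>R wedge (d m) (d n))"
    by (subst (1) 1, subst 2) (simp add: sum.distrib[symmetric] scaleR_left_diff_distrib)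
  also have "\<dots> = (\<Sum>m\<in>UNIV. \<Sum>n\<in>UNIV. \<Sum>k\<in>UNIV. \<Sum>l\<in>UNIV.
      ((w m n - w n m) * (e k m q * e l n q)) *\<^sub>R wedge (\<xi> k q) (\<xi> l q))"
  proof -
    have "d m = (\<Sum>k\<in>UNIV. e k m q *\<^sub>R \<xi> k q)" for m
      using frame_expand[OF q, of "d m"]
      by (simp add: inner_E d_def dcoord_vcoord[OF c V_dom[OF q]] mult_delta_left)
    then have "wedge (d m) (d n) = (\<Sum>k\<in>UNIV. \<Sum>l\<in>UNIV. (e k m q * e l n q) *\<^sub>R wedge (\<xi> k q) (\<xi> l q))" for m n
      by (simp add: wedge_sum_sum wedge_scaleR mult.commute)
    then show ?thesis by (simp add: scaleR_sum_right)
  qed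
  also have "\<dots> = (\<Sum>k\<in>UNIV. \<Sum>l\<in>UNIV. G \<alpha> k l q *\<^sub>R wedge (\<xi> k q) (\<xi> l q))"
    by (subst sum_swap4) (simp add: G_def w_def scaleR_sum_left)
  finally show ?thesis by (metis (no_types) scaleR_half_double)
qed

lemma G_\<xi>: "G (\<xi> j) k l q = (\<Sum>m\<in>UNIV. \<Sum>n\<in>UNIV. W j m n q * (e k m q * e l n q))"
  by (simp add: G_def W_def F_def[abs_def])

lemma G_dcoord:
  assumes "q \<in> V" "u \<notin> I"
  shows "G (\<xi> u) k l q = 0"
proof -
  have "pd c m (F u n) q = pd c m (\<lambda>_. if u = n then 1 else 0) q" for m n
    by (rule pd_cong_V) (use assms F_dcoord in auto)
  then show ?thesis by (simp add: G_\<xi> W_def)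
qed

text \<open>The indices of \<open>F\<close> stand in the opposite order to \<open>F_e\<close>.
  Exchanging them costs the minus sign.\<close>

lemma e_F:
  assumes "q \<in> V" "k \<in> I" "n \<in> I"
  shows "(\<Sum>m\<in>I. e k m q * F m n q) = - (if k = n then 1 else 0)"
proof -
  have "(\<Sum>m\<in>I. e k m q * F m n q) = - (\<Sum>m\<in>I. F n m q * e k m q)"
    unfolding sum_negf[symmetric]
    by (intro sum.cong refl) (subst F_skew[OF assms(1,3)], simp_all)
  also have "(\<Sum>m\<in>I. F n m q * e k m q) = (\<Sum>m\<in>UNIV. F n m q * e k m q)"
    using assms by (intro sum_leaf[symmetric]) (simp add: e_leaf_transverse)
  finally show ?thesis using F_e[OF assms(1)] by auto
qed

text \<open>With \<open>E k\<close> tangent to the leaves, \<open>W_leaf\<close> replaces the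
  exterior derivative by derivatives along x_j, \<open>F_pd_e\<close> moves these to the dual frame,
  and \<open>e_F\<close> collapses the remaining sum. What is left is the derivative of
  \<open>\<pi>\<^sub>k\<^sub>l\<close> or of \<open>- A\<^sub>k\<^sup>l\<close>, according to the
  type of \<open>l\<close>.\<close>

lemma G_leaf:
  assumes q: "q \<in> V" and j: "j \<in> I" and k: "k \<in> I"
  shows "G (\<xi> j) k l q = pd c j (e l k) q"
proof -
  have "G (\<xi> j) k l q = (\<Sum>m\<in>I. \<Sum>n\<in>UNIV. W j m n q * (e k m q * e l n q))"
    unfolding G_\<xi> using k by (intro sum_leaf) (simp add: e_leaf_transverse)
  also have "\<dots> = (\<Sum>m\<in>I. e k m q * (\<Sum>n\<in>UNIV. pd c j (F m n) q * e l n q))"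
    using q j by (intro sum.cong refl) (simp add: W_leaf sum_distrib_left mult_ac)
  also have "\<dots> = (\<Sum>m\<in>I. e k m q * - (\<Sum>n\<in>I. F m n q * pd c j (e l n) q))"
    using F_pd_e[OF q] by simp
  also have "\<dots> = - (\<Sum>n\<in>I. (\<Sum>m\<in>I. e k m q * F m n q) * pd c j (e l n) q)"
    by (simp add: sum_distrib_left sum_distrib_right sum_negf mult.assoc) (rule sum.swap)
  also have "\<dots> = (\<Sum>n\<in>I. if k = n then pd c j (e l n) q else 0)"
    unfolding sum_negf[symmetric] using q k by (intro sum.cong) (auto simp: e_F)
  also have "\<dots> = pd c j (e l k) q" using k by simp
  finally show ?thesis .
qed

lemma e_pd_transverse:
  assumes u: "u \<notin> I"
  shows "(\<Sum>m\<in>UNIV. e u m q * pd c m f q) = pd c u f q - (\<Sum>l\<in>I. a l u q * pd c l f q)"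
proof -
  have "(\<Sum>m\<in>UNIV. e u m q * pd c m f q)
      = (\<Sum>m\<in>I. - (a m u q * pd c m f q)) + (\<Sum>m\<in>-I. (if m = u then 1 else 0) * pd c m f q)"
    unfolding sum_UNIV_split using u
    by (intro arg_cong2[of _ _ _ _ "(+)"] sum.cong) (auto simp: e_def)
  then show ?thesis using u by (simp add: mult_delta_left sum_negf)
qed

text \<open>This is minus the pairing of \<phi>_j with the Lie bracket of \<open>E u\<close> and
  \<open>E v\<close>, because \<phi>_j is constant on the dual frame. The relation
  \<open>W_leaf\<close> needs a leafwise argument, so the sums are evaluated directly:
  \<open>Ee\<close> identifies each half as \<open>pinv\<close> times the derivative of some
  \<open>a k v\<close> along \<open>E u\<close>.\<close>

lemma G_transverse:
  assumes q: "q \<in> V" and j: "j \<in> I" and uv: "u \<notin> I" "v \<notin> I"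
  shows "G (\<xi> j) u v q = - (\<Sum>k\<in>I. pinv j k q * (pd c v (a k u) q - pd c u (a k v) q
    + (\<Sum>l\<in>I. a l u q * pd c l (a k v) q - a l v q * pd c l (a k u) q)))"
proof -
  have Ee: "(\<Sum>m\<in>UNIV. e u m q * (\<Sum>n\<in>UNIV. pd c m (F j n) q * e v n q))
      = (\<Sum>k\<in>I. pinv j k q * (pd c u (a k v) q - (\<Sum>l\<in>I. a l u q * pd c l (a k v) q)))"
    if u: "u \<notin> I" and v: "v \<notin> I" for u v
  proof -
    have "(\<Sum>m\<in>UNIV. e u m q * (\<Sum>n\<in>UNIV. pd c m (F j n) q * e v n q))
        = (\<Sum>m\<in>UNIV. e u m q * (\<Sum>k\<in>I. pinv j k q * pd c m (a k v) q))"
    proof -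
      have "pd c m (e v k) q = - pd c m (a k v) q" if "k \<in> I" for k m
        using pd_minus[OF c V_dom[OF q] smooth_a[OF that v q]] that v by (simp add: e_def)
      then have "(\<Sum>n\<in>UNIV. pd c m (F j n) q * e v n q) = (\<Sum>k\<in>I. pinv j k q * pd c m (a k v) q)" for m
        using q j by (simp add: F_pd_e F_leaf sum_negf)
      then show ?thesis by simp
    qed
    also have "\<dots> = (\<Sum>k\<in>I. pinv j k q * (\<Sum>m\<in>UNIV. e u m q * pd c m (a k v) q))"
      by (simp add: sum_distrib_left mult_ac) (rule sum.swap)
    finally show ?thesis by (simp add: e_pd_transverse[OF u])
  qed
  have "G (\<xi> j) u v q = (\<Sum>m\<in>UNIV. e u m q * (\<Sum>n\<in>UNIV. pd c m (F j n) q * e v n q))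
      - (\<Sum>m\<in>UNIV. \<Sum>n\<in>UNIV. pd c n (F j m) q * (e u m q * e v n q))"
    by (simp add: G_\<xi> W_def sum_subtractf right_diff_distrib sum_distrib_left mult_ac)
  also have "(\<Sum>m\<in>UNIV. \<Sum>n\<in>UNIV. pd c n (F j m) q * (e u m q * e v n q))
      = (\<Sum>m\<in>UNIV. e v m q * (\<Sum>n\<in>UNIV. pd c m (F j n) q * e u n q))"
    by (subst sum.swap) (simp add: sum_distrib_left mult_ac)
  finally show ?thesis
    unfolding Ee[OF uv] Ee[OF uv(2,1)]
    by (simp add: sum_subtractf sum.distrib algebra_simps)
qed

text \<open>By \<open>F_koszul\<close>, the derivative of \<phi>_j along x_i minus that of \<phi>_i
  along x_j is the exact form - d(F i j). \<open>W\<close> is an exterior derivative in components,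
  and it annihilates exact forms.\<close>

lemma pd_W_commute:
  assumes q: "q \<in> V" and ij: "i \<in> I" "j \<in> I"
  shows "pd c i (W j m n) q = pd c j (W i m n) q"
proof -
  have dF: "pd c k (pd c l (F j m)) q = pd c l (pd c k (F j m)) q" for k l j m
    by (rule pd_commute[OF c V_dom[OF q] smooth_F[OF q]])
  have pd_W: "pd c k (W j m n) q = pd c k (pd c m (F j n)) q - pd c k (pd c n (F j m)) q" for k j m n
    unfolding W_def[abs_def] by (intro pd_diff[OF c V_dom[OF q]] smooth_pd_V smooth_F q)
  have key: "pd c m (pd c i (F j n)) q - pd c m (pd c j (F i n)) q = - pd c m (pd c n (F i j)) q" for m n
  proof -
    have "pd c m (pd c i (F j n)) q - pd c m (pd c j (F i n)) q
        = pd c m (\<lambda>q. pd c i (F j n) q - pd c j (F i n) q) q"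
      by (intro pd_diff[OF c V_dom[OF q], symmetric] smooth_pd_V smooth_F q)
    also have "\<dots> = pd c m (\<lambda>q. - pd c n (F i j) q) q"
      by (rule pd_cong_V[OF q]) (use F_koszul[OF _ ij, of _ n] in \<open>simp add: eq_neg_iff_add_eq_0\<close>)
    also have "\<dots> = - pd c m (pd c n (F i j)) q"
      by (intro pd_minus[OF c V_dom[OF q]] smooth_pd_V smooth_F q)
    finally show ?thesis .
  qed
  show ?thesis
    using key[of m n] key[of n m] dF[of i m j n] dF[of i n j m] dF[of j m i n] dF[of j n i m] dF[of m n i j]
    unfolding pd_W by simp
qed

text \<open>Since \<open>{\<phi>\<^sub>i, \<phi>\<^sub>j}\<close> is minus the derivative of \<open>d\<phi>\<^sub>i\<close> along \<open>\<phi>\<^sub>j\<close>, this is the symmetry of \<open>\<T>\<close>. The two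
  sums \<open>R i j\<close> and \<open>R j i\<close> come from differentiating the dual frame.\<close>

lemma pd_G_commute:
  assumes q: "q \<in> V" and ij: "i \<in> I" "j \<in> I"
  shows "pd c i (G (\<xi> j) k l) q = pd c j (G (\<xi> i) k l) q"
proof -
  define R where "R i j = (\<Sum>m\<in>I. \<Sum>n\<in>I. F m n q * (pd c i (e k m) q * pd c j (e l n) q))" for i j
  have expand: "pd c i (G (\<xi> j) k l) q
      = (\<Sum>m\<in>UNIV. \<Sum>n\<in>UNIV. pd c i (W j m n) q * (e k m q * e l n q)) - R i j - R j i"
    if "i \<in> I" "j \<in> I" for i j
  proof -
    have "pd c i (G (\<xi> j) k l) q = (\<Sum>m\<in>UNIV. \<Sum>n\<in>UNIV. pd c i (W j m n) q * (e k m q * e l n q)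
        + W j m n q * (pd c i (e k m) q * e l n q + e k m q * pd c i (e l n) q))"
      unfolding G_\<xi>[abs_def] using q
      by (simp add: pd_sum[OF c V_dom] pd_mult[OF c V_dom] smooth_at_sum smooth_at_mult smooth_W smooth_e)
    also have "\<dots> = (\<Sum>m\<in>UNIV. \<Sum>n\<in>UNIV. pd c i (W j m n) q * (e k m q * e l n q))
        + (\<Sum>m\<in>UNIV. pd c i (e k m) q * (\<Sum>n\<in>UNIV. W j m n q * e l n q))
        + (\<Sum>m\<in>UNIV. \<Sum>n\<in>UNIV. W j m n q * (e k m q * pd c i (e l n) q))"
      by (simp add: sum.distrib distrib_left sum_distrib_left mult_ac)
    also have "(\<Sum>m\<in>UNIV. pd c i (e k m) q * (\<Sum>n\<in>UNIV. W j m n q * e l n q)) = - R i j"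
    proof -
      have "(\<Sum>m\<in>UNIV. pd c i (e k m) q * (\<Sum>n\<in>UNIV. W j m n q * e l n q))
          = (\<Sum>m\<in>I. pd c i (e k m) q * (\<Sum>n\<in>UNIV. pd c j (F m n) q * e l n q))"
        using q that by (subst sum_leaf) (auto simp: pd_e_transverse W_leaf cong: sum.cong)
      also have "\<dots> = (\<Sum>m\<in>I. pd c i (e k m) q * - (\<Sum>n\<in>I. F m n q * pd c j (e l n) q))"
        by (simp add: F_pd_e[OF q])
      also have "\<dots> = - R i j"
        by (simp add: R_def sum_negf sum_distrib_left mult_ac)
      finally show ?thesis .
    qed
    also have "(\<Sum>m\<in>UNIV. \<Sum>n\<in>UNIV. W j m n q * (e k m q * pd c i (e l n) q)) = - R j i"
    proof -
      have "(\<Sum>m\<in>UNIV. \<Sum>n\<in>UNIV. W j m n q * (e k m q * pd c i (e l n) q))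
          = (\<Sum>n\<in>UNIV. \<Sum>m\<in>UNIV. W j m n q * (e k m q * pd c i (e l n) q))"
        by (rule sum.swap)
      also have "\<dots> = (\<Sum>n\<in>I. \<Sum>m\<in>UNIV. W j m n q * (e k m q * pd c i (e l n) q))"
        by (rule sum_leaf) (simp add: pd_e_transverse)
      also have "\<dots> = (\<Sum>n\<in>I. - (pd c i (e l n) q * (\<Sum>m\<in>UNIV. pd c j (F n m) q * e k m q)))"
        using q that by (intro sum.cong refl)
          (simp add: W_leaf_right W_leaf sum_distrib_left sum_negf mult_ac)
      also have "\<dots> = (\<Sum>n\<in>I. \<Sum>m\<in>I. F n m q * (pd c j (e k m) q * pd c i (e l n) q))"
        by (subst F_pd_e[OF q]) (simp add: sum_distrib_left mult_ac)
      also have "\<dots> = (\<Sum>n\<in>I. \<Sum>m\<in>I. - (F m n q * (pd c j (e k m) q * pd c i (e l n) q)))"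
        by (intro sum.cong refl) (subst F_skew[OF q], simp_all)
      also have "\<dots> = - R j i"
        unfolding R_def by (subst sum.swap) (simp add: sum_negf)
      finally show ?thesis .
    qed
    finally show ?thesis by simp
  qed
  show ?thesis
    unfolding expand[OF ij] expand[OF ij(2,1)] pd_W_commute[OF q ij] by simp
qed

section \<open>General parallel forms and the tensor\<close>

lemma smooth_coeff:
  assumes "q \<in> V" "form_at q \<alpha>" shows "smooth_at q (\<lambda>q. \<alpha> q \<bullet> E k q)"
  unfolding inner_E using assms
  by (intro smooth_at_sum smooth_at_mult smooth_e form_atD[OF _ c V_dom])

text \<open>Differentiating the frame expansion along \<phi>_i leaves only the derivatives of its
  coefficients along x_i. The sum vanishes, and pairing with the dual frame separates the
  terms.\<close>

lemma parallel_coeff: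
  assumes U: "open U" "U \<subseteq> V" "q \<in> U" and \<alpha>: "parallel_on A D U \<alpha>" and i: "i \<in> I"
  shows "pd c i (\<lambda>q. \<alpha> q \<bullet> E k q) q = 0"
proof -
  have q: "q \<in> V" using U by blast
  note \<alpha>q = parallel_form_at[OF \<alpha> U(1,3)]
  have "\<forall>\<^sub>F q in nhds q. \<alpha> q = (\<Sum>k\<in>UNIV. (\<alpha> q \<bullet> E k q) *\<^sub>R \<xi> k q)"
    using eventually_nhds_in_open[OF V(1) q] by eventually_elim (simp add: frame_expand)
  then have "restr A D (\<xi> i) \<alpha> q = restr A D (\<xi> i) (\<lambda>q. \<Sum>k\<in>UNIV. (\<alpha> q \<bullet> E k q) *\<^sub>R \<xi> k q) q"
    by (intro restr_cong) auto
  also have "\<dots> = (\<Sum>k\<in>UNIV. pd c i (\<lambda>q. \<alpha> q \<bullet> E k q) q *\<^sub>R \<xi> k q)"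
    using q i by (simp add: restr_sum form_at_\<xi> smooth_coeff \<alpha>q parallel_restr[OF parallel_\<xi> V(1)]
        anchor_\<xi> inner_commute[of "vcoord A c i q"] diff_vcoord[OF c V_dom])
  finally have "(\<Sum>k\<in>UNIV. pd c i (\<lambda>q. \<alpha> q \<bullet> E k q) q *\<^sub>R \<xi> k q) = 0"
    using parallel_restr[OF \<alpha> U(1,3) form_at_\<xi>[OF q]] by simp
  then have "(\<Sum>j\<in>UNIV. pd c i (\<lambda>q. \<alpha> q \<bullet> E j q) q *\<^sub>R \<xi> j q) \<bullet> E k q = 0" by simp
  then show ?thesis using q by (simp add: inner_sum_left \<xi>_E mult_delta_right)
qed

text \<open>\<open>h k l\<close> is the derivative along \<open>E k\<close> of the
  \<open>l\<close>-th frame coefficient of \<alpha>. It is 0 for leafwise \<open>k\<close>, and for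
  transverse \<open>k\<close> the leafwise part of \<open>E k\<close> contributes nothing. The
  difference of the two \<open>h\<close> terms is thus the component of the sum of df_j \<and>
  \<xi>_j.\<close>

lemma G_parallel:
  assumes U: "open U" "U \<subseteq> V" "q \<in> U" and \<alpha>: "parallel_on A D U \<alpha>"
  defines "h \<equiv> \<lambda>k l q. if k \<in> I then 0 else pd c k (\<lambda>q. \<alpha> q \<bullet> E l q) q"
  shows "G \<alpha> k l q = h k l q - h l k q + (\<Sum>j\<in>UNIV. (\<alpha> q \<bullet> E j q) * G (\<xi> j) k l q)"
proof -
  have q: "q \<in> V" using U by blast
  note \<alpha>q = parallel_form_at[OF \<alpha> U(1,3)]
  define f where "f j q = \<alpha> q \<bullet> E j q" for j q
  have f: "smooth_at q (f j)" for j
    using smooth_coeff[OF q \<alpha>q] by (simp add: f_def[abs_def])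
  have d\<alpha>: "pd c m (\<lambda>q. \<alpha> q \<bullet> vcoord A c n q) q
      = (\<Sum>j\<in>UNIV. pd c m (f j) q * F j n q) + (\<Sum>j\<in>UNIV. f j q * pd c m (F j n) q)" for m n
  proof -
    have "\<alpha> q \<bullet> vcoord A c n q = (\<Sum>j\<in>UNIV. f j q * F j n q)" if "q \<in> V" for q
      by (subst (1) frame_expand[OF that, of "\<alpha> q", symmetric])
        (simp add: inner_sum_left f_def F_def)
    then have "pd c m (\<lambda>q. \<alpha> q \<bullet> vcoord A c n q) q = pd c m (\<lambda>q. \<Sum>j\<in>UNIV. f j q * F j n q) q"
      by (rule pd_cong_V[OF q])
    then show ?thesis
      using q f by (simp add: pd_sum[OF c V_dom] pd_mult[OF c V_dom] smooth_at_mult smooth_F sum.distrib)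
  qed
  have Ef: "(\<Sum>m\<in>UNIV. e k m q * (\<Sum>n\<in>UNIV. (\<Sum>j\<in>UNIV. pd c m (f j) q * F j n q) * e l n q)) = h k l q" for k l
  proof -
    have "(\<Sum>n\<in>UNIV. (\<Sum>j\<in>UNIV. pd c m (f j) q * F j n q) * e l n q)
        = (\<Sum>j\<in>UNIV. pd c m (f j) q * (\<Sum>n\<in>UNIV. F j n q * e l n q))" for m
      by (simp add: sum_distrib_left sum_distrib_right mult.assoc) (rule sum.swap)
    also have "\<dots> m = pd c m (f l) q" for m
      by (simp add: F_e[OF q] mult_delta_right)
    finally have *: "(\<Sum>m\<in>UNIV. e k m q * (\<Sum>n\<in>UNIV. (\<Sum>j\<in>UNIV. pd c m (f j) q * F j n q) * e l n q))
        = (\<Sum>m\<in>UNIV. e k m q * pd c m (f l) q)" by simp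
    have zero: "pd c i (f l) q = 0" if "i \<in> I" for i
      using parallel_coeff[OF U \<alpha> that] by (simp add: f_def[abs_def])
    show ?thesis
    proof (cases "k \<in> I")
      case True
      then have "(\<Sum>m\<in>UNIV. e k m q * pd c m (f l) q) = 0"
        by (intro sum.neutral) (metis zero e_leaf_transverse mult_eq_0_iff)
      then show ?thesis using True by (simp add: * h_def)
    next
      case False
      then have "(\<Sum>m\<in>UNIV. e k m q * pd c m (f l) q) = h k l q"
        using zero by (simp add: e_pd_transverse h_def) (simp add: f_def[abs_def])
      then show ?thesis using * by simp
    qed
  qed
  have "G \<alpha> k l q = (\<Sum>m\<in>UNIV. e k m q * (\<Sum>n\<in>UNIV. (\<Sum>j\<in>UNIV. pd c m (f j) q * F j n q) * e l n q))
      - (\<Sum>n\<in>UNIV. \<Sum>m\<in>UNIV. e l n q * ((\<Sum>j\<in>UNIV. pd c n (f j) q * F j m q) * e k m q))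
      + (\<Sum>m\<in>UNIV. \<Sum>n\<in>UNIV. (\<Sum>j\<in>UNIV. f j q * W j m n q) * (e k m q * e l n q))"
  proof -
    define u w where "u m n = (\<Sum>j\<in>UNIV. pd c m (f j) q * F j n q)"
      and "w m n = (\<Sum>j\<in>UNIV. f j q * pd c m (F j n) q)" for m n
    have W: "(\<Sum>j\<in>UNIV. f j q * W j m n q) = w m n - w n m" for m n
      by (simp add: w_def W_def right_diff_distrib sum_subtractf)
    have swap: "(\<Sum>n\<in>UNIV. \<Sum>m\<in>UNIV. e l n q * (u n m * e k m q))
        = (\<Sum>m\<in>UNIV. \<Sum>n\<in>UNIV. e l n q * (u n m * e k m q))"
      by (rule sum.swap)
    show ?thesis
      unfolding G_def d\<alpha> W u_def[symmetric] w_def[symmetric] swap sum_distrib_left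
        sum_subtractf[symmetric] sum.distrib[symmetric]
      by (intro sum.cong refl) (simp add: algebra_simps)
  qed
  also have "(\<Sum>n\<in>UNIV. \<Sum>m\<in>UNIV. e l n q * ((\<Sum>j\<in>UNIV. pd c n (f j) q * F j m q) * e k m q)) = h l k q"
    unfolding sum_distrib_left[symmetric] by (rule Ef)
  also have "(\<Sum>m\<in>UNIV. \<Sum>n\<in>UNIV. (\<Sum>j\<in>UNIV. f j q * W j m n q) * (e k m q * e l n q))
      = (\<Sum>m\<in>UNIV. \<Sum>n\<in>UNIV. \<Sum>j\<in>UNIV. f j q * (W j m n q * (e k m q * e l n q)))"
    by (simp add: sum_distrib_right mult.assoc)
  also have "\<dots> = (\<Sum>j\<in>UNIV. f j q * G (\<xi> j) k l q)"
    unfolding G_\<xi> sum_distrib_left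
    by (subst (2) sum.swap, subst sum.swap) rule
  finally show ?thesis unfolding Ef by (simp add: f_def)
qed

lemma pd_G_parallel:
  assumes U: "open U" "U \<subseteq> V" "q \<in> U" and \<alpha>: "parallel_on A D U \<alpha>" and i: "i \<in> I"
  shows "pd c i (G \<alpha> k l) q = (\<Sum>j\<in>UNIV. (\<alpha> q \<bullet> E j q) * pd c i (G (\<xi> j) k l) q)"
proof -
  have q: "q \<in> V" using U by blast
  note \<alpha>q = parallel_form_at[OF \<alpha> U(1,3)]
  define h where "h k l q = (if k \<in> I then 0 else pd c k (\<lambda>q. \<alpha> q \<bullet> E l q) q)" for k l q
  have smooth_h: "smooth_at q (h k l)" for k l
    using smooth_pd_V[OF q smooth_coeff[OF q \<alpha>q]] by (cases "k \<in> I") (auto simp: h_def[abs_def])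
  \<comment> \<open>Coordinate derivatives commute, and the leafwise derivative of the coefficient
    vanishes in a whole neighbourhood, hence so does its transverse derivative.\<close>
  have pd_h: "pd c i (h k l) q = 0" for k l
  proof (cases "k \<in> I")
    case False
    then have "pd c i (h k l) q = pd c k (pd c i (\<lambda>q. \<alpha> q \<bullet> E l q)) q"
      using pd_commute[OF c V_dom[OF q] smooth_coeff[OF q \<alpha>q]] by (simp add: h_def[abs_def])
    also have "\<dots> = pd c k (\<lambda>_. 0) q"
      using U parallel_coeff[OF U(1,2) _ \<alpha> i]
      by (intro pd_cong[OF c V_dom[OF q]]) (auto simp: eventually_nhds)
    finally show ?thesis by simp
  qed (simp add: h_def[abs_def])
  have "pd c i (G \<alpha> k l) q
      = pd c i (\<lambda>q. h k l q - h l k q + (\<Sum>j\<in>UNIV. (\<alpha> q \<bullet> E j q) * G (\<xi> j) k l q)) q"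
    using U G_parallel[OF U(1,2) _ \<alpha>]
    by (intro pd_cong[OF c V_dom[OF q]]) (auto simp: eventually_nhds h_def)
  then show ?thesis
    using q smooth_h pd_h parallel_coeff[OF U \<alpha> i]
    by (simp add: pd_add[OF c V_dom] pd_diff[OF c V_dom] pd_sum[OF c V_dom] pd_mult[OF c V_dom]
        smooth_at_add smooth_at_diff smooth_at_sum smooth_at_mult smooth_G form_at_\<xi> smooth_coeff \<alpha>q)
qed

text \<open>The value that the tensor must have. It uses only the two covectors at the point and
  data of the frame, so equality with the bracket proves independence of the parallel
  extensions.\<close>

definition T_value :: "'m \<Rightarrow> real^'d \<Rightarrow> real^'d \<Rightarrow> real^'d^'d" where
  "T_value q s t = - ((1/2) *\<^sub>R (\<Sum>k\<in>UNIV. \<Sum>l\<in>UNIV. (\<Sum>i\<in>I. \<Sum>j\<in>UNIV.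
     (t \<bullet> E i q) * (s \<bullet> E j q) * pd c i (G (\<xi> j) k l) q) *\<^sub>R wedge (\<xi> k q) (\<xi> l q)))"

lemma hawkins_eq_T_value:
  assumes U: "open U" "q \<in> U" "q \<in> V" and par: "parallel_on A D U \<alpha>" "parallel_on A D U \<beta>"
  shows "hawkins A P D \<alpha> \<beta> q = T_value q (\<alpha> q) (\<beta> q)"
proof -
  note \<alpha>q = parallel_form_at[OF par(1) U(1,2)] and \<beta>q = parallel_form_at[OF par(2) U(1,2)]
  have UV: "open (U \<inter> V)" "U \<inter> V \<subseteq> V" "q \<in> U \<inter> V" using U V(1) by auto
  \<comment> \<open>The domain \<open>U\<close> comes from the description of the tensor and need
    not lie in \<open>V\<close>, where the frame lives.\<close>
  have \<alpha>: "parallel_on A D (U \<inter> V) \<alpha>"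
    using parallel_form_at[OF par(1) U(1)] parallel_restr[OF par(1) U(1)]
    by (intro parallel_onI[OF UV(1)]) auto
  have "anchor (P q) (\<beta> q) = anchor (P q) (\<Sum>k\<in>UNIV. (\<beta> q \<bullet> E k q) *\<^sub>R \<xi> k q)"
    using U by (simp add: frame_expand)
  also have "\<dots> = (\<Sum>k\<in>UNIV. (\<beta> q \<bullet> E k q) *\<^sub>R (if k \<in> I then vcoord A c k q else 0))"
    using U by (simp add: anchor_sum anchor_scaleR anchor_\<xi>)
  also have "\<dots> = (\<Sum>i\<in>I. (\<beta> q \<bullet> E i q) *\<^sub>R vcoord A c i q)"
    by (subst sum_leaf) auto
  finally have X: "anchor (P q) (\<beta> q) \<bullet> diff A g q = (\<Sum>i\<in>I. (\<beta> q \<bullet> E i q) * pd c i g q)"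
    if "smooth_at q g" for g
    using diff_vcoord[OF c V_dom[OF U(3)] that] by (simp add: inner_sum_left inner_commute[of "vcoord _ _ _ _"])
  have "restr2 A P D \<beta> (ext_d A \<alpha>) q = (1/2) *\<^sub>R (\<Sum>k\<in>UNIV. \<Sum>l\<in>UNIV.
      (anchor (P q) (\<beta> q) \<bullet> diff A (G \<alpha> k l) q) *\<^sub>R wedge (\<xi> k q) (\<xi> l q))"
  proof (rule restr2_frame[OF \<beta>q form_at_\<xi>[OF U(3)] parallel_restr[OF parallel_\<xi> V(1) U(3) \<beta>q]
        smooth_G[OF U(3) \<alpha>q] G_skew])
    show "\<forall>\<^sub>F q in nhds q. ext_d A \<alpha> q = (1/2) *\<^sub>R (\<Sum>k\<in>UNIV. \<Sum>l\<in>UNIV. G \<alpha> k l q *\<^sub>R wedge (\<xi> k q) (\<xi> l q))"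
      using form_at_eventually[OF \<alpha>q] eventually_nhds_in_open[OF V(1) U(3)]
      by eventually_elim (rule ext_d_frame)
  qed
  also have "\<dots> = (1/2) *\<^sub>R (\<Sum>k\<in>UNIV. \<Sum>l\<in>UNIV. (\<Sum>i\<in>I. \<Sum>j\<in>UNIV.
     (\<beta> q \<bullet> E i q) * (\<alpha> q \<bullet> E j q) * pd c i (G (\<xi> j) k l) q) *\<^sub>R wedge (\<xi> k q) (\<xi> l q))"
    by (simp add: X smooth_G U \<alpha>q pd_G_parallel[OF UV \<alpha>] sum_distrib_left mult.assoc)
  finally show ?thesis
    by (simp add: hawkins_parallel[OF par U(1,2)] T_value_def)
qed

text \<open>Constant coefficients suffice to extend any covector at a point of \<open>V\<close> to a
  parallel form, which gives the existence half of the description of the tensor.\<close>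

lemma parallel_combination: "parallel_on A D V (\<lambda>q. \<Sum>k\<in>UNIV. s k *\<^sub>R \<xi> k q)"
  by (intro parallel_onI[OF V(1)] form_at_sum form_at_scale)
    (auto simp: form_at_\<xi> restr_sum smooth_at_const diff_const parallel_restr[OF parallel_\<xi> V(1)])

lemma T_tensor_eq:
  assumes "q \<in> V" shows "T_tensor A P D q s t = T_value q s t"
  unfolding T_tensor_def
proof (rule the_equality)
  let ?\<alpha> = "\<lambda>q'. \<Sum>k\<in>UNIV. (s \<bullet> E k q) *\<^sub>R \<xi> k q'" and ?\<beta> = "\<lambda>q'. \<Sum>k\<in>UNIV. (t \<bullet> E k q) *\<^sub>R \<xi> k q'"
  have "T_value q s t = hawkins A P D ?\<alpha> ?\<beta> q"
    using hawkins_eq_T_value[OF V(1) assms assms parallel_combination parallel_combination]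
    by (simp add: frame_expand assms)
  then show "\<exists>W \<alpha> \<beta>. open W \<and> q \<in> W \<and> parallel_on A D W \<alpha> \<and> parallel_on A D W \<beta> \<and>
      \<alpha> q = s \<and> \<beta> q = t \<and> T_value q s t = hawkins A P D \<alpha> \<beta> q"
    using V(1) assms parallel_combination frame_expand[OF assms]
    by (intro exI[of _ V] exI[of _ ?\<alpha>] exI[of _ ?\<beta>]) auto
next
  fix \<eta>
  assume "\<exists>W \<alpha> \<beta>. open W \<and> q \<in> W \<and> parallel_on A D W \<alpha> \<and> parallel_on A D W \<beta> \<and>
      \<alpha> q = s \<and> \<beta> q = t \<and> \<eta> = hawkins A P D \<alpha> \<beta> q"
  then show "\<eta> = T_value q s t" using hawkins_eq_T_value assms by blast
qed

lemma T_tensor_dcoord: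
  assumes "q \<in> V" "u \<notin> I" shows "T_tensor A P D q (dcoord A c u q) b = 0"
proof -
  have "dcoord A c u q \<bullet> E j q = (if u = j then 1 else 0)" for j
    using \<xi>_E[OF assms(1), of u j] assms by (simp add: \<xi>_def)
  moreover have "pd c i (G (\<xi> u) k l) q = 0" for i k l
  proof -
    have "pd c i (G (\<xi> u) k l) q = pd c i (\<lambda>_. 0) q"
      using assms G_dcoord by (intro pd_cong_V) auto
    then show ?thesis by simp
  qed
  ultimately show ?thesis
    by (simp add: T_tensor_eq assms T_value_def mult_delta_left mult_delta_right)
qed

lemma T_tensor_\<phi>:
  assumes "q \<in> V" "i \<in> I" "j \<in> I"
  shows "T_tensor A P D q (\<phi> i q) (\<phi> j q)
    = - ((1/2) *\<^sub>R (\<Sum>k\<in>UNIV. \<Sum>l\<in>UNIV. pd c i (G (\<xi> j) k l) q *\<^sub>R wedge (\<xi> k q) (\<xi> l q)))"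
proof -
  have "\<phi> m q \<bullet> E n q = (if m = n then 1 else 0)" if "m \<in> I" for m n
    using \<xi>_E[OF assms(1), of m n] that by (simp add: \<xi>_def)
  then have "T_tensor A P D q (\<phi> i q) (\<phi> j q)
      = - ((1/2) *\<^sub>R (\<Sum>k\<in>UNIV. \<Sum>l\<in>UNIV. pd c j (G (\<xi> i) k l) q *\<^sub>R wedge (\<xi> k q) (\<xi> l q)))"
    using assms by (simp add: T_tensor_eq T_value_def mult_delta_left mult_delta_right)
  \<comment> \<open>The bracket differentiates the components of d\<phi>_i along x_j. The symmetry
    exchanges \<open>i\<close> and \<open>j\<close>, as the third group of terms in the formula
    requires.\<close>
  then show ?thesis by (simp add: pd_G_commute[OF assms])
qed

section \<open>The three groups of coefficients\<close>

lemma pd_G_leaf_leaf: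
  assumes "q \<in> V" "j \<in> I" "k \<in> I" "l \<in> I"
  shows "pd c i (G (\<xi> j) k l) q = pd c i (pd c j (pi_comp A P c k l)) q"
  by (rule pd_cong_V[OF assms(1)]) (use assms in \<open>simp add: G_leaf e_def\<close>)

lemma pd_G_leaf_transverse:
  assumes "q \<in> V" "j \<in> I" "k \<in> I" "u \<notin> I"
  shows "pd c i (G (\<xi> j) k u) q = - pd c i (pd c j (a k u)) q"
proof -
  have "G (\<xi> j) k u q' = - pd c j (a k u) q'" if "q' \<in> V" for q'
    using assms that by (simp add: G_leaf e_def pd_minus[OF c V_dom] smooth_a)
  then have "pd c i (G (\<xi> j) k u) q = pd c i (\<lambda>q. - pd c j (a k u) q) q"
    by (rule pd_cong_V[OF assms(1)])
  then show ?thesis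
    using assms by (simp add: pd_minus[OF c V_dom] smooth_pd_V smooth_a)
qed

text \<open>The inverse matrix is given only pointwise. Its smoothness comes from the identification
  of its entries with components of the smooth forms \<phi>_j.\<close>

lemma smooth_pinv:
  assumes "q \<in> V" "j \<in> I" "k \<in> I" shows "smooth_at q (pinv j k)"
  by (rule smooth_cong_V[OF assms(1) smooth_F[OF assms(1)]]) (rule F_leaf[OF _ assms(2,3)])

lemma pd_G_transverse:
  assumes q: "q \<in> V" and j: "j \<in> I" and uv: "u \<notin> I" "v \<notin> I"
  shows "pd c i (G (\<xi> j) u v) q = - (\<Sum>k\<in>I. pd c i (\<lambda>p. pinv j k p * (pd c v (a k u) p - pd c u (a k v) p
    + (\<Sum>l\<in>I. a l u p * pd c l (a k v) p - a l v p * pd c l (a k u) p))) q)"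
proof -
  have sm: "smooth_at q (\<lambda>p. pinv j k p * (pd c v (a k u) p - pd c u (a k v) p
      + (\<Sum>l\<in>I. a l u p * pd c l (a k v) p - a l v p * pd c l (a k u) p)))" if "k \<in> I" for k
    using assms that
    by (intro smooth_at_mult smooth_at_add smooth_at_diff smooth_at_sum smooth_pinv smooth_pd_V smooth_a)
  have "pd c i (G (\<xi> j) u v) q = pd c i (\<lambda>q. - (\<Sum>k\<in>I. pinv j k q * (pd c v (a k u) q - pd c u (a k v) q
    + (\<Sum>l\<in>I. a l u q * pd c l (a k v) q - a l v q * pd c l (a k u) q)))) q"
    by (rule pd_cong_V[OF q]) (rule G_transverse[OF _ j uv])
  then show ?thesis
    using q sm by (simp add: pd_minus[OF c V_dom] pd_sum[OF c V_dom] smooth_at_sum)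
qed

end

section \<open>Sums over ordered pairs of indices\<close>

lemma symmetric_sum_split:
  fixes f :: "'d::linorder \<Rightarrow> 'd \<Rightarrow> 'b::real_vector"
  assumes "finite J" "\<And>k l. f l k = f k l" "\<And>k. f k k = 0"
  shows "(\<Sum>k\<in>J. \<Sum>l\<in>J. f k l) = 2 *\<^sub>R (\<Sum>k\<in>J. \<Sum>l\<in>{l\<in>J. k < l}. f k l)"
proof -
  have "(\<Sum>l\<in>J. f k l) = (\<Sum>l\<in>{l\<in>J. k < l}. f k l) + (\<Sum>l\<in>{l\<in>J. l < k}. f k l)" for k
  proof -
    have "(\<Sum>l\<in>J. f k l) = (\<Sum>l\<in>{l\<in>J. k < l} \<union> {l\<in>J. l < k}. f k l)"
      by (rule sum.mono_neutral_right) (use assms in \<open>auto simp: not_less_iff_gr_or_eq\<close>)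
    then show ?thesis using assms(1) by (subst sum.union_disjoint[symmetric]) auto
  qed
  moreover have "(\<Sum>k\<in>J. \<Sum>l\<in>{l\<in>J. l < k}. f k l) = (\<Sum>k\<in>J. \<Sum>l\<in>{l\<in>J. k < l}. f k l)"
    by (subst sum.swap_restrict[OF assms(1,1)]) (simp add: assms(2))
  ultimately show ?thesis by (simp add: sum.distrib scaleR_2)
qed

text \<open>Coefficient and wedge are both skew, so each summand is symmetric and vanishes on the
  diagonal. Every unordered pair is counted twice, which the factor 1/2 compensates. Mixed pairs
  need no order, since the leafwise index is put in front.\<close>

lemma skew_sum_split:
  fixes g :: "'d::{finite,linorder} \<Rightarrow> 'd \<Rightarrow> real" and \<xi> :: "'d \<Rightarrow> real^'d::{finite,linorder}"
  assumes skew: "\<And>k l. g l k = - g k l"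
  shows "(1/2) *\<^sub>R (\<Sum>k\<in>UNIV. \<Sum>l\<in>UNIV. g k l *\<^sub>R wedge (\<xi> k) (\<xi> l))
    = (\<Sum>k\<in>I. \<Sum>l\<in>{l\<in>I. k < l}. g k l *\<^sub>R wedge (\<xi> k) (\<xi> l))
    + (\<Sum>k\<in>I. \<Sum>u\<in>-I. g k u *\<^sub>R wedge (\<xi> k) (\<xi> u))
    + (\<Sum>u\<in>-I. \<Sum>v\<in>{v\<in>-I. u < v}. g u v *\<^sub>R wedge (\<xi> u) (\<xi> v))"
proof -
  define f where "f k l = g k l *\<^sub>R wedge (\<xi> k) (\<xi> l)" for k l
  have f: "f l k = f k l" "f k k = 0" for k l
    using skew[of k l] wedge_skew[of "\<xi> k" "\<xi> l"] skew[of k k] by (simp_all add: f_def)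
  have split: "(\<Sum>k\<in>UNIV. h k) = (\<Sum>k\<in>I. h k) + (\<Sum>k\<in>-I. h k)" for h :: "'d \<Rightarrow> real^'d::{finite,linorder}^'d::{finite,linorder}"
    using sum.union_disjoint[of I "-I" h] by simp
  have "(\<Sum>u\<in>-I. \<Sum>k\<in>I. f u k) = (\<Sum>k\<in>I. \<Sum>u\<in>-I. f k u)"
    by (subst sum.swap) (simp add: f(1))
  then have "(\<Sum>k\<in>UNIV. \<Sum>l\<in>UNIV. f k l) = (\<Sum>k\<in>I. \<Sum>l\<in>I. f k l) + 2 *\<^sub>R (\<Sum>k\<in>I. \<Sum>u\<in>-I. f k u)
      + (\<Sum>u\<in>-I. \<Sum>v\<in>-I. f u v)"
    by (simp add: split sum.distrib scaleR_2)
  also have "(\<Sum>k\<in>I. \<Sum>l\<in>I. f k l) = 2 *\<^sub>R (\<Sum>k\<in>I. \<Sum>l\<in>{l\<in>I. k < l}. f k l)"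
    by (intro symmetric_sum_split f) simp
  also have "(\<Sum>u\<in>-I. \<Sum>v\<in>-I. f u v) = 2 *\<^sub>R (\<Sum>u\<in>-I. \<Sum>v\<in>{v\<in>-I. u < v}. f u v)"
    by (intro symmetric_sum_split f) simp
  finally show ?thesis by (simp add: f_def scaleR_add_right)
qed

theorem theorem3p9:
  fixes A :: "('m::{t2_space,second_countable_topology}, 'd::{finite,linorder}) chart set"
    and P :: "'m \<Rightarrow> real^'d::{finite,linorder}^'d::{finite,linorder}"
    and D :: "('m \<Rightarrow> real^'d::{finite,linorder}) \<Rightarrow> ('m \<Rightarrow> real^'d::{finite,linorder}) \<Rightarrow> 'm \<Rightarrow> real^'d::{finite,linorder}"
    and x :: 'm and r :: nat
    and W :: "'m set" and H :: "'m \<Rightarrow> (real^'d::{finite,linorder}) set"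
    and c :: "('m, 'd) chart" and I :: "'d set"
    and a :: "'d \<Rightarrow> 'd \<Rightarrow> 'm \<Rightarrow> real"
    and pinv :: "'d \<Rightarrow> 'd \<Rightarrow> 'm \<Rightarrow> real"
  assumes "smooth_structure A"
    and "poisson A P"
    and "contravariant_connection A P D"
    and "flat A P D" and "torsion_free A P D" and "F_reg_connection A P D"
    and "x \<in> reg_points P" and "rank (P x) = 2 * r"
    and "open W" and "x \<in> W" and "invariant_complement A P D W H"
    and "flat_chart A P D x c I" and "card I = 2 * r"
    and "\<exists>V. open V \<and> x \<in> V \<and> (\<forall>i\<in>I.
           (\<lambda>q. dcoord A c i q + (\<Sum>u\<in>-I. a i u q *\<^sub>R dcoord A c u q)) \<in> sections A V H)"
    and "\<forall>\<^sub>F q in nhds x. \<forall>i\<in>I. \<forall>j\<in>I.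
           (\<Sum>k\<in>I. pinv i k q * pi_comp A P c k j q) = (if i = j then 1 else 0) \<and>
           (\<Sum>k\<in>I. pi_comp A P c i k q * pinv k j q) = (if i = j then 1 else 0)"
  shows "\<forall>\<^sub>F q in nhds x.
    (\<forall>u\<in>-I. \<forall>b. T_tensor A P D q (dcoord A c u q) b = 0) \<and>
    (\<forall>i\<in>I. \<forall>j\<in>I. T_tensor A P D q (phi A P H c i q) (phi A P H c j q) =
       - (\<Sum>k\<in>I. \<Sum>l\<in>{l\<in>I. k < l}.
            pd c i (pd c j (pi_comp A P c k l)) q *\<^sub>R wedge (phi A P H c k q) (phi A P H c l q))
       + (\<Sum>k\<in>I. \<Sum>u\<in>-I.
            pd c i (pd c j (a k u)) q *\<^sub>R wedge (phi A P H c k q) (dcoord A c u q))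
       + (\<Sum>u\<in>-I. \<Sum>v\<in>{v\<in>-I. u < v}. \<Sum>k\<in>I.
            pd c i (\<lambda>p. pinv j k p * (pd c v (a k u) p - pd c u (a k v) p
                + (\<Sum>l\<in>I. a l u p * pd c l (a k v) p - a l v p * pd c l (a k u) p))) q
              *\<^sub>R wedge (dcoord A c u q) (dcoord A c v q)))"
proof -
  interpret torsion_free_connection A P D
    by unfold_locales (fact assms)+
  define \<theta> where "\<theta> i q = dcoord A c i q + (\<Sum>u\<in>-I. a i u q *\<^sub>R dcoord A c u q)" for i q
  have fol: "foliated_chart A P c I" "x \<in> fst c"
    using assms(12) by (auto simp: flat_chart_def)
  then have c: "c \<in> A" by (simp add: foliated_chart_def)
  \<comment> \<open>The defining property of a flat chart, applied to the given complement, supplies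
    the parallel frame.\<close>
  obtain V0 where V0: "open V0" "x \<in> V0" "V0 \<subseteq> W \<inter> fst c"
    and par: "\<And>k. parallel_on A D V0 (if k \<in> I then phi A P H c k else dcoord A c k)"
    using assms(9-12) unfolding flat_chart_def Let_def by meson
  obtain V1 where V1: "open V1" "x \<in> V1" "\<And>i. i \<in> I \<Longrightarrow> \<theta> i \<in> sections A V1 H"
    using assms(14) by (auto simp: \<theta>_def[abs_def])
  obtain V2 where V2: "open V2" "x \<in> V2" "\<And>q i j. q \<in> V2 \<Longrightarrow> i \<in> I \<Longrightarrow> j \<in> I \<Longrightarrow>
      (\<Sum>k\<in>I. pinv i k q * pi_comp A P c k j q) = (if i = j then 1 else 0)"
    using assms(15) unfolding eventually_nhds by auto
  define V where "V = V0 \<inter> V1 \<inter> V2"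
  have V: "open V" "x \<in> V" "V \<subseteq> fst c" "V \<subseteq> W" "V \<subseteq> V0" "V \<subseteq> V1" "V \<subseteq> V2"
    using V0 V1(1,2) V2(1,2) by (auto simp: V_def)
  have kernel: "anchor (P q) (dcoord A c u q) = 0" if "u \<notin> I" "q \<in> fst c" for u q
    using fol(1) that span_base[of "dcoord A c u q" "(\<lambda>u. dcoord A c u q) ` (- I)"]
    unfolding foliated_chart_def by blast
  have sub: "subspace (H q)" and ker: "\<And>b. b \<in> H q \<Longrightarrow> anchor (P q) b = 0 \<Longrightarrow> b = 0"
    and decomp: "\<And>b. \<exists>k h. anchor (P q) k = 0 \<and> h \<in> H q \<and> b = k + h" if "q \<in> W" for q
    using assms(11) that unfolding invariant_complement_def subbundle_def
    by (metis subspace_span, blast+)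
  \<comment> \<open>\<open>varpi\<close> is an \<open>inv_into\<close>, meaningful only on the image
    of \<open>H q\<close>. Splitting a preimage of the coordinate field into kernel and complement
    parts shows that the field lies in that image.\<close>
  have phi: "phi A P H c i q \<in> H q" "anchor (P q) (phi A P H c i q) = vcoord A c i q"
    if "i \<in> I" "q \<in> V" for i q
  proof -
    have q: "q \<in> W" "q \<in> fst c" using V that by auto
    have "vcoord A c i q \<in> range (anchor (P q))"
      using fol(1) q that(1) span_base[of "vcoord A c i q" "(\<lambda>i. vcoord A c i q) ` I"]
      unfolding foliated_chart_def by blast
    then obtain b where b: "vcoord A c i q = anchor (P q) b" by blast
    obtain k h where "anchor (P q) k = 0" "h \<in> H q" "b = k + h" using decomp[OF q(1)] by blast
    then have "vcoord A c i q \<in> anchor (P q) ` H q" using b by (auto simp: anchor_add)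
    then show "phi A P H c i q \<in> H q" "anchor (P q) (phi A P H c i q) = vcoord A c i q"
      unfolding phi_def varpi_def by (auto intro: inv_into_into f_inv_into_f)
  qed
  interpret flat_frame A P D c I V "phi A P H c" a pinv
  proof
    fix k
    show "parallel_on A D V (if k \<in> I then phi A P H c k else dcoord A c k)"
      using parallel_form_at[OF par V0(1), of _ k] parallel_restr[OF par V0(1), of _ _ k] V
      by (intro parallel_onI) auto
  next
    fix i q assume i: "i \<in> I" and q: "q \<in> V"
    then have qc: "q \<in> fst c" and qW: "q \<in> W" using V by auto
    have "anchor (P q) (\<theta> i q) = anchor (P q) (dcoord A c i q)"
      using qc by (simp add: \<theta>_def anchor_add anchor_sum anchor_scaleR kernel)
    also have "\<dots> = (\<Sum>l\<in>UNIV. pi_comp A P c i l q *\<^sub>R vcoord A c l q)"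
      by (rule anchor_dcoord_expand[OF c qc])
    \<comment> \<open>Transverse \<open>l\<close> drop out: by skewness \<pi>(dx_i, dy_l) is, up to
      sign, a pairing with the anchor of dy_l, which is 0.\<close>
    also have "\<dots> = (\<Sum>l\<in>I. pi_comp A P c i l q *\<^sub>R vcoord A c l q)"
      using biv_skew[of q] kernel[OF _ qc]
      by (intro sum.mono_neutral_right) (auto simp: pi_comp_def inner_anchor[symmetric])
    also have "\<dots> = anchor (P q) (\<Sum>l\<in>I. pi_comp A P c i l q *\<^sub>R phi A P H c l q)"
      using q phi by (simp add: anchor_sum anchor_scaleR)
    finally have "anchor (P q) (\<theta> i q - (\<Sum>l\<in>I. pi_comp A P c i l q *\<^sub>R phi A P H c l q)) = 0"
      by (simp add: anchor_diff)
    \<comment> \<open>The difference lies in the kernel of the anchor and in the complement, whose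
      intersection is trivial.\<close>
    moreover have "\<theta> i q - (\<Sum>l\<in>I. pi_comp A P c i l q *\<^sub>R phi A P H c l q) \<in> H q"
      using V1(3)[OF i] q V phi
      by (intro subspace_diff[OF sub[OF qW]] subspace_sum[OF sub[OF qW]] subspace_scale[OF sub[OF qW]])
        (auto simp: sections_def)
    ultimately show "dcoord A c i q + (\<Sum>u\<in>-I. a i u q *\<^sub>R dcoord A c u q)
        = (\<Sum>l\<in>I. pi_comp A P c i l q *\<^sub>R phi A P H c l q)"
      using ker[OF qW] by (fastforce simp: \<theta>_def)
  next
    fix i u q assume i: "i \<in> I" and u: "u \<notin> I" and q: "q \<in> V"
    have "form_at q (\<theta> i)"
      using V1(1) V1(3)[OF i] q V by (auto simp: sections_def forms1_iff)
    then have "smooth_at q (\<lambda>q. \<theta> i q \<bullet> vcoord A c u q)"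
      using c q V by (intro form_atD) auto
    \<comment> \<open>The function \<open>a i u\<close> is a chart component of a smooth section,
      which is the source of its smoothness.\<close>
    moreover have "\<theta> i q \<bullet> vcoord A c u q = a i u q" if "q \<in> fst c" for q
      using i u that by (auto simp: \<theta>_def inner_add_left inner_sum_left dcoord_vcoord[OF c] mult_delta_right)
    ultimately show "smooth_at q (a i u)"
      by (elim smooth_at_cong) (use V q in \<open>auto intro!: eventually_mono[OF eventually_dom[OF c]]\<close>)
  qed (use c V V2 phi kernel in auto)
  have "T_tensor A P D q (phi A P H c i q) (phi A P H c j q) =
       - (\<Sum>k\<in>I. \<Sum>l\<in>{l\<in>I. k < l}.
            pd c i (pd c j (pi_comp A P c k l)) q *\<^sub>R wedge (phi A P H c k q) (phi A P H c l q))
       + (\<Sum>k\<in>I. \<Sum>u\<in>-I.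
            pd c i (pd c j (a k u)) q *\<^sub>R wedge (phi A P H c k q) (dcoord A c u q))
       + (\<Sum>u\<in>-I. \<Sum>v\<in>{v\<in>-I. u < v}. \<Sum>k\<in>I.
            pd c i (\<lambda>p. pinv j k p * (pd c v (a k u) p - pd c u (a k v) p
                + (\<Sum>l\<in>I. a l u p * pd c l (a k v) p - a l v p * pd c l (a k u) p))) q
              *\<^sub>R wedge (dcoord A c u q) (dcoord A c v q))"
    if q: "q \<in> V" and ij: "i \<in> I" "j \<in> I" for q i j
  proof -
    have skew: "pd c i (G (\<xi> j) l k) q = - pd c i (G (\<xi> j) k l) q" for k l
    proof -
      have "pd c i (G (\<xi> j) l k) q = pd c i (\<lambda>q. - G (\<xi> j) k l q) q"
        by (rule pd_cong_V[OF q]) (rule G_skew)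
      then show ?thesis using q by (simp add: pd_minus[OF c V_dom] smooth_G form_at_\<xi>)
    qed
    have \<xi>: "k \<in> I \<Longrightarrow> \<xi> k q = phi A P H c k q" "k \<notin> I \<Longrightarrow> \<xi> k q = dcoord A c k q" for k
      by (simp_all add: \<xi>_def)
    have "(\<Sum>k\<in>I. \<Sum>l\<in>{l\<in>I. k < l}. pd c i (G (\<xi> j) k l) q *\<^sub>R wedge (\<xi> k q) (\<xi> l q))
        = (\<Sum>k\<in>I. \<Sum>l\<in>{l\<in>I. k < l}.
            pd c i (pd c j (pi_comp A P c k l)) q *\<^sub>R wedge (phi A P H c k q) (phi A P H c l q))"
      using q ij by (intro sum.cong refl) (simp add: pd_G_leaf_leaf \<xi>)
    moreover have "(\<Sum>k\<in>I. \<Sum>u\<in>-I. pd c i (G (\<xi> j) k u) q *\<^sub>R wedge (\<xi> k q) (\<xi> u q))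
        = - (\<Sum>k\<in>I. \<Sum>u\<in>-I.
            pd c i (pd c j (a k u)) q *\<^sub>R wedge (phi A P H c k q) (dcoord A c u q))"
      unfolding sum_negf[symmetric]
      using q ij by (intro sum.cong refl) (simp add: pd_G_leaf_transverse \<xi>)
    moreover have "(\<Sum>u\<in>-I. \<Sum>v\<in>{v\<in>-I. u < v}. pd c i (G (\<xi> j) u v) q *\<^sub>R wedge (\<xi> u q) (\<xi> v q))
        = - (\<Sum>u\<in>-I. \<Sum>v\<in>{v\<in>-I. u < v}. \<Sum>k\<in>I.
            pd c i (\<lambda>p. pinv j k p * (pd c v (a k u) p - pd c u (a k v) p
                + (\<Sum>l\<in>I. a l u p * pd c l (a k v) p - a l v p * pd c l (a k u) p))) q
              *\<^sub>R wedge (dcoord A c u q) (dcoord A c v q))"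
      unfolding sum_negf[symmetric] scaleR_minus_left[symmetric] scaleR_sum_left[symmetric]
      using q ij by (intro sum.cong refl) (simp add: pd_G_transverse \<xi> sum_negf)
    ultimately show ?thesis
      unfolding T_tensor_\<phi>[OF q ij] skew_sum_split[of "\<lambda>k l. pd c i (G (\<xi> j) k l) q", OF skew, where I = I]
      by simp
  qed
  moreover have "\<forall>\<^sub>F q in nhds x. q \<in> V" using V(1) \<open>x \<in> V\<close> by (rule eventually_nhds_in_open)
  ultimately show ?thesis
    using T_tensor_dcoord by (auto elim!: eventually_mono)
qed

end
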